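(* Let $1<p<\infty$, $0<q<p$ and $\alpha=\frac1q-\frac1p$. For $\beta\in\mathbb R$ there exists a constant $C=C(\beta)>0$ such that, for any sufficiently smooth functions $b\in\Lambda_\alpha(\mathbb R)$ and $f\in H^q(\mathbb R)$, $$\Vert\mathcal H_\beta(b,f)\Vert_{H^p(\mathbb R)}\le C\,\Vert f\Vert_{H^q(\mathbb R)}\,\Vert b\Vert_{\Lambda_\alpha(\mathbb R)}.$$ Furthermore, $C(\beta)$ is uniformly bounded when $\beta$ lies in a compact set of $\mathbb R$.
   Context: For $\beta\in\mathbb R$, $b\in\Lambda_\alpha(\mathbb R)$ and $f\in H^q(\mathbb R)$, $$\mathcal H_\beta(b,f)(x):=\int_{-\infty}^{\infty}\left[b\big(x+\beta(s-x)\big)-b(x)\right]f(s)\,\frac{ds}{x-s}.$$ $\Lambda_\alpha(\mathbb R)$, $\alpha>0$, is the usual Lipschitz space of order $\alpha$ on $\mathbb R$, with its usual norm. $H^p(\mathbb R)$, $p>0$, is the real Hardy space on the line. The constant $C(\beta)$ does not depend on $b$ and $f$; it may depend on $p,q$. *)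

theory Defs
  imports "HOL-Analysis.Analysis"
begin

subsection \<open>Derivatives and smoothness on the line\<close>

definition nth_deriv :: "nat \<Rightarrow> (real \<Rightarrow> 'a::real_normed_vector) \<Rightarrow> real \<Rightarrow> 'a" where
  "nth_deriv k f = ((\<lambda>g x. vector_derivative g (at x)) ^^ k) f"

definition C_k :: "nat \<Rightarrow> (real \<Rightarrow> 'a::real_normed_vector) \<Rightarrow> bool" where
  "C_k n f \<longleftrightarrow>
     (\<forall>k<n. \<forall>x. nth_deriv k f differentiable (at x)) \<and> continuous_on UNIV (nth_deriv n f)"

definition schwartz :: "(real \<Rightarrow> complex) \<Rightarrow> bool" where
  "schwartz \<phi> \<longleftrightarrow>
     (\<forall>k x. nth_deriv k \<phi> differentiable (at x)) \<and>
     (\<forall>m k. bounded (range (\<lambda>x. (1 + \<bar>x\<bar>) ^ m *\<^sub>R nth_deriv k \<phi> x)))"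


subsection \<open>Lipschitz spaces\<close>

definition fwd_diff :: "real \<Rightarrow> (real \<Rightarrow> complex) \<Rightarrow> real \<Rightarrow> complex" where
  "fwd_diff h b x = b (x + h) - b x"

text \<open>
  The homogeneous norm of order \<open>\<alpha> > 0\<close>, with differences of order \<open>\<lfloor>\<alpha>\<rfloor> + 1\<close>. For
  \<open>\<alpha> < 1\<close> this is the Hoelder seminorm; \<open>\<alpha> = 1\<close> is the Zygmund class. It vanishes exactly on the
  polynomials of degree at most \<open>\<alpha>\<close>.
\<close>

definition lip_norm :: "real \<Rightarrow> (real \<Rightarrow> complex) \<Rightarrow> ennreal" where
  "lip_norm \<alpha> b =
     (SUP x. SUP h\<in>UNIV - {0}.
        ennreal (norm ((fwd_diff h ^^ (nat \<lfloor>\<alpha>\<rfloor> + 1)) b x) / \<bar>h\<bar> powr \<alpha>))"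

definition lip_space :: "real \<Rightarrow> (real \<Rightarrow> complex) set" where
  "lip_space \<alpha> = {b. continuous_on UNIV b \<and> lip_norm \<alpha> b < \<infinity>}"


subsection \<open>Real Hardy spaces\<close>

text \<open>Functions that act on Schwartz functions, by absolutely convergent integration, as tempered
  distributions.\<close>

definition tempered_fun :: "(real \<Rightarrow> complex) \<Rightarrow> bool" where
  "tempered_fun f \<longleftrightarrow>
     f \<in> borel_measurable lborel \<and> (\<exists>m::nat. integrable lborel (\<lambda>x. f x /\<^sub>R (1 + \<bar>x\<bar>) ^ m))"

definition test_class :: "nat \<Rightarrow> (real \<Rightarrow> complex) set" where
  "test_class n =
     {\<phi>. schwartz \<phi> \<and>
         (LINT x|lborel. (1 + \<bar>x\<bar>) ^ n * (\<Sum>k\<le>n + 1. norm (nth_deriv k \<phi> x))) \<le> 1}"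

text \<open>The supremum of \<open>\<bar>(\<phi>\<^sub>t * f)(y)\<bar>\<close> over test functions \<open>\<phi>\<close>, over \<open>t > 0\<close> and over \<open>\<bar>y - x\<bar> < t\<close>,
  where \<open>\<phi>\<^sub>t(z) = \<phi>(z/t)/t\<close>.\<close>

definition grand_max :: "nat \<Rightarrow> (real \<Rightarrow> complex) \<Rightarrow> real \<Rightarrow> ennreal" where
  "grand_max n f x =
     (SUP \<phi>\<in>test_class n. SUP t\<in>{0<..}. SUP y\<in>{x - t<..<x + t}.
        ennreal (norm (LINT z|lborel. (\<phi> ((y - z) / t) /\<^sub>R t) * f z)))"

definition epowr :: "ennreal \<Rightarrow> real \<Rightarrow> ennreal" where
  "epowr u a = (if u = \<infinity> then \<infinity> else ennreal (enn2real u powr a))"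

text \<open>
  The norm (a quasi-norm for \<open>p < 1\<close>) is the \<open>L\<^sup>p\<close> norm of the grand maximal function.
  The order \<open>\<lfloor>1/p\<rfloor> + 1\<close> of the test class is the usual one; any larger
  order gives the same space with an equivalent norm.
\<close>

definition hardy_norm :: "real \<Rightarrow> (real \<Rightarrow> complex) \<Rightarrow> ennreal" where
  "hardy_norm p f =
     epowr (\<integral>\<^sup>+x. epowr (grand_max (nat \<lfloor>1 / p\<rfloor> + 1) f x) p \<partial>lborel) (1 / p)"

definition hardy_space :: "real \<Rightarrow> (real \<Rightarrow> complex) set" where
  "hardy_space p = {f. tempered_fun f \<and> hardy_norm p f < \<infinity>}"


subsection \<open>The operator\<close>

definition H_integrand ::
    "real \<Rightarrow> (real \<Rightarrow> complex) \<Rightarrow> (real \<Rightarrow> complex) \<Rightarrow> real \<Rightarrow> real \<Rightarrow> complex" where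
  "H_integrand \<beta> b f x s = (b (x + \<beta> * (s - x)) - b x) * f s / of_real (x - s)"

definition H_op ::
    "real \<Rightarrow> (real \<Rightarrow> complex) \<Rightarrow> (real \<Rightarrow> complex) \<Rightarrow> real \<Rightarrow> complex" where
  "H_op \<beta> b f x = (LINT s|lborel. H_integrand \<beta> b f x s)"

end

theory Submission
  imports Defs
begin

text \<open>
  Since \<open>p > 1\<close>, the Hardy--Littlewood maximal theorem reduces the claim to an \<open>L\<^sup>p\<close> bound for
  \<open>H_op \<beta> b f\<close>. For \<open>q \<le> 1\<close>, write \<open>b\<close> as the sum over \<open>j\<close> of differences of its mollifications at
  the scales \<open>2 powr j\<close> and \<open>2 powr (j + 1)\<close>; the derivatives of the mollifier are differences of
  order \<open>m\<close>, so these pieces are controlled by the differences of \<open>b\<close> alone. For each piece, the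
  kernel of the operator splits into bumps of width \<open>2 powr j\<close>, and the pairing of \<open>f\<close> with a bump is
  bounded by the infimum of the grand maximal function over an interval of that length. Summing
  over the dyadic level sets of the grand maximal function with Minkowski's inequality gives the
  bound without an atomic decomposition. For \<open>q > 1\<close> the operator is dominated by the fractional
  integral of order \<open>\<alpha>\<close> of the modulus of \<open>f\<close>.
\<close>

text \<open>The seminorm ignores polynomials of degree at most \<alpha>, so \<open>b\<close> and the
  low derivatives of its mollifications have no global bound. Only derivatives of order at least
  \<open>m\<close> and differences between consecutive scales are controlled. A polynomial part
  therefore survives in the coarsest mollification and has to be beaten by the size of
  \<open>f\<close>; this uses \<alpha> < 1/q. What replaces atoms: a bump of width \<open>h\<close>
  pairs with \<open>f\<close> to at most a constant times \<open>h\<close> times the infimum of the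
  grand maximal function F over a ball of radius \<open>h\<close>. If that infimum exceeds 2^k, the
  ball lies in E_k = {F > 2^k}, so \<open>h\<close> is at most |E_k|. The level set cuts off the
  scales, as the support of an atom would. The potential of E_k then has L^p norm at most a constant
  times |E_k|^(\<alpha> + 1/p) = |E_k|^(1/q), and for q \<le> 1 the sum of 2^k |E_k|^(1/q) is at
  most the power 1/q of the sum of 2^(kq) |E_k|. For q > 1 this last step fails, but then \<alpha> <
  1 and first differences suffice. Every \<beta> comes from the chain rule or from the size of a
  first difference, so C(\<beta>) can be taken polynomial in |\<beta>|.\<close>

section \<open>Functions carried together with all their derivatives\<close>

definition dseq :: "(nat \<Rightarrow> real \<Rightarrow> 'a::real_normed_vector) \<Rightarrow> bool" where
  "dseq D \<longleftrightarrow> (\<forall>k x. (D k has_vector_derivative D (Suc k) x) (at x))"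

lemma dseqD: "dseq D \<Longrightarrow> (D k has_vector_derivative D (Suc k) x) (at x within S)"
  unfolding dseq_def by (blast intro: has_vector_derivative_at_within)

lemma dseq_continuous: "dseq D \<Longrightarrow> continuous_on S (D k)"
  by (meson continuous_on_vector_derivative dseqD)

lemma dseq_continuous2:
  "dseq D \<Longrightarrow> continuous_on S f \<Longrightarrow> continuous_on S (\<lambda>x. D k (f x))"
  by (rule continuous_on_compose2[OF dseq_continuous[where S=UNIV]]) auto

text \<open>Derivatives are carried as data, so that no iterated \<open>vector_derivative\<close>
  has to be computed; this returns to \<open>nth_deriv\<close> where the test class asks for
  it.\<close>

lemma dseq_nth_deriv: "dseq D \<Longrightarrow> nth_deriv k (D 0) = D k"
proof (induction k)
  case (Suc k)
  have "nth_deriv (Suc k) (D 0) = (\<lambda>x. vector_derivative (D k) (at x))"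
    using Suc by (simp add: nth_deriv_def)
  also have "\<dots> = D (Suc k)"
    using dseqD[OF Suc.prems, of k _ UNIV] by (auto intro!: vector_derivative_at)
  finally show ?case .
qed (simp add: nth_deriv_def)

lemma dseq_affine:
  assumes "dseq D" shows "dseq (\<lambda>k x. c ^ k *\<^sub>R D k (a + c * x))"
  unfolding dseq_def
proof (intro allI)
  fix k x
  have "((\<lambda>x. a + c * x) has_vector_derivative c) (at x)"
    by (auto intro!: derivative_eq_intros)
  then have "((D k \<circ> (\<lambda>x. a + c * x)) has_vector_derivative c *\<^sub>R D (Suc k) (a + c * x)) (at x)"
    using assms by (intro vector_diff_chain_at) (auto simp: dseq_def)
  then show "((\<lambda>x. c ^ k *\<^sub>R D k (a + c * x)) has_vector_derivative
      c ^ Suc k *\<^sub>R D (Suc k) (a + c * x)) (at x)"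
    by (auto intro!: derivative_eq_intros simp: o_def)
qed

lemma dseq_scaleR: "dseq D \<Longrightarrow> dseq (\<lambda>k x. c *\<^sub>R D k x)"
  unfolding dseq_def by (auto intro!: derivative_eq_intros)

lemma dseq_diff: "dseq D \<Longrightarrow> dseq E \<Longrightarrow> dseq (\<lambda>k x. D k x - E k x)"
  unfolding dseq_def by (auto intro!: derivative_eq_intros)

lemma dseq_sum: "(\<And>i. i \<in> I \<Longrightarrow> dseq (D i)) \<Longrightarrow> dseq (\<lambda>k x. \<Sum>i\<in>I. D i k x)"
  unfolding dseq_def by (auto intro!: derivative_eq_intros)

lemma dseq_of_real:
  "dseq D \<Longrightarrow> dseq (\<lambda>k x. (of_real (D k x) :: 'a::{real_normed_algebra_1}))"
  unfolding dseq_def by (auto intro!: derivative_eq_intros has_vector_derivative_of_real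
      simp flip: has_real_derivative_iff_has_vector_derivative)

definition dmul :: "(nat \<Rightarrow> real \<Rightarrow> 'a::real_normed_algebra) \<Rightarrow> (nat \<Rightarrow> real \<Rightarrow> 'a) \<Rightarrow> nat \<Rightarrow> real \<Rightarrow> 'a"
  where "dmul D E k x = (\<Sum>i\<le>k. real (k choose i) *\<^sub>R (D i x * E (k - i) x))"

lemma dmul_0 [simp]: "dmul D E 0 x = D 0 x * E 0 x"
  by (simp add: dmul_def)

text \<open>Pascal's rule, in the shape that the product rule yields when applied to each term of
  Leibniz' formula.\<close>

lemma dmul_Suc:
  "dmul D E (Suc k) x =
    (\<Sum>i\<le>k. real (k choose i) *\<^sub>R (D i x * E (Suc (k - i)) x + D (Suc i) x * E (k - i) x))"
proof -
  define a where "a i = D i x * E (Suc k - i) x" for i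
  have 1: "dmul D E (Suc k) x = a 0 + (\<Sum>i\<le>k. (real (k choose i) + real (k choose Suc i)) *\<^sub>R a (Suc i))"
    unfolding dmul_def a_def[symmetric] by (subst sum.atMost_Suc_shift) simp
  have 2: "(\<Sum>i\<le>Suc k. real (k choose i) *\<^sub>R a i) = a 0 + (\<Sum>i\<le>k. real (k choose Suc i) *\<^sub>R a (Suc i))"
    by (subst sum.atMost_Suc_shift) simp
  then have 3: "(\<Sum>i\<le>k. real (k choose i) *\<^sub>R a i) = a 0 + (\<Sum>i\<le>k. real (k choose Suc i) *\<^sub>R a (Suc i))"
    by (simp add: binomial_eq_0)
  have "dmul D E (Suc k) x = (\<Sum>i\<le>k. real (k choose i) *\<^sub>R a i) + (\<Sum>i\<le>k. real (k choose i) *\<^sub>R a (Suc i))"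
    unfolding 1 3 by (simp add: scaleR_add_left sum.distrib)
  also have "\<dots> = (\<Sum>i\<le>k. real (k choose i) *\<^sub>R (a i + a (Suc i)))"
    by (simp add: scaleR_add_right sum.distrib)
  also have "\<dots> = (\<Sum>i\<le>k. real (k choose i) *\<^sub>R (D i x * E (Suc (k - i)) x + D (Suc i) x * E (k - i) x))"
    by (rule sum.cong) (auto simp: a_def Suc_diff_le)
  finally show ?thesis .
qed

lemma dseq_dmul:
  fixes D E :: "nat \<Rightarrow> real \<Rightarrow> 'a::real_normed_algebra"
  assumes "dseq D" "dseq E" shows "dseq (dmul D E)"
  unfolding dseq_def
proof (intro allI)
  fix k x
  show "(dmul D E k has_vector_derivative dmul D E (Suc k) x) (at x)"
    unfolding dmul_Suc unfolding dmul_def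
    by (rule has_vector_derivative_sum)
      (intro bounded_linear.has_vector_derivative[OF bounded_linear_scaleR_right]
       has_vector_derivative_mult dseqD assms)
qed

text \<open>Pieces of width \<open>h\<close> are measured by \<open>norm (D k x) * h ^ k\<close>.
  This scale-invariant size is multiplicative up to \<open>2 ^ k\<close>, the sum of a row of
  binomial coefficients.\<close>

lemma dmul_bound:
  fixes D E :: "nat \<Rightarrow> real \<Rightarrow> 'a::real_normed_algebra"
  assumes D: "\<And>i. i \<le> k \<Longrightarrow> norm (D i x) * h ^ i \<le> A"
    and E: "\<And>i. i \<le> k \<Longrightarrow> norm (E i x) * h ^ i \<le> B" and h: "0 \<le> h"
  shows "norm (dmul D E k x) * h ^ k \<le> 2 ^ k * A * B"
proof -
  have AB: "0 \<le> A" "0 \<le> B" using D[of 0] E[of 0] by (auto intro: order_trans[rotated])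
  have "norm (dmul D E k x) * h ^ k \<le> (\<Sum>i\<le>k. real (k choose i) * (norm (D i x) * norm (E (k - i) x))) * h ^ k"
    unfolding dmul_def
    by (intro mult_right_mono order_trans[OF norm_sum] sum_mono)
       (auto simp: h norm_mult_ineq mult_left_mono)
  also have "\<dots> = (\<Sum>i\<le>k. real (k choose i) * ((norm (D i x) * h ^ i) * (norm (E (k - i) x) * h ^ (k - i))))"
    unfolding sum_distrib_right by (rule sum.cong) (auto simp: algebra_simps power_diff simp flip: power_add)
  also have "\<dots> \<le> (\<Sum>i\<le>k. real (k choose i) * (A * B))"
    using h AB by (intro sum_mono mult_left_mono mult_mono D E) auto
  also have "\<dots> = 2 ^ k * A * B"
    using choose_row_sum[of k] by (simp add: sum_distrib_right[symmetric] flip: of_nat_sum)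
  finally show ?thesis .
qed

lemma dmul_eq_0:
  "(\<forall>i. D i x = 0) \<or> (\<forall>i. E i x = 0) \<Longrightarrow> dmul D E k x = 0"
  by (auto simp: dmul_def)

lemma compact_support_integral:
  fixes g :: "real \<Rightarrow> 'a::euclidean_space"
  assumes "continuous_on UNIV g" "\<And>x. x \<notin> {a..b} \<Longrightarrow> g x = 0"
  shows "integrable lborel g" "(LINT x|lborel. g x) = integral {a..b} g"
proof -
  have eq: "(\<lambda>x. indicat_real {a..b} x *\<^sub>R g x) = g"
    using assms(2) by (auto simp: indicator_def)
  have "integrable lborel (\<lambda>x. indicat_real {a..b} x *\<^sub>R g x)"
    by (rule borel_integrable_compact) (auto intro: continuous_on_subset[OF assms(1)])
  then have si: "set_integrable lborel {a..b} g" by (simp add: set_integrable_def)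
  then show "integrable lborel g" unfolding set_integrable_def eq .
  show "(LINT x|lborel. g x) = integral {a..b} g"
    using set_borel_integral_eq_integral(2)[OF si] unfolding set_lebesgue_integral_def eq .
qed

subsection \<open>A smooth bump function\<close>

text \<open>With z = 1/x one has dz/dx = -z^2, so the x-derivative of P(z) exp(-z) is z^2 (P(z) -
  P'(z)) exp(-z). The recursion records this polynomial factor.\<close>

primrec bump_poly :: "nat \<Rightarrow> real poly" where
  "bump_poly 0 = 1"
| "bump_poly (Suc k) = [:0, 0, 1:] * (bump_poly k - pderiv (bump_poly k))"

definition half_bump :: "nat \<Rightarrow> real \<Rightarrow> real" where
  "half_bump k x = (if x > 0 then poly (bump_poly k) (1 / x) * exp (- (1 / x)) else 0)"

lemma poly_exp_tendsto_0: "((\<lambda>z::real. poly p z * exp (- z)) \<longlongrightarrow> 0) at_top"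
proof -
  have "((\<lambda>z::real. \<Sum>i\<le>degree p. coeff p i * (z ^ i / exp z)) \<longlongrightarrow> (\<Sum>i\<le>degree p. coeff p i * 0)) at_top"
    by (intro tendsto_intros tendsto_power_div_exp_0)
  then show ?thesis
    by (simp add: poly_altdef sum_distrib_right exp_minus divide_inverse mult.assoc)
qed

lemma half_bump_dseq: "dseq half_bump"
  unfolding dseq_def has_real_derivative_iff_has_vector_derivative[symmetric]
proof (intro allI)
  fix k and x :: real
  consider "x > 0" | "x < 0" | "x = 0" by linarith
  then show "(half_bump k has_real_derivative half_bump (Suc k) x) (at x)"
  proof cases
    case 1
    have "((\<lambda>x. poly (bump_poly k) (1 / x) * exp (- (1 / x))) has_real_derivative half_bump (Suc k) x) (at x)"
      using 1 by (auto intro!: derivative_eq_intros simp: half_bump_def field_simps power2_eq_square)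
    then show ?thesis
      by (rule has_field_derivative_transform_within_open[where S="{0<..}"])
         (use 1 in \<open>auto simp: half_bump_def\<close>)
  next
    case 2
    have "((\<lambda>x. 0) has_real_derivative half_bump (Suc k) x) (at x)"
      using 2 by (auto simp: half_bump_def)
    then show ?thesis
      by (rule has_field_derivative_transform_within_open[where S="{..<0}"])
         (use 2 in \<open>auto simp: half_bump_def\<close>)
  next
    case 3
    \<comment> \<open>With z = 1/y the difference quotient at 0 is z P(z) exp(-z), and z tends to
      infinity.\<close>
    have r: "((\<lambda>y. half_bump k y / y) \<longlongrightarrow> 0) (at_right 0)"
    proof (rule Lim_transform_eventually)
      show "((\<lambda>y. poly ([:0, 1:] * bump_poly k) (inverse y) * exp (- inverse y)) \<longlongrightarrow> 0) (at_right 0)"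
        by (rule filterlim_compose[OF poly_exp_tendsto_0 filterlim_inverse_at_top_right])
      show "\<forall>\<^sub>F y in at_right 0. poly ([:0, 1:] * bump_poly k) (inverse y) * exp (- inverse y) = half_bump k y / y"
        using eventually_at_right_less
        by eventually_elim (auto simp: half_bump_def field_simps)
    qed
    have l: "((\<lambda>y. half_bump k y / y) \<longlongrightarrow> 0) (at_left 0)"
    proof (rule Lim_transform_eventually)
      show "\<forall>\<^sub>F y in at_left 0. (0::real) = half_bump k y / y"
        by (auto simp: eventually_at_filter half_bump_def)
    qed auto
    have "((\<lambda>y. half_bump k y / y) \<longlongrightarrow> 0) (at 0)"
      using l r by (simp add: filterlim_split_at)
    then show ?thesis
      using 3 by (simp add: has_field_derivative_iff half_bump_def)
  qed
qed

lemma bump_exists: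
  obtains \<rho> :: "nat \<Rightarrow> real \<Rightarrow> real" where
    "dseq \<rho>" "\<And>k x. 1 \<le> \<bar>x\<bar> \<Longrightarrow> \<rho> k x = 0" "\<And>x. 0 \<le> \<rho> 0 x" "0 < \<rho> 0 0"
    "(LINT x|lborel. \<rho> 0 x) = 1"
proof -
  \<comment> \<open>The product of \<open>half_bump 0 (1 + x)\<close>, which vanishes for x \<le>
    -1, and \<open>half_bump 0 (1 - x)\<close>, which vanishes for x \<ge> 1.\<close>
  define r where "r = dmul (\<lambda>k x. 1 ^ k *\<^sub>R half_bump k (1 + 1 * x)) (\<lambda>k x. (- 1) ^ k *\<^sub>R half_bump k (1 + (- 1) * x))"
  have r: "dseq r" unfolding r_def
    by (intro dseq_dmul dseq_affine half_bump_dseq)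
  have supp: "r k x = 0" if "1 \<le> \<bar>x\<bar>" for k x
    unfolding r_def
  proof (rule dmul_eq_0)
    have "1 + x \<le> 0 \<or> 1 - x \<le> 0" using that by linarith
    then show "(\<forall>i. 1 ^ i *\<^sub>R half_bump i (1 + 1 * x) = 0) \<or> (\<forall>i. (- 1) ^ i *\<^sub>R half_bump i (1 + - 1 * x) = 0)"
      by (auto simp: half_bump_def)
  qed
  have pos: "0 \<le> r 0 x" for x
    by (auto simp: r_def half_bump_def)
  have pos0: "0 < r 0 0"
    by (auto simp: r_def half_bump_def)
  have co: "continuous_on UNIV (r 0)" by (rule dseq_continuous[OF r])
  have int: "(LINT x|lborel. r 0 x) = integral {-1..1} (r 0)" "integrable lborel (r 0)"
    using compact_support_integral[OF co, of "-1" 1] supp[of _ 0] by (force simp: abs_le_iff)+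
  have "integral {-1..1} (r 0) \<noteq> 0"
    using integral_eq_0_iff[of "-1" 1 "r 0"] co pos pos0
    by (metis atLeastAtMost_iff continuous_on_subset less_irrefl neg_le_0_iff_le neg_less_0_iff_less order_less_trans subset_UNIV zero_le_one zero_less_one)
  moreover have "0 \<le> integral {-1..1} (r 0)"
    unfolding int(1)[symmetric] by (rule integral_nonneg_AE) (auto simp: pos)
  ultimately have c: "0 < integral {-1..1} (r 0)" by simp
  define c where "c = integral {-1..1} (r 0)"
  show thesis
  proof (rule that[of "\<lambda>k x. (1 / c) *\<^sub>R r k x"])
    show "dseq (\<lambda>k x. (1 / c) *\<^sub>R r k x)" by (rule dseq_scaleR[OF r])
    show "(LBINT x. (1 / c) *\<^sub>R r 0 x) = 1"
      using c int by (simp add: c_def)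
  qed (use supp pos pos0 c in \<open>auto simp: c_def\<close>)
qed

section \<open>Finite differences and intermediate derivatives\<close>

lemma fwd_diff_pow:
  "(fwd_diff h ^^ m) b x = (\<Sum>i\<le>m. ((- 1) ^ (m - i) * real (m choose i)) *\<^sub>R b (x + real i * h))"
proof (induction m arbitrary: x)
  case (Suc m)
  define a where "a i = ((- 1) ^ (Suc m - i)) *\<^sub>R b (x + real i * h)" for i
  have 1: "(\<Sum>i\<le>Suc m. ((- 1) ^ (Suc m - i) * real (Suc m choose i)) *\<^sub>R b (x + real i * h))
     = a 0 + (\<Sum>i\<le>m. (real (m choose i) + real (m choose Suc i)) *\<^sub>R a (Suc i))"
    by (subst sum.atMost_Suc_shift) (simp add: a_def algebra_simps)
  have 2: "(\<Sum>i\<le>Suc m. real (m choose i) *\<^sub>R a i) = a 0 + (\<Sum>i\<le>m. real (m choose Suc i) *\<^sub>R a (Suc i))"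
    by (subst sum.atMost_Suc_shift) simp
  then have 3: "(\<Sum>i\<le>m. real (m choose i) *\<^sub>R a i) = a 0 + (\<Sum>i\<le>m. real (m choose Suc i) *\<^sub>R a (Suc i))"
    by (simp add: binomial_eq_0)
  have 4: "(\<Sum>i\<le>m. real (m choose i) *\<^sub>R a i) = - (fwd_diff h ^^ m) b x"
    unfolding Suc sum_negf[symmetric] by (rule sum.cong) (auto simp: a_def Suc_diff_le)
  have 5: "(\<Sum>i\<le>m. real (m choose i) *\<^sub>R a (Suc i)) = (fwd_diff h ^^ m) b (x + h)"
    unfolding Suc by (rule sum.cong) (auto simp: a_def Suc_diff_le algebra_simps)
  have "(fwd_diff h ^^ Suc m) b x = (fwd_diff h ^^ m) b (x + h) - (fwd_diff h ^^ m) b x"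
    by (simp add: fwd_diff_def)
  also have "\<dots> = a 0 + (\<Sum>i\<le>m. (real (m choose i) + real (m choose Suc i)) *\<^sub>R a (Suc i))"
  proof -
    have "(fwd_diff h ^^ m) b (x + h) - (fwd_diff h ^^ m) b x =
      (\<Sum>i\<le>m. real (m choose i) *\<^sub>R a (Suc i)) + (a 0 + (\<Sum>i\<le>m. real (m choose Suc i) *\<^sub>R a (Suc i)))"
      unfolding 3[symmetric] 4 5 by simp
    then show ?thesis by (simp add: scaleR_add_left sum.distrib add_ac)
  qed
  finally show ?case unfolding 1 .
qed simp

lemma fwd_diff_Suc:
  "(fwd_diff h ^^ Suc m) b = (\<lambda>x. (fwd_diff h ^^ m) b (x + h) - (fwd_diff h ^^ m) b x)"
  by (auto simp: fwd_diff_def[of h "(fwd_diff h ^^ m) b"])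

lemma fwd_diff_bound:
  assumes "\<And>x. norm (b x) \<le> B" shows "norm ((fwd_diff h ^^ m) b x) \<le> 2 ^ m * B"
proof (induction m arbitrary: x)
  case (Suc m)
  have "norm ((fwd_diff h ^^ Suc m) b x) \<le> norm ((fwd_diff h ^^ m) b (x + h)) + norm ((fwd_diff h ^^ m) b x)"
    by (simp add: fwd_diff_def norm_triangle_ineq4)
  then show ?case using Suc[of x] Suc[of "x + h"] by simp
qed (simp add: assms)

lemma fwd_diff_continuous:
  "continuous_on UNIV b \<Longrightarrow> continuous_on UNIV ((fwd_diff h ^^ m) b)"
proof (induction m)
  case (Suc m)
  then show ?case
    unfolding fwd_diff_Suc
    by (intro continuous_on_diff continuous_on_compose2[where g="(fwd_diff h ^^ m) b" and f="\<lambda>x. x + h"])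
      (auto intro!: continuous_on_add continuous_on_id continuous_on_const)
qed auto

lemma dseq_lipschitz:
  fixes D :: "nat \<Rightarrow> real \<Rightarrow> 'a::real_normed_vector"
  assumes "dseq D" "convex S" "\<And>z. z \<in> S \<Longrightarrow> norm (D (Suc k) z) \<le> B" "x \<in> S" "y \<in> S"
  shows "norm (D k x - D k y) \<le> B * \<bar>x - y\<bar>"
proof -
  have "norm (D k x - D k y) \<le> B * norm (x - y)"
  proof (rule differentiable_bound[where S=S and f'="\<lambda>z t. t *\<^sub>R D (Suc k) z"])
    show "(D k has_derivative (\<lambda>t. t *\<^sub>R D (Suc k) z)) (at z within S)" if "z \<in> S" for z
      using dseqD[OF assms(1)] by (simp add: has_vector_derivative_def)
    show "onorm (\<lambda>t. t *\<^sub>R D (Suc k) z) \<le> B" if "z \<in> S" for z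
      by (intro onorm_le, simp, subst mult.commute) (intro mult_right_mono assms(3)[OF that] abs_ge_zero)
  qed (use assms in auto)
  then show ?thesis by simp
qed

text \<open>Each of the \<open>k\<close> difference steps is replaced by \<open>h\<close> times a
  derivative at a cost of at most \<open>h ^ Suc k * B\<close>.\<close>

lemma fwd_diff_deriv:
  assumes "dseq D" "0 < h" "\<And>y. norm (D (Suc k) y) \<le> B"
  shows "norm ((fwd_diff h ^^ k) (D 0) y - h ^ k *\<^sub>R D k y) \<le> real k * h ^ Suc k * B"
  using assms
proof (induction k arbitrary: D B)
  case (Suc k)
  define G where "G j y = D j (y + h) - D j y" for j y
  have "dseq (\<lambda>j y. 1 ^ j *\<^sub>R D j (h + 1 * y) - D j y)"
    by (intro dseq_diff dseq_affine Suc)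
  then have G: "dseq G" by (simp add: G_def[abs_def] add.commute)
  have L: "norm (D (Suc k) z - D (Suc k) w) \<le> B * \<bar>z - w\<bar>" for z w
    by (rule dseq_lipschitz[OF Suc.prems(1) convex_UNIV]) (use Suc.prems in auto)
  have B: "0 \<le> B" using Suc.prems(3)[of 0] norm_ge_zero order_trans by blast
  have "norm (G (Suc k) z) \<le> h * B" for z
    using L[of "z + h" z] Suc.prems(2) by (simp add: G_def mult.commute)
  from Suc.IH[OF G Suc.prems(2) this]
  have 1: "norm ((fwd_diff h ^^ k) (G 0) y - h ^ k *\<^sub>R G k y) \<le> real k * h ^ Suc k * (h * B)" .
  \<comment> \<open>The linear Taylor term at \<open>y\<close> is subtracted from
    \<open>D k\<close>. The increment of \<open>E 0\<close> over \<open>{y..y+h}\<close> is then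
    \<open>G k y - h *\<^sub>R D (Suc k) y\<close>, while its derivative there is at most
    \<open>h * B\<close>.\<close>
  define E where "E j z = (if j = 0 then D k z - z *\<^sub>R D (Suc k) y else
     if j = 1 then D (Suc k) z - D (Suc k) y else D (j + k) z)" for j z
  have "dseq E"
    unfolding dseq_def
  proof (intro allI)
    fix j z
    consider "j = 0" | "j = 1" | i where "j = Suc (Suc i)" by (metis One_nat_def nat.exhaust)
    then show "(E j has_vector_derivative E (Suc j) z) (at z)"
      using dseqD[OF Suc.prems(1), of _ z UNIV]
      by cases (auto simp: E_def[abs_def] intro!: derivative_eq_intros)
  qed
  then have "norm (E 0 (y + h) - E 0 y) \<le> (h * B) * \<bar>y + h - y\<bar>"
  proof (rule dseq_lipschitz)
    show "norm (E (Suc 0) z) \<le> h * B" if "z \<in> {y..y+h}" for z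
    proof -
      have "norm (E (Suc 0) z) \<le> B * \<bar>z - y\<bar>" using L[of z y] by (simp add: E_def)
      also have "\<dots> \<le> B * h" using that B by (intro mult_left_mono) auto
      finally show ?thesis by (simp add: mult.commute)
    qed
  qed (use Suc.prems in auto)
  then have 2: "norm (G k y - h *\<^sub>R D (Suc k) y) \<le> h * h * B"
    using Suc.prems(2) by (simp add: E_def G_def algebra_simps)
  have 3: "(fwd_diff h ^^ Suc k) (D 0) y = (fwd_diff h ^^ k) (G 0) y"
  proof -
    have "G 0 = fwd_diff h (D 0)" by (simp add: G_def[abs_def] fwd_diff_def[abs_def])
    then show ?thesis by (simp add: funpow_swap1)
  qed
  have "norm ((fwd_diff h ^^ Suc k) (D 0) y - h ^ Suc k *\<^sub>R D (Suc k) y)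
      = norm (((fwd_diff h ^^ k) (G 0) y - h ^ k *\<^sub>R G k y) + h ^ k *\<^sub>R (G k y - h *\<^sub>R D (Suc k) y))"
    unfolding 3 by (simp add: algebra_simps)
  also have "\<dots> \<le> real k * h ^ Suc k * (h * B) + h ^ k * (h * h * B)"
    using 1 2 Suc.prems(2) by (intro norm_triangle_mono) (auto intro: mult_left_mono)
  also have "\<dots> = real (Suc k) * h ^ Suc (Suc k) * B" by (simp add: algebra_simps)
  finally show ?case .
qed simp

text \<open>Landau--Kolmogorov, by downward induction on the order of the derivative.\<close>

lemma intermediate_derivatives:
  "\<exists>C\<ge>0. \<forall>D h B. dseq D \<longrightarrow> 0 < h \<longrightarrow> (\<forall>y. norm (D 0 y :: complex) \<le> B) \<longrightarrow>
     (\<forall>y. norm (D m y) * h ^ m \<le> B) \<longrightarrow> (\<forall>k\<le>m. \<forall>y. norm (D k y) * h ^ k \<le> C * B)"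
proof (induction m)
  case 0
  show ?case by (intro exI[of _ 1]) auto
next
  case (Suc m)
  then obtain C where C: "0 \<le> C" "\<And>D h B k y. dseq D \<Longrightarrow> 0 < h \<Longrightarrow> (\<And>y. norm (D 0 y :: complex) \<le> B) \<Longrightarrow>
     (\<And>y. norm (D m y) * h ^ m \<le> B) \<Longrightarrow> k\<le>m \<Longrightarrow> norm (D k y) * h ^ k \<le> C * B"
    by blast
  \<comment> \<open>The derivative of order \<open>m\<close> is compared with the m-th difference,
    which is at most \<open>2 ^ m * B\<close>; the error of the comparison is at most
    \<open>real m * B\<close>.\<close>
  define K where "K = 2 ^ m + real m + 1"
  show ?case
  proof (intro exI[of _ "C * K + 1"] conjI allI impI)
    fix D :: "nat \<Rightarrow> real \<Rightarrow> complex" and h B k y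
    assume D: "dseq D" and h: "0 < h" and 0: "\<forall>y. norm (D 0 y) \<le> B"
      and 1: "\<forall>y. norm (D (Suc m) y) * h ^ Suc m \<le> B" and k: "k \<le> Suc m"
    have B: "0 \<le> B" using 0 norm_ge_zero order_trans by blast
    have K: "1 \<le> K" by (simp add: K_def)
    have "norm (D m y) * h ^ m \<le> K * B" for y
    proof -
      have "norm (D (Suc m) y) \<le> B / h ^ Suc m" for y
        using 1[rule_format, of y] h by (simp add: field_simps)
      then have "norm ((fwd_diff h ^^ m) (D 0) y - h ^ m *\<^sub>R D m y) \<le> real m * h ^ Suc m * (B / h ^ Suc m)"
        by (intro fwd_diff_deriv D h)
      then have a: "norm ((fwd_diff h ^^ m) (D 0) y - h ^ m *\<^sub>R D m y) \<le> real m * B"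
        using h by simp
      have "norm (h ^ m *\<^sub>R D m y) \<le> norm ((fwd_diff h ^^ m) (D 0) y) + norm ((fwd_diff h ^^ m) (D 0) y - h ^ m *\<^sub>R D m y)"
        by (metis norm_triangle_sub norm_minus_commute)
      also have "\<dots> \<le> 2 ^ m * B + real m * B"
        using 0 a by (intro add_mono fwd_diff_bound) auto
      also have "\<dots> \<le> K * B" using B by (simp add: K_def algebra_simps)
      finally show ?thesis using h by (simp add: mult.commute)
    qed
    moreover have "B \<le> K * B" using K B by (simp add: mult_le_cancel_right1)
    then have "norm (D 0 y) \<le> K * B" for y using 0 order_trans by blast
    ultimately have "norm (D k y) * h ^ k \<le> C * (K * B)" if "k \<le> m"
      using C(2)[OF D h _ _ that] by blast
    moreover have "k \<le> m \<or> k = Suc m" using k by auto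
    moreover have "0 \<le> C * (K * B)" using C B K by simp
    ultimately show "norm (D k y) * h ^ k \<le> (C * K + 1) * B"
      using 1[rule_format, of y] B by (auto simp: algebra_simps)
  qed (use C in \<open>simp add: K_def\<close>)
qed

subsection \<open>Mollification\<close>

lemma scaled_bump_integral:
  fixes \<Phi> :: "nat \<Rightarrow> real \<Rightarrow> real" and b :: "real \<Rightarrow> 'a::euclidean_space"
  assumes "dseq \<Phi>" "\<And>k u. r \<le> \<bar>u\<bar> \<Longrightarrow> \<Phi> k u = 0" "continuous_on UNIV b"
  shows "integrable lborel (\<lambda>u. \<Phi> k u *\<^sub>R b u)"
    "(LINT u|lborel. \<Phi> k u *\<^sub>R b u) = integral {-r..r} (\<lambda>u. \<Phi> k u *\<^sub>R b u)"
proof -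
  have c: "continuous_on UNIV (\<lambda>u. \<Phi> k u *\<^sub>R b u)"
    by (intro continuous_intros dseq_continuous assms)
  have s: "\<Phi> k u *\<^sub>R b u = 0" if "u \<notin> {-r..r}" for u
    using assms(2)[of u k] that by (auto simp: abs_if split: if_splits)
  show "integrable lborel (\<lambda>u. \<Phi> k u *\<^sub>R b u)"
    "(LINT u|lborel. \<Phi> k u *\<^sub>R b u) = integral {-r..r} (\<lambda>u. \<Phi> k u *\<^sub>R b u)"
    using compact_support_integral[OF c s] by auto
qed

lemma scaled_bump_bound:
  fixes \<Phi> :: "nat \<Rightarrow> real \<Rightarrow> real" and b :: "real \<Rightarrow> 'a::euclidean_space"
  assumes "dseq \<Phi>" "\<And>k u. r \<le> \<bar>u\<bar> \<Longrightarrow> \<Phi> k u = 0" "continuous_on UNIV b"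
    and B: "\<And>u. \<bar>u\<bar> \<le> r \<Longrightarrow> norm (b u) \<le> B"
  shows "norm (LINT u|lborel. \<Phi> k u *\<^sub>R b u) \<le> (LINT u|lborel. \<bar>\<Phi> k u\<bar>) * B"
proof -
  have "integrable lborel (\<lambda>u. \<Phi> k u *\<^sub>R (1::real))"
    by (rule scaled_bump_integral[OF assms(1,2)]) auto
  then have i: "integrable lborel (\<lambda>u. \<bar>\<Phi> k u\<bar>)" by auto
  have "norm (LINT u|lborel. \<Phi> k u *\<^sub>R b u) \<le> (LINT u|lborel. norm (\<Phi> k u *\<^sub>R b u))"
    by (rule integral_norm_bound)
  also have "\<dots> \<le> (LINT u|lborel. \<bar>\<Phi> k u\<bar> * B)"
  proof (intro integral_mono)
    show "integrable lborel (\<lambda>u. norm (\<Phi> k u *\<^sub>R b u))"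
      by (intro integrable_norm scaled_bump_integral[OF assms(1,2,3)]) auto
    fix u show "norm (\<Phi> k u *\<^sub>R b u) \<le> \<bar>\<Phi> k u\<bar> * B"
      using assms(2)[of u k] B[of u] by (cases "\<bar>u\<bar> \<le> r") (auto intro: mult_left_mono)
  qed (use i in auto)
  also have "\<dots> = (LINT u|lborel. \<bar>\<Phi> k u\<bar>) * B" by simp
  finally show ?thesis .
qed

text \<open>The entry of order zero is the convolution of \<open>\<Phi> 0\<close> with the indicator
  of a unit interval. Its derivative is a difference of end values, so each higher entry is a unit
  difference of the derivative one order lower.\<close>

lemma dseq_integral_shift:
  fixes \<Phi> :: "nat \<Rightarrow> real \<Rightarrow> real"
  assumes "dseq \<Phi>"
  shows "dseq (\<lambda>k u. case k of 0 \<Rightarrow> integral {0..1} (\<lambda>t. \<Phi> 0 (u + t)) | Suc j \<Rightarrow> \<Phi> j (u + 1) - \<Phi> j u)"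
  unfolding dseq_def
proof (intro allI)
  fix k u
  have sh: "((\<lambda>t. \<Phi> j (u + t)) has_vector_derivative \<Phi> (Suc j) (u + t)) (at t within S)" for j u t S
  proof -
    have "dseq (\<lambda>k t. 1 ^ k *\<^sub>R \<Phi> k (u + 1 * t))" by (rule dseq_affine[OF assms])
    from dseqD[OF this, of j t S] show ?thesis by simp
  qed
  have sh': "((\<lambda>u. \<Phi> j (u + t)) has_vector_derivative \<Phi> (Suc j) (u + t)) (at u within S)" for j u t S
    using sh[of j t u S] by (simp add: add.commute)
  have "((\<lambda>u. integral (cbox 0 1) (\<lambda>t. \<Phi> 0 (u + t))) has_vector_derivative integral (cbox 0 1) (\<lambda>t. \<Phi> 1 (u + t))) (at u within UNIV)"
  proof (rule leibniz_rule_vector_derivative)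
    show "(\<lambda>t. \<Phi> 0 (x + t)) integrable_on cbox 0 1" for x
      by (intro integrable_continuous dseq_continuous2[OF assms] continuous_intros)
    show "continuous_on (UNIV \<times> cbox 0 1) (\<lambda>(x, t). \<Phi> 1 (x + t))"
      unfolding split_beta by (intro dseq_continuous2[OF assms] continuous_intros)
  qed (use sh' in auto)
  moreover have "integral {0..1} (\<lambda>t. \<Phi> 1 (u + t)) = \<Phi> 0 (u + 1) - \<Phi> 0 (u + 0)"
    by (intro integral_unique fundamental_theorem_of_calculus) (use sh in \<open>auto\<close>)
  ultimately show "((\<lambda>u. case k of 0 \<Rightarrow> integral {0..1} (\<lambda>t. \<Phi> 0 (u + t)) | Suc j \<Rightarrow> \<Phi> j (u + 1) - \<Phi> j u)
      has_vector_derivative (case Suc k of 0 \<Rightarrow> integral {0..1} (\<lambda>t. \<Phi> 0 (u + t)) | Suc j \<Rightarrow> \<Phi> j (u + 1) - \<Phi> j u)) (at u)"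
    using sh'[of _ 0] by (cases k) (auto intro!: has_vector_derivative_diff sh')
qed

text \<open>The kernel \<open>g\<close> sees \<open>b\<close> only through m-th differences;
  polynomials of degree below \<open>m\<close> are invisible to it. The step is \<open>- h\<close>
  because moving a shift by 1 off the kernel translates \<open>b\<close> by
  \<open>- h\<close>.\<close>

definition diff_bound :: "nat \<Rightarrow> (real \<Rightarrow> real) \<Rightarrow> real \<Rightarrow> bool" where
  "diff_bound m g C \<longleftrightarrow> (\<forall>b h B y. continuous_on UNIV (b :: real \<Rightarrow> complex) \<longrightarrow>
        (\<forall>y. norm ((fwd_diff (- h) ^^ m) b y) \<le> B) \<longrightarrow>
        norm (LINT u|lborel. g u *\<^sub>R b (y + h * u)) \<le> C * B)"

lemma diff_boundI:
  assumes "\<And>b h B y. continuous_on UNIV (b :: real \<Rightarrow> complex) \<Longrightarrow>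
        \<forall>y. norm ((fwd_diff (- h) ^^ m) b y) \<le> B \<Longrightarrow>
        norm (LINT u|lborel. g u *\<^sub>R b (y + h * u)) \<le> C * B"
  shows "diff_bound m g C"
  unfolding diff_bound_def using assms by blast

lemma diff_boundD:
  assumes "diff_bound m g C" "continuous_on UNIV b" "\<And>y. norm ((fwd_diff (- h) ^^ m) b y) \<le> B"
  shows "norm (LINT u|lborel. g u *\<^sub>R b (y + h * u)) \<le> C * B"
  using assms unfolding diff_bound_def by blast

text \<open>The difference bound is asked only from order \<open>m\<close> on:
  \<open>\<Phi> 0\<close> has to keep total integral one and so must see constants.\<close>

definition diff_kernel :: "nat \<Rightarrow> real \<Rightarrow> (nat \<Rightarrow> real \<Rightarrow> real) \<Rightarrow> bool" where
  "diff_kernel m r \<Phi> \<longleftrightarrow> dseq \<Phi> \<and> (\<forall>k u. r \<le> \<bar>u\<bar> \<longrightarrow> \<Phi> k u = 0) \<and>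
     (\<forall>k. \<exists>C\<ge>0. diff_bound m (\<Phi> (k + m)) C)"

lemma diff_kernelD:
  assumes "diff_kernel m r \<Phi>" shows "dseq \<Phi>" "\<And>k u. r \<le> \<bar>u\<bar> \<Longrightarrow> \<Phi> k u = 0"
  using assms unfolding diff_kernel_def by blast+

lemma continuous_on_affine_compose:
  "continuous_on UNIV b \<Longrightarrow> continuous_on S (\<lambda>u::real. b (y + h * u))"
  by (rule continuous_on_compose2[where g=b]) (auto intro!: continuous_intros)

lemma diff_kernel_0:
  assumes "dseq \<Phi>" "\<And>k u. r \<le> \<bar>u\<bar> \<Longrightarrow> \<Phi> k u = 0" shows "diff_kernel 0 r \<Phi>"
  unfolding diff_kernel_def
proof (intro conjI allI impI)
  fix k
  show "\<exists>C\<ge>0. diff_bound 0 (\<Phi> (k + 0)) C"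
  proof (intro exI[of _ "LINT u|lborel. \<bar>\<Phi> k u\<bar>"] conjI diff_boundI)
    fix b :: "real \<Rightarrow> complex" and h B y
    assume "continuous_on UNIV b" "\<forall>y. norm ((fwd_diff (- h) ^^ 0) b y) \<le> B"
    then show "norm (LINT u|lborel. \<Phi> (k + 0) u *\<^sub>R b (y + h * u)) \<le> (LINT u|lborel. \<bar>\<Phi> k u\<bar>) * B"
      using scaled_bump_bound[OF assms, where b="\<lambda>u. b (y + h * u)" and B=B and k=k]
      by (auto intro: continuous_on_affine_compose)
  qed auto
qed (use assms in auto)

text \<open>Averaging over unit intervals turns one derivative into a unit difference, which is then
  moved onto the integrated function.\<close>

lemma diff_kernel_Suc:
  assumes "diff_kernel m r \<Phi>"
  shows "diff_kernel (Suc m) (r + 1)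
    (\<lambda>k u. case k of 0 \<Rightarrow> integral {0..1} (\<lambda>t. \<Phi> 0 (u + t)) | Suc j \<Rightarrow> \<Phi> j (u + 1) - \<Phi> j u)"
    (is "diff_kernel _ _ ?J")
  unfolding diff_kernel_def
proof (intro conjI allI impI)
  have \<Phi>: "dseq \<Phi>" "\<And>k u. r \<le> \<bar>u\<bar> \<Longrightarrow> \<Phi> k u = 0" by (rule diff_kernelD[OF assms])+
  show "dseq ?J" by (rule dseq_integral_shift[OF \<Phi>(1)])
  show "?J k u = 0" if "r + 1 \<le> \<bar>u\<bar>" for k u
  proof -
    have "integral {0..1} (\<lambda>t. \<Phi> 0 (u + t)) = integral {0..1} (\<lambda>t::real. 0)"
      by (rule Henstock_Kurzweil_Integration.integral_cong) (rule \<Phi>(2), use that in auto)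
    moreover have "\<Phi> j (u + 1) - \<Phi> j u = 0" for j using that by (simp add: \<Phi>(2))
    ultimately show ?thesis by (simp split: nat.splits)
  qed
  fix k
  obtain C where C: "C \<ge> 0" "diff_bound m (\<Phi> (k + m)) C"
    using assms unfolding diff_kernel_def by blast
  show "\<exists>C\<ge>0. diff_bound (Suc m) (?J (k + Suc m)) C"
  proof (intro exI[of _ C] conjI diff_boundI C(1))
    fix b :: "real \<Rightarrow> complex" and h B y
    assume b: "continuous_on UNIV b" and B: "\<forall>y. norm ((fwd_diff (- h) ^^ Suc m) b y) \<le> B"
    let ?i = "\<lambda>u. \<Phi> (k + m) u *\<^sub>R b (y + h * u)"
    let ?i' = "\<lambda>u. \<Phi> (k + m) u *\<^sub>R b (y - h + h * u)"
    let ?s = "\<lambda>u. \<Phi> (k + m) (u + 1) *\<^sub>R b (y + h * u)"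
    have i: "integrable lborel ?i" and i': "integrable lborel ?i'"
      by (intro scaled_bump_integral[OF \<Phi>] continuous_on_affine_compose b; simp)+
    have s_eq: "?s = (\<lambda>u. ?i' (1 + 1 * u))" by (auto simp: algebra_simps)
    have s: "integrable lborel ?s"
      unfolding s_eq using i' by (subst lborel_integrable_real_affine_iff) auto
    have "(LINT u|lborel. ?J (k + Suc m) u *\<^sub>R b (y + h * u)) = (LINT u|lborel. ?s u) - (LINT u|lborel. ?i u)"
      by (subst Bochner_Integration.integral_diff[OF s i, symmetric]) (simp add: scaleR_diff_left)
    also have "(LINT u|lborel. ?s u) = (LINT u|lborel. ?i' u)"
      unfolding s_eq by (subst (2) lborel_integral_real_affine[of 1 _ 1]) simp_all
    also have "(LINT u|lborel. ?i' u) - (LINT u|lborel. ?i u) = (LINT u|lborel. \<Phi> (k + m) u *\<^sub>R fwd_diff (- h) b (y + h * u))"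
      by (subst Bochner_Integration.integral_diff[OF i' i, symmetric])
        (simp add: scaleR_diff_right fwd_diff_def algebra_simps)
    also have "norm \<dots> \<le> C * B"
    proof (rule diff_boundD[OF C(2)])
      show "continuous_on UNIV (fwd_diff (- h) b)"
        using fwd_diff_continuous[OF b, where h="- h" and m=1] by simp
      show "norm ((fwd_diff (- h) ^^ m) (fwd_diff (- h) b) y) \<le> B" for y
        using B by (simp add: funpow_swap1)
    qed
    finally show "norm (LINT u|lborel. ?J (k + Suc m) u *\<^sub>R b (y + h * u)) \<le> C * B" .
  qed
qed

text \<open>A bump convolved \<open>m\<close> times with the indicator of a unit interval is such a
  kernel, a smoothed B-spline. Nonnegativity and positivity somewhere are carried through the
  induction so that the integral can be normalised at the end.\<close>

lemma diff_kernel_exists: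
  obtains \<Phi> r where "diff_kernel m r \<Phi>" "(LINT u|lborel. \<Phi> 0 u) = 1" "0 \<le> r"
proof -
  have "\<exists>\<Phi> r. diff_kernel m r \<Phi> \<and> (\<forall>u. 0 \<le> \<Phi> 0 u) \<and> (\<exists>u. 0 < \<Phi> 0 u)"
  proof (induction m)
    case 0
    obtain \<rho> :: "nat \<Rightarrow> real \<Rightarrow> real" where
      "dseq \<rho>" "\<And>k x. 1 \<le> \<bar>x\<bar> \<Longrightarrow> \<rho> k x = 0" "\<And>x. 0 \<le> \<rho> 0 x" "0 < \<rho> 0 0"
      using bump_exists by metis
    then show ?case using diff_kernel_0[of \<rho> 1] by blast
  next
    case (Suc m)
    then obtain \<Phi> r u where \<Phi>: "diff_kernel m r \<Phi>" "\<And>u. 0 \<le> \<Phi> 0 u" "0 < \<Phi> 0 u" by blast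
    have d: "dseq \<Phi>" by (rule diff_kernelD[OF \<Phi>(1)])
    have c: "continuous_on {0..1} (\<lambda>t. \<Phi> 0 (u + t))" for u by (intro dseq_continuous2[OF d] continuous_intros)
    have nn: "0 \<le> integral {0..1} (\<lambda>t. \<Phi> 0 (u + t))" for u
      by (intro integral_nonneg integrable_continuous_interval c \<Phi>)
    have "integral {0..1} (\<lambda>t. \<Phi> 0 (u + t)) \<noteq> 0"
    proof
      assume "integral {0..1} (\<lambda>t. \<Phi> 0 (u + t)) = 0"
      then have "\<forall>t\<in>{0..1}. \<Phi> 0 (u + t) = 0"
        using integral_eq_0_iff[OF c[of u]] \<Phi>(2) by auto
      then show False using \<Phi>(3) by (auto dest!: bspec[where x=0])
    qed
    with nn[of u] have "0 < integral {0..1} (\<lambda>t. \<Phi> 0 (u + t))" by simp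
    then have "\<exists>u. 0 < (case 0 of 0 \<Rightarrow> integral {0..1} (\<lambda>t. \<Phi> 0 (u + t)) | Suc j \<Rightarrow> \<Phi> j (u + 1) - \<Phi> j u)"
      by auto
    with diff_kernel_Suc[OF \<Phi>(1)] nn show ?case
      by (intro exI[of _ "\<lambda>k u. case k of 0 \<Rightarrow> integral {0..1} (\<lambda>t. \<Phi> 0 (u + t)) | Suc j \<Rightarrow> \<Phi> j (u + 1) - \<Phi> j u"]
          exI[of _ "r + 1"]) auto
  qed
  then obtain \<Phi> r u where \<Phi>: "diff_kernel m r \<Phi>" "\<And>u. 0 \<le> \<Phi> 0 u" "0 < \<Phi> 0 u" by blast
  have d: "dseq \<Phi>" and s: "\<And>k u. r \<le> \<bar>u\<bar> \<Longrightarrow> \<Phi> k u = 0"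
    and K: "\<And>k. \<exists>C\<ge>0. diff_bound m (\<Phi> (k + m)) C"
    using \<Phi> unfolding diff_kernel_def by blast+
  have ur: "\<bar>u\<bar> < r" using s[of u 0] \<Phi>(3) by force
  define c where "c = (LINT u|lborel. \<Phi> 0 u)"
  have c_eq: "c = integral {-r..r} (\<Phi> 0)"
    using scaled_bump_integral(2)[OF d s, where b="\<lambda>_. 1::real" and k=0] by (simp add: c_def)
  have "c \<noteq> 0"
  proof
    assume "c = 0"
    then have "\<forall>t\<in>{-r..r}. \<Phi> 0 t = 0"
      using integral_eq_0_iff[of "-r" r "\<Phi> 0", OF dseq_continuous[OF d]] \<Phi>(2) ur by (auto simp: c_eq)
    then show False using \<Phi>(3) ur by (auto dest!: bspec[where x=u])
  qed
  moreover have "0 \<le> c" unfolding c_def by (rule integral_nonneg_AE) (auto simp: \<Phi>)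
  ultimately have c: "0 < c" by simp
  show thesis
  proof (rule that[of r "\<lambda>k u. (1 / c) *\<^sub>R \<Phi> k u"])
    show "diff_kernel m r (\<lambda>k u. (1 / c) *\<^sub>R \<Phi> k u)"
      unfolding diff_kernel_def
    proof (intro conjI allI impI dseq_scaleR d)
      fix k
      obtain C where C: "C \<ge> 0" "diff_bound m (\<Phi> (k + m)) C"
        using K[of k] by blast
      show "\<exists>C\<ge>0. diff_bound m (\<lambda>u. (1 / c) *\<^sub>R \<Phi> (k + m) u) C"
      proof (intro exI[of _ "C / c"] conjI diff_boundI)
        fix b :: "real \<Rightarrow> complex" and h B y
        assume "continuous_on UNIV b" and B: "\<forall>y. norm ((fwd_diff (- h) ^^ m) b y) \<le> B"
        from diff_boundD[OF C(2) this(1) B[rule_format], of y] c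
        have "norm ((1 / c) *\<^sub>R (LINT u|lborel. \<Phi> (k + m) u *\<^sub>R b (y + h * u))) \<le> C / c * B"
          by (simp add: field_simps)
        moreover have "(\<lambda>u. ((1 / c) *\<^sub>R \<Phi> (k + m) u) *\<^sub>R b (y + h * u)) = (\<lambda>u. (1 / c) *\<^sub>R (\<Phi> (k + m) u *\<^sub>R b (y + h * u)))"
          by simp
        ultimately show "norm (LINT u|lborel. ((1 / c) *\<^sub>R \<Phi> (k + m) u) *\<^sub>R b (y + h * u)) \<le> C / c * B"
          by (simp only: integral_scaleR_right)
      qed (use C c in auto)
    qed (use s in auto)
    show "(LBINT u. (1 / c) *\<^sub>R \<Phi> 0 u) = 1" using c by (simp add: c_def)
    show "0 \<le> r" using ur by simp
  qed
qed

text \<open>The k-th derivative in \<open>y\<close> of the mollified function after \<open>k\<close>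
  integrations by parts. All derivatives sit on the kernel, which is what makes the difference
  bounds applicable.\<close>

definition moll :: "(nat \<Rightarrow> real \<Rightarrow> real) \<Rightarrow> (real \<Rightarrow> complex) \<Rightarrow> real \<Rightarrow> nat \<Rightarrow> real \<Rightarrow> complex" where
  "moll \<Phi> b h k y = (- 1 / h) ^ k *\<^sub>R (LINT u|lborel. \<Phi> k u *\<^sub>R b (y + h * u))"

text \<open>One derivative of \<open>b\<close> serves every order: it appears when differentiating
  under the integral and is moved onto the kernel by parts, which leaves an integral of
  \<open>b\<close> again.\<close>

lemma dseq_moll:
  assumes \<Phi>: "dseq \<Phi>" "\<And>k u. r \<le> \<bar>u\<bar> \<Longrightarrow> \<Phi> k u = 0" and r: "0 \<le> r" and h: "h \<noteq> 0"
    and b: "\<And>x. (b has_vector_derivative b' x) (at x)" "continuous_on UNIV b'"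
  shows "dseq (moll \<Phi> b h)"
  unfolding dseq_def
proof (intro allI)
  fix k y
  have bc: "continuous_on UNIV b"
    using b(1) by (meson continuous_on_vector_derivative has_vector_derivative_at_within)
  define I where "I j y = integral (cbox (-r) r) (\<lambda>u. \<Phi> j u *\<^sub>R b (y + h * u))" for j y
  have moll: "moll \<Phi> b h j y = (- 1 / h) ^ j *\<^sub>R I j y" for j y
    unfolding moll_def I_def
    by (subst scaled_bump_integral(2)[OF \<Phi>]) (auto intro: continuous_on_affine_compose bc)
  have db: "((\<lambda>y. b (y + h * u)) has_vector_derivative b' (y + h * u)) (at y within S)" for y u S
  proof -
    have "((\<lambda>y. y + h * u) has_vector_derivative 1) (at y)" by (auto intro!: derivative_eq_intros)
    from vector_diff_chain_at[OF this b(1)] show ?thesis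
      by (auto simp: o_def intro: has_vector_derivative_at_within)
  qed
  have du: "((\<lambda>u. b (y + h * u)) has_vector_derivative h *\<^sub>R b' (y + h * u)) (at u within S)" for y u S
  proof -
    have "((\<lambda>u. y + h * u) has_vector_derivative h) (at u)" by (auto intro!: derivative_eq_intros)
    from vector_diff_chain_at[OF this b(1)] show ?thesis
      by (auto simp: o_def intro: has_vector_derivative_at_within)
  qed
  define I' where "I' = integral (cbox (-r) r) (\<lambda>u. \<Phi> k u *\<^sub>R b' (y + h * u))"
  have int: "(\<lambda>u. \<Phi> j u *\<^sub>R g (y + h * u)) integrable_on cbox (-r) r" if "continuous_on UNIV g" for j y and g :: "real \<Rightarrow> complex"
    by (intro integrable_continuous continuous_on_scaleR dseq_continuous \<Phi> continuous_on_affine_compose that)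
  have "((\<lambda>y. I k y) has_vector_derivative I') (at y within UNIV)"
    unfolding I_def I'_def
  proof (rule leibniz_rule_vector_derivative)
    show "((\<lambda>x. \<Phi> k t *\<^sub>R b (x + h * t)) has_vector_derivative \<Phi> k t *\<^sub>R b' (x + h * t)) (at x within UNIV)" for x t
      by (intro bounded_linear.has_vector_derivative[OF bounded_linear_scaleR_right] db)
    show "continuous_on (UNIV \<times> cbox (-r) r) (\<lambda>(x, t). \<Phi> k t *\<^sub>R b' (x + h * t))"
      unfolding split_beta
      by (intro continuous_on_scaleR dseq_continuous2[OF \<Phi>(1)] continuous_on_compose2[OF b(2)] continuous_intros) auto
  qed (use int[OF bc] in auto)
  moreover have "I' = (- 1 / h) *\<^sub>R I (Suc k) y"
  proof -
    have "((\<lambda>u. \<Phi> k u *\<^sub>R (h *\<^sub>R b' (y + h * u)) + \<Phi> (Suc k) u *\<^sub>R b (y + h * u)) has_integral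
       (\<Phi> k r *\<^sub>R b (y + h * r) - \<Phi> k (-r) *\<^sub>R b (y + h * (-r)))) {-r..r}"
    proof (rule fundamental_theorem_of_calculus)
      show "((\<lambda>u. \<Phi> k u *\<^sub>R b (y + h * u)) has_vector_derivative
         \<Phi> k u *\<^sub>R (h *\<^sub>R b' (y + h * u)) + \<Phi> (Suc k) u *\<^sub>R b (y + h * u)) (at u within {-r..r})" for u
        using dseqD[OF \<Phi>(1), of k u "{-r..r}"]
        by (intro has_vector_derivative_scaleR du) (simp add: has_real_derivative_iff_has_vector_derivative)
    qed (use r in auto)
    then have "integral (cbox (-r) r) (\<lambda>u. h *\<^sub>R (\<Phi> k u *\<^sub>R b' (y + h * u)) + \<Phi> (Suc k) u *\<^sub>R b (y + h * u)) = 0"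
      using \<Phi>(2)[of r k] \<Phi>(2)[of "-r" k] r by (simp add: integral_unique mult.commute)
    then have "h *\<^sub>R I' + I (Suc k) y = 0"
      using int[OF b(2), of k y] int[OF bc, of "Suc k" y]
      unfolding I_def I'_def
      by (subst (asm) integral_add) (auto simp del: scaleR_scaleR intro: integrable_cmul)
    then have "I (Suc k) y = - (h *\<^sub>R I')" by (simp add: eq_neg_iff_add_eq_0 add.commute)
    then show ?thesis using h by simp
  qed
  ultimately have "(I k has_vector_derivative (- 1 / h) *\<^sub>R I (Suc k) y) (at y)" by simp
  from bounded_linear.has_vector_derivative[OF bounded_linear_scaleR_right this, of "(- 1 / h) ^ k"]
  have "((\<lambda>y. (- 1 / h) ^ k *\<^sub>R I k y) has_vector_derivative (- 1 / h) ^ k *\<^sub>R ((- 1 / h) *\<^sub>R I (Suc k) y)) (at y)" .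
  moreover have "(- 1 / h) ^ k *\<^sub>R ((- 1 / h) *\<^sub>R I (Suc k) y) = (- 1 / h) ^ Suc k *\<^sub>R I (Suc k) y"
    by (simp only: scaleR_scaleR power_Suc mult.commute)
  moreover have "moll \<Phi> b h k = (\<lambda>y. (- 1 / h) ^ k *\<^sub>R I k y)" by (rule ext) (rule moll)
  ultimately show "(moll \<Phi> b h k has_vector_derivative moll \<Phi> b h (Suc k) y) (at y)"
    unfolding moll by simp
qed

text \<open>A single mollification errs by an average of first differences. With T the translation
  by \<open>h * u\<close>, the coefficients used here are those of 1 - (1 - T)^m, so the error
  becomes an average of m-th differences, the quantity that \<open>lip_norm\<close>
  controls.\<close>

definition smoothed :: "nat \<Rightarrow> (nat \<Rightarrow> real \<Rightarrow> real) \<Rightarrow> (real \<Rightarrow> complex) \<Rightarrow> real \<Rightarrow> nat \<Rightarrow> real \<Rightarrow> complex" where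
  "smoothed m \<Phi> b h k y =
     (\<Sum>i=1..m. ((- 1) ^ (i + 1) * real (m choose i)) *\<^sub>R moll \<Phi> b (real i * h) k y)"

lemma fwd_diff_pow_split:
  "b y - (\<Sum>i=1..m. ((- 1) ^ (i + 1) * real (m choose i)) *\<^sub>R b (y + real i * t)) =
    (- 1) ^ m *\<^sub>R (fwd_diff t ^^ m) b y"
proof -
  have "(- 1) ^ m *\<^sub>R (fwd_diff t ^^ m) b y = (\<Sum>i\<le>m. ((- 1) ^ i * real (m choose i)) *\<^sub>R b (y + real i * t))"
    unfolding fwd_diff_pow scaleR_sum_right
  proof (rule sum.cong[OF refl])
    fix i assume "i \<in> {..m}"
    then have "(- 1 :: real) ^ m * (- 1) ^ (m - i) = (- 1) ^ i"
      by (simp add: power_add[symmetric] minus_one_power_iff)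
    then show "(- 1) ^ m *\<^sub>R ((- 1) ^ (m - i) * real (m choose i)) *\<^sub>R b (y + real i * t) =
      ((- 1) ^ i * real (m choose i)) *\<^sub>R b (y + real i * t)"
      by (simp add: mult.assoc[symmetric])
  qed
  also have "\<dots> = b y + (\<Sum>i=1..m. ((- 1) ^ i * real (m choose i)) *\<^sub>R b (y + real i * t))"
    by (simp add: atMost_atLeast0 sum.atLeast_Suc_atMost)
  finally show ?thesis by (simp add: sum_negf[symmetric])
qed

lemma binomial_weighted_bound:
  assumes "1 \<le> m" "\<And>i. i \<in> {1..m} \<Longrightarrow> norm (g i) \<le> B"
  shows "norm (\<Sum>i=1..m. ((- 1) ^ (i + 1) * real (m choose i)) *\<^sub>R g i) \<le> 2 ^ m * B"
proof -
  have B: "0 \<le> B" by (rule order_trans[OF norm_ge_zero assms(2)[of 1]]) (use assms(1) in simp)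
  have "norm (\<Sum>i=1..m. ((- 1) ^ (i + 1) * real (m choose i)) *\<^sub>R g i) \<le> (\<Sum>i=1..m. real (m choose i) * B)"
    by (rule order_trans[OF norm_sum sum_mono]) (auto simp: abs_mult power_abs intro!: mult_left_mono assms(2))
  also have "\<dots> \<le> (\<Sum>i\<le>m. real (m choose i) * B)"
    using B by (intro sum_mono2) auto
  also have "\<dots> = 2 ^ m * B"
    using choose_row_sum[of m] by (simp add: sum_distrib_right[symmetric] flip: of_nat_sum)
  finally show ?thesis .
qed

locale smoothing =
  fixes m :: nat and r :: real and \<Phi> :: "nat \<Rightarrow> real \<Rightarrow> real" and \<alpha> :: real
  assumes kernel: "diff_kernel m r \<Phi>" and total: "(LINT u|lborel. \<Phi> 0 u) = 1" and r: "0 \<le> r"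
    and m: "1 \<le> m" and \<alpha>: "0 < \<alpha>"
begin

lemma \<Phi>: "dseq \<Phi>" "\<And>k u. r \<le> \<bar>u\<bar> \<Longrightarrow> \<Phi> k u = 0"
  by (rule diff_kernelD[OF kernel])+

lemma dseq_smoothed:
  assumes "\<And>x. (b has_vector_derivative b' x) (at x)" "continuous_on UNIV b'" "0 < h"
  shows "dseq (smoothed m \<Phi> b h)"
  unfolding smoothed_def[abs_def]
  by (intro dseq_sum dseq_scaleR dseq_moll[OF \<Phi> r _ assms(1,2)]) (use assms in auto)

lemma smoothed_approx:
  assumes b: "continuous_on UNIV b" and A: "\<And>t y. norm ((fwd_diff t ^^ m) b y) \<le> A * \<bar>t\<bar> powr \<alpha>"
    and h: "0 < h" and A0: "0 \<le> A"
  shows "norm (b y - smoothed m \<Phi> b h 0 y) \<le> (LINT u|lborel. \<bar>\<Phi> 0 u\<bar>) * (A * (r * h) powr \<alpha>)"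
proof -
  note i = scaled_bump_integral(1)[OF \<Phi>, where k=0]
  have "b y = (LINT u|lborel. \<Phi> 0 u *\<^sub>R b y)"
    using total i[where b="\<lambda>_. 1::real"] by simp
  moreover have "smoothed m \<Phi> b h 0 y = (LINT u|lborel. (\<Sum>i=1..m. ((- 1) ^ (i + 1) * real (m choose i)) *\<^sub>R (\<Phi> 0 u *\<^sub>R b (y + real i * h * u))))"
  proof -
    have "integrable lborel (\<lambda>u. \<Phi> 0 u *\<^sub>R b (y + real i * h * u))" for i
      by (intro i continuous_on_affine_compose b)
    then show ?thesis
      by (simp only: smoothed_def moll_def power_0 scaleR_one Bochner_Integration.integral_sum
        integrable_scaleR_right integral_scaleR_right)
  qed
  ultimately have "b y - smoothed m \<Phi> b h 0 y = (LINT u|lborel. \<Phi> 0 u *\<^sub>R b y) -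
     (LINT u|lborel. (\<Sum>i=1..m. ((- 1) ^ (i + 1) * real (m choose i)) *\<^sub>R (\<Phi> 0 u *\<^sub>R b (y + real i * h * u))))"
    by simp
  also have "\<dots> = (LINT u|lborel. \<Phi> 0 u *\<^sub>R b y - (\<Sum>i=1..m. ((- 1) ^ (i + 1) * real (m choose i)) *\<^sub>R (\<Phi> 0 u *\<^sub>R b (y + real i * h * u))))"
    by (intro Bochner_Integration.integral_diff[symmetric] Bochner_Integration.integrable_sum integrable_scaleR_right i)
       (auto intro!: continuous_on_affine_compose b)
  also have "\<dots> = (LINT u|lborel. \<Phi> 0 u *\<^sub>R (b y - (\<Sum>i=1..m. ((- 1) ^ (i + 1) * real (m choose i)) *\<^sub>R b (y + real i * (h * u)))))"
    by (intro Bochner_Integration.integral_cong refl) (simp add: scaleR_diff_right scaleR_sum_right scaleR_left_commute mult.assoc mult_ac)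
  also have "norm \<dots> \<le> (LINT u|lborel. \<bar>\<Phi> 0 u\<bar>) * (A * (r * h) powr \<alpha>)"
  proof (rule scaled_bump_bound[OF \<Phi>])
    show "continuous_on UNIV (\<lambda>u. b y - (\<Sum>i=1..m. ((- 1) ^ (i + 1) * real (m choose i)) *\<^sub>R b (y + real i * (h * u))))"
      by (intro continuous_intros continuous_on_compose2[OF b]) auto
    fix u assume u: "\<bar>u\<bar> \<le> r"
    have "A * \<bar>h * u\<bar> powr \<alpha> \<le> A * (r * h) powr \<alpha>"
      using u h \<alpha> A0 by (intro mult_left_mono powr_mono2) (auto simp: abs_mult mult.commute intro: mult_right_mono)
    then show "norm (b y - (\<Sum>i=1..m. ((- 1) ^ (i + 1) * real (m choose i)) *\<^sub>R b (y + real i * (h * u)))) \<le> A * (r * h) powr \<alpha>"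
      unfolding fwd_diff_pow_split using A[of "h * u" y] by (simp add: power_abs)
  qed
  finally show ?thesis .
qed

text \<open>At each of the scales \<open>i * h\<close> a kernel derivative of order at least
  \<open>m\<close> meets \<open>b\<close>, and it sees only m-th differences of step
  \<open>i * h\<close>.\<close>

lemma smoothed_high_derivatives:
  assumes "m \<le> k"
  shows "\<exists>C\<ge>0. \<forall>b A h y. continuous_on UNIV b \<longrightarrow>
     (\<forall>t y. norm ((fwd_diff t ^^ m) b y) \<le> A * \<bar>t\<bar> powr \<alpha>) \<longrightarrow> 0 < h \<longrightarrow> 0 \<le> A \<longrightarrow>
     norm (smoothed m \<Phi> b h k y) * h ^ k \<le> C * A * h powr \<alpha>"
proof -
  obtain C where C: "C \<ge> 0" "diff_bound m (\<Phi> (k - m + m)) C"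
    using kernel unfolding diff_kernel_def by blast
  show ?thesis
  proof (intro exI[of _ "2 ^ m * (C * real m powr \<alpha>)"] conjI allI impI)
    fix b :: "real \<Rightarrow> complex" and A h y :: real
    assume b: "continuous_on UNIV b" and A: "\<forall>t y. norm ((fwd_diff t ^^ m) b y) \<le> A * \<bar>t\<bar> powr \<alpha>"
      and h: "0 < h" and A0: "(0::real) \<le> A"
    have "norm (moll \<Phi> b (real i * h) k y) \<le> C * (A * (real m * h) powr \<alpha>) / h ^ k" if i: "i \<in> {1..m}" for i
    proof -
      have ih: "0 < real i * h" using i h by simp
      have "norm (LINT u|lborel. \<Phi> (k - m + m) u *\<^sub>R b (y + (real i * h) * u)) \<le> C * (A * \<bar>- (real i * h)\<bar> powr \<alpha>)"
        by (rule diff_boundD[OF C(2) b]) (use A in blast)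
      also have "\<dots> \<le> C * (A * (real m * h) powr \<alpha>)"
        using C(1) A0 i h \<alpha> by (intro mult_left_mono powr_mono2) (auto simp: abs_mult intro!: mult_right_mono)
      finally have 1: "norm (LINT u|lborel. \<Phi> k u *\<^sub>R b (y + (real i * h) * u)) \<le> C * (A * (real m * h) powr \<alpha>)"
        using assms by simp
      have "norm (moll \<Phi> b (real i * h) k y) = norm (LINT u|lborel. \<Phi> k u *\<^sub>R b (y + (real i * h) * u)) / (real i * h) ^ k"
        using ih h by (simp add: moll_def power_abs power_divide abs_mult)
      also have "\<dots> \<le> C * (A * (real m * h) powr \<alpha>) / h ^ k"
        using 1 C(1) A0 i h ih by (intro frac_le power_mono) (auto simp: mult_le_cancel_right1)
      finally show ?thesis .
    qed
    then have "norm (smoothed m \<Phi> b h k y) \<le> 2 ^ m * (C * (A * (real m * h) powr \<alpha>) / h ^ k)"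
      unfolding smoothed_def by (rule binomial_weighted_bound[OF m])
    then have "norm (smoothed m \<Phi> b h k y) * h ^ k \<le> 2 ^ m * (C * (A * (real m * h) powr \<alpha>) / h ^ k) * h ^ k"
      using h by (intro mult_right_mono) auto
    also have "\<dots> = 2 ^ m * (C * (A * (real m * h) powr \<alpha>))" using h by simp
    finally show "norm (smoothed m \<Phi> b h k y) * h ^ k \<le> 2 ^ m * (C * real m powr \<alpha>) * A * h powr \<alpha>"
      using h by (simp add: powr_mult algebra_simps)
  qed (use C in simp)
qed

text \<open>Below order \<open>m\<close> a single mollification may be large, since \<open>b\<close>
  may contain a polynomial. Two consecutive scales both approximate \<open>b\<close>, however, so
  their difference is small at order zero; from order \<open>m\<close> on each scale is small
  separately, and \<open>intermediate_derivatives\<close> fills the gap.\<close>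

lemma smoothed_difference:
  "\<exists>C\<ge>0. \<forall>b b' A h. (\<forall>x. (b has_vector_derivative b' x) (at x)) \<longrightarrow> continuous_on UNIV b' \<longrightarrow>
     (\<forall>t y. norm ((fwd_diff t ^^ m) b y) \<le> A * \<bar>t\<bar> powr \<alpha>) \<longrightarrow> 0 < h \<longrightarrow> 0 \<le> A \<longrightarrow>
     (\<forall>k\<le>K. \<forall>y. norm (smoothed m \<Phi> b h k y - smoothed m \<Phi> b (2 * h) k y) * h ^ k \<le> C * A * h powr \<alpha>)"
proof -
  define C0 where "C0 = (LINT u|lborel. \<bar>\<Phi> 0 u\<bar>) * r powr \<alpha>"
  have C0: "0 \<le> C0" by (simp add: C0_def)
  have "\<exists>C. \<forall>k\<ge>m. C k \<ge> 0 \<and> (\<forall>b A h y. continuous_on UNIV b \<longrightarrow>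
     (\<forall>t y. norm ((fwd_diff t ^^ m) b y) \<le> A * \<bar>t\<bar> powr \<alpha>) \<longrightarrow> 0 < h \<longrightarrow> 0 \<le> A \<longrightarrow>
     norm (smoothed m \<Phi> b h k y) * h ^ k \<le> C k * A * h powr \<alpha>)"
    using smoothed_high_derivatives by metis
  then obtain C1 where C1: "\<And>k. m \<le> k \<Longrightarrow> C1 k \<ge> 0" "\<And>b A h y k. m \<le> k \<Longrightarrow> continuous_on UNIV b \<Longrightarrow>
     (\<And>t y. norm ((fwd_diff t ^^ m) b y) \<le> A * \<bar>t\<bar> powr \<alpha>) \<Longrightarrow> 0 < h \<Longrightarrow> 0 \<le> A \<Longrightarrow>
     norm (smoothed m \<Phi> b h k y) * h ^ k \<le> C1 k * A * h powr \<alpha>" by blast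
  obtain L where L: "0 \<le> L" "\<And>D h B k y. dseq D \<Longrightarrow> 0 < h \<Longrightarrow> (\<And>y. norm (D 0 y :: complex) \<le> B) \<Longrightarrow>
     (\<And>y. norm (D m y) * h ^ m \<le> B) \<Longrightarrow> k\<le>m \<Longrightarrow> norm (D k y) * h ^ k \<le> L * B"
    using intermediate_derivatives[of m] by blast
  \<comment> \<open>The range \<open>{m..m+K}\<close> contains \<open>m\<close> even if
    \<open>K < m\<close>: order \<open>m\<close> is always needed for the interpolation.\<close>
  define C2 where "C2 = C0 + (\<Sum>k\<in>{m..m+K}. C1 k)"
  have C2: "C0 \<le> C2" "0 \<le> C2" "\<And>k. m \<le> k \<Longrightarrow> k \<le> m + K \<Longrightarrow> C1 k \<le> C2"
  proof -
    have nn: "0 \<le> (\<Sum>k\<in>{m..m+K}. C1 k)" using C1(1) by (intro sum_nonneg) auto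
    show "C0 \<le> C2" "0 \<le> C2" using C0 nn by (auto simp: C2_def)
    fix k assume "m \<le> k" "k \<le> m + K"
    then have "C1 k \<le> (\<Sum>k\<in>{m..m+K}. C1 k)" using C1(1) by (intro member_le_sum) auto
    then show "C1 k \<le> C2" using C0 by (simp add: C2_def)
  qed
  define C3 where "C3 = C2 * (1 + 2 powr \<alpha>)"
  have C3: "0 \<le> C3" using C2 by (simp add: C3_def)
  show ?thesis
  proof (intro exI[of _ "(L + 1) * C3"] conjI allI impI)
    show "0 \<le> (L + 1) * C3" using L(1) C3 by simp
    fix b b' :: "real \<Rightarrow> complex" and A h y :: real and k
    assume b: "\<forall>x. (b has_vector_derivative b' x) (at x)" "continuous_on UNIV b'"
      and A: "\<forall>t y. norm ((fwd_diff t ^^ m) b y) \<le> A * \<bar>t\<bar> powr \<alpha>" and h: "0 < h" and A0: "(0::real) \<le> A"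
      and k: "k \<le> K"
    have bc: "continuous_on UNIV b"
      using b(1) by (meson continuous_on_vector_derivative has_vector_derivative_at_within)
    define v where "v k y = smoothed m \<Phi> b h k y - smoothed m \<Phi> b (2 * h) k y" for k y
    have dv: "dseq v"
      unfolding v_def[abs_def] by (intro dseq_diff dseq_smoothed[of b b']) (use b h in auto)
    have approx: "norm (b y - smoothed m \<Phi> b h' 0 y) \<le> C2 * A * h' powr \<alpha>" if "0 < h'" for h' y
    proof -
      have "norm (b y - smoothed m \<Phi> b h' 0 y) \<le> C0 * (A * h' powr \<alpha>)"
        using smoothed_approx[OF bc _ that A0, of y] A r that by (simp add: C0_def powr_mult algebra_simps)
      also have "\<dots> \<le> C2 * (A * h' powr \<alpha>)" using C2 A0 by (intro mult_right_mono) auto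
      finally show ?thesis by (simp add: mult.assoc)
    qed
    have v0: "norm (v 0 y) \<le> C3 * A * h powr \<alpha>" for y
    proof -
      have "norm (v 0 y) \<le> norm (b y - smoothed m \<Phi> b h 0 y) + norm (b y - smoothed m \<Phi> b (2 * h) 0 y)"
        using norm_triangle_ineq4[of "b y - smoothed m \<Phi> b (2 * h) 0 y" "b y - smoothed m \<Phi> b h 0 y"]
        by (simp add: v_def)
      also have "\<dots> \<le> C2 * A * h powr \<alpha> + C2 * A * (2 * h) powr \<alpha>"
        using h by (intro add_mono approx) auto
      also have "\<dots> = C3 * A * h powr \<alpha>" using h by (simp add: C3_def powr_mult algebra_simps)
      finally show ?thesis .
    qed
    have vk: "norm (v k y) * h ^ k \<le> C3 * A * h powr \<alpha>" if "m \<le> k" "k \<le> m + K" for k y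
    proof -
      have s: "norm (smoothed m \<Phi> b h' k y) * h' ^ k \<le> C2 * A * h' powr \<alpha>" if "0 < h'" for h'
      proof -
        have "norm (smoothed m \<Phi> b h' k y) * h' ^ k \<le> C1 k * A * h' powr \<alpha>"
          by (rule C1(2)) (use bc A A0 that \<open>m \<le> k\<close> in auto)
        also have "\<dots> \<le> C2 * A * h' powr \<alpha>"
          using C2(3)[OF \<open>m \<le> k\<close> \<open>k \<le> m + K\<close>] A0 by (intro mult_right_mono) auto
        finally show ?thesis .
      qed
      have "norm (v k y) * h ^ k \<le> (norm (smoothed m \<Phi> b h k y) + norm (smoothed m \<Phi> b (2 * h) k y)) * h ^ k"
        unfolding v_def using h by (intro mult_right_mono norm_triangle_ineq4) auto
      also have "\<dots> \<le> norm (smoothed m \<Phi> b h k y) * h ^ k + norm (smoothed m \<Phi> b (2 * h) k y) * (2 * h) ^ k"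
        using h by (simp add: distrib_right power_mono mult_left_mono)
      also have "\<dots> \<le> C2 * A * h powr \<alpha> + C2 * A * (2 * h) powr \<alpha>"
        using h by (intro add_mono s) auto
      also have "\<dots> = C3 * A * h powr \<alpha>" using h by (simp add: C3_def powr_mult algebra_simps)
      finally show ?thesis .
    qed
    have B: "0 \<le> C3 * A * h powr \<alpha>" using C3 A0 by simp
    have "norm (v k y) * h ^ k \<le> (L + 1) * (C3 * A * h powr \<alpha>)"
    proof (cases "m \<le> k")
      case True
      then have "norm (v k y) * h ^ k \<le> C3 * A * h powr \<alpha>" using vk k by auto
      also have "\<dots> \<le> (L + 1) * (C3 * A * h powr \<alpha>)" using B L(1) by (simp add: distrib_right)
      finally show ?thesis .
    next
      case False
      then have "norm (v k y) * h ^ k \<le> L * (C3 * A * h powr \<alpha>)"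
        by (intro L(2)[OF dv h v0 vk]) auto
      then show ?thesis using B by (simp add: distrib_right)
    qed
    then show "norm (smoothed m \<Phi> b h k y - smoothed m \<Phi> b (2 * h) k y) * h ^ k \<le> (L + 1) * C3 * A * h powr \<alpha>"
      by (simp add: v_def mult.assoc)
  qed
qed

text \<open>For \<open>h \<le> 1\<close> the mollifier reaches no further than \<open>m * r\<close>,
  so a local Lipschitz bound survives with a constant independent of \<open>h\<close>. This supplies
  the majorant when the finest scale tends to zero.\<close>

lemma smoothed_lipschitz:
  assumes b: "continuous_on UNIV b" and h: "0 < h" "h \<le> 1"
    and L: "\<And>x y. \<bar>x\<bar> \<le> T + real m * r \<Longrightarrow> \<bar>y\<bar> \<le> T + real m * r \<Longrightarrow> norm (b x - b y) \<le> L * \<bar>x - y\<bar>"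
    and xy: "\<bar>x\<bar> \<le> T" "\<bar>y\<bar> \<le> T"
  shows "norm (smoothed m \<Phi> b h 0 x - smoothed m \<Phi> b h 0 y)
    \<le> 2 ^ m * (LINT u|lborel. \<bar>\<Phi> 0 u\<bar>) * L * \<bar>x - y\<bar>"
proof -
  have "norm (moll \<Phi> b (real i * h) 0 x - moll \<Phi> b (real i * h) 0 y) \<le> (LINT u|lborel. \<bar>\<Phi> 0 u\<bar>) * (L * \<bar>x - y\<bar>)"
    if i: "i \<in> {1..m}" for i
  proof -
    note int = scaled_bump_integral(1)[OF \<Phi>, where k=0]
    have "moll \<Phi> b (real i * h) 0 x - moll \<Phi> b (real i * h) 0 y =
      (LINT u|lborel. \<Phi> 0 u *\<^sub>R (b (x + (real i * h) * u) - b (y + (real i * h) * u)))"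
      unfolding moll_def scaleR_diff_right
      by (subst Bochner_Integration.integral_diff) (auto intro!: int continuous_on_affine_compose b)
    also have "norm \<dots> \<le> (LINT u|lborel. \<bar>\<Phi> 0 u\<bar>) * (L * \<bar>x - y\<bar>)"
    proof (rule scaled_bump_bound[OF \<Phi>])
      show "continuous_on UNIV (\<lambda>u. b (x + real i * h * u) - b (y + real i * h * u))"
        by (intro continuous_intros continuous_on_affine_compose b)
      fix u assume u: "\<bar>u\<bar> \<le> r"
      have "\<bar>real i * h * u\<bar> \<le> real m * 1 * r"
        unfolding abs_mult using u h i by (intro mult_mono) auto
      then show "norm (b (x + real i * h * u) - b (y + real i * h * u)) \<le> L * \<bar>x - y\<bar>"
        using L[of "x + real i * h * u" "y + real i * h * u"] xy by auto
    qed
    finally show ?thesis .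
  qed
  then have "norm (\<Sum>i=1..m. ((- 1) ^ (i + 1) * real (m choose i)) *\<^sub>R (moll \<Phi> b (real i * h) 0 x - moll \<Phi> b (real i * h) 0 y))
     \<le> 2 ^ m * ((LINT u|lborel. \<bar>\<Phi> 0 u\<bar>) * (L * \<bar>x - y\<bar>))"
    by (rule binomial_weighted_bound[OF m])
  then show ?thesis
    by (simp only: smoothed_def scaleR_diff_right sum_subtractf mult.assoc)
qed

end

section \<open>Pairing with the grand maximal function\<close>

lemma compact_support_bounded:
  fixes g :: "real \<Rightarrow> 'a::real_normed_vector"
  assumes "continuous_on UNIV g" "\<And>x. x \<notin> {a..b} \<Longrightarrow> g x = 0"
  shows "bounded (range g)"
proof -
  have "bounded (g ` {a..b})"
    by (intro compact_imp_bounded compact_continuous_image continuous_on_subset[OF assms(1)]) auto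
  then have "bounded (insert 0 (g ` {a..b}))" by simp
  then show ?thesis by (rule bounded_subset) (use assms(2) in blast)
qed

text \<open>Bounds the test-class integral of a function supported in \<open>{-1..1}\<close> with
  derivatives at most 1: length 2, weight at most \<open>2 ^ n\<close>, and \<open>n + 2\<close>
  derivatives.\<close>

definition pairing_const :: "nat \<Rightarrow> real" where
  "pairing_const n = 2 ^ Suc n * real (n + 2)"

text \<open>Reflected, rescaled to unit width and divided by \<open>c\<close>, the function
  \<open>D 0\<close> is a test function, and its dilate by \<open>h\<close> evaluated at
  \<open>u\<close> gives back the pairing. The supremum is nontangential, so every \<open>z\<close>
  closer than \<open>h\<close> to \<open>u\<close> may serve.\<close>

lemma grand_max_pairing:
  fixes D :: "nat \<Rightarrow> real \<Rightarrow> complex"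
  assumes D: "dseq D" and h: "0 < h" and supp: "\<And>k s. h \<le> \<bar>s - u\<bar> \<Longrightarrow> D k s = 0"
    and B: "\<And>k s. k \<le> Suc n \<Longrightarrow> norm (D k s) * h ^ k \<le> B" and z: "\<bar>z - u\<bar> < h"
  shows "ennreal (norm (LINT s|lborel. D 0 s * f s)) \<le> ennreal (pairing_const n * B * h) * grand_max n f z"
proof (cases "B \<le> 0")
  case True
  then have "D 0 s = 0" for s using B[of 0 s, simplified] True by (simp flip: norm_le_zero_iff)
  then show ?thesis by simp
next
  case False
  define c where "c = pairing_const n * B"
  have pc: "0 < pairing_const n" by (simp add: pairing_const_def)
  then have c: "0 < c" using False by (simp add: c_def)
  define \<phi> where "\<phi> k w = (1 / c) *\<^sub>R ((- h) ^ k *\<^sub>R D k (u + (- h) * w))" for k w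
  have \<phi>: "dseq \<phi>" unfolding \<phi>_def[abs_def] by (intro dseq_scaleR dseq_affine D)
  have \<phi>0: "\<phi> k w = 0" if "1 \<le> \<bar>w\<bar>" for k w
    using supp[of "u + (- h) * w" k] that h by (simp add: \<phi>_def abs_mult)
  have \<phi>B: "norm (\<phi> k w) \<le> 1 / pairing_const n" if "k \<le> Suc n" for k w
  proof -
    have "norm (\<phi> k w) = (norm (D k (u + (- h) * w)) * h ^ k) / c"
      using c h by (simp add: \<phi>_def power_abs)
    also have "\<dots> \<le> B / c" using B[OF that] c by (intro divide_right_mono) auto
    also have "\<dots> = 1 / pairing_const n" using False by (simp add: c_def)
    finally show ?thesis .
  qed
  have "schwartz (\<phi> 0)"
    unfolding schwartz_def dseq_nth_deriv[OF \<phi>]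
  proof (intro conjI allI)
    show "\<phi> k differentiable at x" for k x
      using dseqD[OF \<phi>, of k x UNIV] by (rule differentiableI_vector)
    show "bounded (range (\<lambda>x. (1 + \<bar>x\<bar>) ^ m *\<^sub>R \<phi> k x))" for m k
    proof (rule compact_support_bounded[where a="-1" and b=1])
      show "continuous_on UNIV (\<lambda>x. (1 + \<bar>x\<bar>) ^ m *\<^sub>R \<phi> k x)"
        by (intro continuous_on_scaleR dseq_continuous[OF \<phi>] continuous_intros)
      show "(1 + \<bar>x\<bar>) ^ m *\<^sub>R \<phi> k x = 0" if "x \<notin> {-1..1}" for x
        using \<phi>0[of x k] that by (auto simp: abs_if split: if_splits)
    qed
  qed
  moreover have "(LINT x|lborel. (1 + \<bar>x\<bar>) ^ n * (\<Sum>k\<le>n + 1. norm (nth_deriv k (\<phi> 0) x))) \<le> 1"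
  proof -
    let ?c = "2 ^ n * (real (n + 2) * (1 / pairing_const n))"
    have c0: "0 \<le> ?c" using pc by simp
    have "(LINT x|lborel. (1 + \<bar>x\<bar>) ^ n * (\<Sum>k\<le>n + 1. norm (nth_deriv k (\<phi> 0) x))) \<le> (LINT x|lborel. indicator {-1..1::real} x *\<^sub>R ?c)"
    proof (rule Bochner_Integration.integral_mono')
      show "integrable lborel (\<lambda>x. indicat_real {-1..1::real} x *\<^sub>R ?c)"
        by (rule borel_integrable_compact) auto
      fix x :: real
      show "0 \<le> indicat_real {-1..1} x *\<^sub>R ?c" using c0 by (simp add: indicator_def)
      show "(1 + \<bar>x\<bar>) ^ n * (\<Sum>k\<le>n + 1. norm (nth_deriv k (\<phi> 0) x)) \<le> indicat_real {-1..1} x *\<^sub>R ?c"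
      proof (cases "\<bar>x\<bar> \<le> 1")
        case True
        have "(\<Sum>k\<le>n + 1. norm (nth_deriv k (\<phi> 0) x)) \<le> (\<Sum>k\<le>n + 1. 1 / pairing_const n)"
          unfolding dseq_nth_deriv[OF \<phi>] using \<phi>B by (intro sum_mono) auto
        also have "\<dots> = real (n + 2) * (1 / pairing_const n)" by simp
        finally have "(1 + \<bar>x\<bar>) ^ n * (\<Sum>k\<le>n + 1. norm (nth_deriv k (\<phi> 0) x)) \<le> ?c"
          using True by (intro mult_mono power_mono sum_nonneg) auto
        then show ?thesis using True by (simp add: indicator_def abs_le_iff)
      next
        case False
        then have "nth_deriv k (\<phi> 0) x = 0" for k unfolding dseq_nth_deriv[OF \<phi>] by (intro \<phi>0) simp
        then show ?thesis using False c0 by (simp add: indicator_def)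
      qed
    qed
    also have "\<dots> = 2 * ?c" by simp
    also have "\<dots> = 1" using pc by (simp add: pairing_const_def)
    finally show ?thesis .
  qed
  ultimately have t: "\<phi> 0 \<in> test_class n" by (simp add: test_class_def)
  have "ennreal (norm (LINT s|lborel. (\<phi> 0 ((u - s) / h) /\<^sub>R h) * f s)) \<le> grand_max n f z"
    unfolding grand_max_def
    by (rule order_trans[OF _ SUP_upper[OF t]], rule order_trans[OF _ SUP_upper[of h]],
        rule order_trans[OF _ SUP_upper[of u]]) (use h z in \<open>auto simp: abs_less_iff\<close>)
  moreover have "(\<phi> 0 ((u - s) / h) /\<^sub>R h) * f s = (1 / (c * h)) *\<^sub>R (D 0 s * f s)" for s
    using h c by (simp add: \<phi>_def field_simps)
  ultimately have "ennreal (norm ((1 / (c * h)) *\<^sub>R (LINT s|lborel. D 0 s * f s))) \<le> grand_max n f z"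
    by (simp only: integral_scaleR_right)
  then have "ennreal (c * h) * ennreal (norm ((1 / (c * h)) *\<^sub>R (LINT s|lborel. D 0 s * f s))) \<le> ennreal (c * h) * grand_max n f z"
    by (rule mult_left_mono) simp
  then show ?thesis
    unfolding c_def[symmetric] using h c by (simp add: ennreal_mult[symmetric] abs_mult)
qed

subsection \<open>Difference quotients\<close>

text \<open>The derivatives of \<open>(V 0 y - V 0 0) / y\<close>, written as averages over the
  segment from 0 to \<open>y\<close>; in this form they are smooth across
  \<open>y = 0\<close>.\<close>

definition quot :: "(nat \<Rightarrow> real \<Rightarrow> complex) \<Rightarrow> nat \<Rightarrow> real \<Rightarrow> complex" where
  "quot V k y = integral {0..1} (\<lambda>\<theta>. \<theta> ^ k *\<^sub>R V (Suc k) (\<theta> * y))"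

lemma dseq_compose_mult:
  fixes V :: "nat \<Rightarrow> real \<Rightarrow> complex"
  assumes "dseq V"
  shows "((\<lambda>\<theta>. V k (\<theta> * y)) has_vector_derivative y *\<^sub>R V (Suc k) (\<theta> * y)) (at \<theta> within S)"
    "((\<lambda>y. V k (\<theta> * y)) has_vector_derivative \<theta> *\<^sub>R V (Suc k) (\<theta> * y)) (at y within S)"
proof -
  have "((\<lambda>\<theta>. \<theta> * y) has_vector_derivative y) (at \<theta>)" by (auto intro!: derivative_eq_intros)
  from vector_diff_chain_at[OF this, of "V k" "V (Suc k) (\<theta> * y)"] dseqD[OF assms]
  show "((\<lambda>\<theta>. V k (\<theta> * y)) has_vector_derivative y *\<^sub>R V (Suc k) (\<theta> * y)) (at \<theta> within S)"
    by (auto simp: o_def intro: has_vector_derivative_at_within)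
  have "((\<lambda>y. \<theta> * y) has_vector_derivative \<theta>) (at y)" by (auto intro!: derivative_eq_intros)
  from vector_diff_chain_at[OF this, of "V k" "V (Suc k) (\<theta> * y)"] dseqD[OF assms]
  show "((\<lambda>y. V k (\<theta> * y)) has_vector_derivative \<theta> *\<^sub>R V (Suc k) (\<theta> * y)) (at y within S)"
    by (auto simp: o_def intro: has_vector_derivative_at_within)
qed

lemma quot_integrable:
  fixes V :: "nat \<Rightarrow> real \<Rightarrow> complex"
  assumes "dseq V"
  shows "(\<lambda>\<theta>. \<theta> ^ j *\<^sub>R V k (\<theta> * y)) integrable_on cbox 0 1"
  by (intro integrable_continuous continuous_on_scaleR dseq_continuous2[OF assms] continuous_intros)

lemma dseq_quot:
  assumes "dseq V" shows "dseq (quot V)"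
  unfolding dseq_def quot_def[abs_def]
proof (intro allI)
  fix k y
  have "((\<lambda>y. integral (cbox 0 1) (\<lambda>\<theta>. \<theta> ^ k *\<^sub>R V (Suc k) (\<theta> * y))) has_vector_derivative
      integral (cbox 0 1) (\<lambda>\<theta>. \<theta> ^ k *\<^sub>R (\<theta> *\<^sub>R V (Suc (Suc k)) (\<theta> * y)))) (at y within UNIV)"
  proof (rule leibniz_rule_vector_derivative)
    show "((\<lambda>x. t ^ k *\<^sub>R V (Suc k) (t * x)) has_vector_derivative t ^ k *\<^sub>R (t *\<^sub>R V (Suc (Suc k)) (t * x))) (at x within UNIV)" for x t
      by (intro bounded_linear.has_vector_derivative[OF bounded_linear_scaleR_right] dseq_compose_mult assms)
    show "continuous_on (UNIV \<times> cbox 0 1) (\<lambda>(x, t). t ^ k *\<^sub>R (t *\<^sub>R V (Suc (Suc k)) (t * x)))"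
      unfolding split_beta by (intro continuous_on_scaleR dseq_continuous2[OF assms] continuous_intros)
  qed (use quot_integrable[OF assms] in auto)
  then show "((\<lambda>y. integral {0..1} (\<lambda>\<theta>. \<theta> ^ k *\<^sub>R V (Suc k) (\<theta> * y))) has_vector_derivative
      integral {0..1} (\<lambda>\<theta>. \<theta> ^ Suc k *\<^sub>R V (Suc (Suc k)) (\<theta> * y))) (at y)"
    by (simp add: mult.commute)
qed

lemma quot_0:
  assumes "dseq V" shows "y *\<^sub>R quot V 0 y = V 0 y - V 0 0"
proof -
  have "((\<lambda>\<theta>. y *\<^sub>R V 1 (\<theta> * y)) has_integral V 0 (1 * y) - V 0 (0 * y)) {0..1}"
    by (rule fundamental_theorem_of_calculus) (use dseq_compose_mult(1)[OF assms, of 0] in auto)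
  then show ?thesis by (auto simp: quot_def integral_unique simp flip: integral_cmul)
qed

text \<open>This is \<open>y *\<^sub>R quot V 0 y = V 0 y - V 0 0\<close> differentiated
  \<open>Suc k\<close> times; it is obtained by integrating the \<theta>-derivative of
  \<open>\<theta> ^ Suc k *\<^sub>R V (Suc k) (\<theta> * y)\<close>.\<close>

lemma quot_Suc:
  assumes "dseq V" shows "y *\<^sub>R quot V (Suc k) y + real (Suc k) *\<^sub>R quot V k y = V (Suc k) y"
proof -
  have "((\<lambda>\<theta>. \<theta> ^ Suc k *\<^sub>R (y *\<^sub>R V (Suc (Suc k)) (\<theta> * y)) + (real (Suc k) * \<theta> ^ k) *\<^sub>R V (Suc k) (\<theta> * y)) has_integral
     1 ^ Suc k *\<^sub>R V (Suc k) (1 * y) - 0 ^ Suc k *\<^sub>R V (Suc k) (0 * y)) {0..1}"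
  proof (rule fundamental_theorem_of_calculus)
    fix \<theta> :: real
    have "((\<lambda>\<theta>. \<theta> ^ Suc k) has_real_derivative real (Suc k) * \<theta> ^ k) (at \<theta> within {0..1})"
      by (auto intro!: derivative_eq_intros simp del: power_Suc)
    then show "((\<lambda>\<theta>. \<theta> ^ Suc k *\<^sub>R V (Suc k) (\<theta> * y)) has_vector_derivative
      \<theta> ^ Suc k *\<^sub>R (y *\<^sub>R V (Suc (Suc k)) (\<theta> * y)) + (real (Suc k) * \<theta> ^ k) *\<^sub>R V (Suc k) (\<theta> * y)) (at \<theta> within {0..1})"
      by (intro has_vector_derivative_scaleR dseq_compose_mult assms)
  qed auto
  then have "integral {0..1} (\<lambda>\<theta>. y *\<^sub>R (\<theta> ^ Suc k *\<^sub>R V (Suc (Suc k)) (\<theta> * y)) + real (Suc k) *\<^sub>R (\<theta> ^ k *\<^sub>R V (Suc k) (\<theta> * y))) = V (Suc k) y"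
    by (intro integral_unique) (simp add: algebra_simps)
  then show ?thesis
    using quot_integrable[OF assms, of "Suc k" "Suc (Suc k)" y] quot_integrable[OF assms, of k "Suc k" y]
    unfolding quot_def
    by (subst (asm) integral_add) (auto simp del: scaleR_scaleR power_Suc of_nat_Suc intro: integrable_cmul)
qed

lemma quot_bound:
  assumes "dseq V" "\<And>\<theta>. 0 \<le> \<theta> \<Longrightarrow> \<theta> \<le> 1 \<Longrightarrow> norm (V (Suc k) (\<theta> * y)) \<le> M"
  shows "norm (quot V k y) \<le> M"
proof -
  have "norm (integral {0..1} (\<lambda>\<theta>. \<theta> ^ k *\<^sub>R V (Suc k) (\<theta> * y))) \<le> M * (1 - 0)"
  proof (rule integral_bound)
    show "continuous_on {0..1} (\<lambda>\<theta>. \<theta> ^ k *\<^sub>R V (Suc k) (\<theta> * y))"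
      by (intro continuous_on_scaleR dseq_continuous2[OF assms(1)] continuous_intros)
    show "norm (t ^ k *\<^sub>R V (Suc k) (t * y)) \<le> M" if "t \<in> {0..1}" for t
    proof -
      have "norm (t ^ k *\<^sub>R V (Suc k) (t * y)) \<le> 1 * norm (V (Suc k) (t * y))"
        using that by (auto intro!: mult_left_le_one_le power_le_one simp: power_abs)
      then show ?thesis using assms(2)[of t] that by auto
    qed
  qed auto
  then show ?thesis by (simp add: quot_def)
qed

text \<open>Near 0 the quotient is an average of the next derivative, which gives
  \<open>B / h\<close>; far away \<open>quot_Suc\<close> trades a factor
  \<open>\<bar>y\<bar>\<close> for lower orders. The two bounds are added, whence
  \<open>n + 3\<close>. The quotient costs one derivative of \<open>V\<close>.\<close>

lemma quot_decay:
  assumes V: "dseq V" and h: "0 < h" and B: "\<And>k y. k \<le> Suc n \<Longrightarrow> norm (V k y) * h ^ k \<le> B" and k: "k \<le> n"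
  shows "norm (quot V k y) * h ^ k \<le> real (n + 3) * B / (h + \<bar>y\<bar>)"
proof -
  have B0: "0 \<le> B" using B[of 0 0] by (auto intro: order_trans[rotated])
  have near: "norm (quot V k y) * h ^ k * h \<le> B" if "k \<le> n" for k
  proof -
    have "norm (quot V k y) \<le> B / h ^ Suc k"
      using B[of "Suc k"] that h by (intro quot_bound V) (auto simp: field_simps)
    then show ?thesis using h by (simp add: field_simps)
  qed
  have far: "\<bar>y\<bar> * (norm (quot V k y) * h ^ k) \<le> real (n + 2) * B"
  proof (cases k)
    case 0
    have "\<bar>y\<bar> * norm (quot V 0 y) = norm (V 0 y - V 0 0)"
      unfolding quot_0[OF V, symmetric] by simp
    also have "\<dots> \<le> norm (V 0 y) + norm (V 0 0)" by (rule norm_triangle_ineq4)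
    also have "\<dots> \<le> 2 * B" using B[of 0 y] B[of 0 0] by simp
    also have "\<dots> \<le> real (n + 2) * B" using B0 by (intro mult_right_mono) auto
    finally show ?thesis using 0 by simp
  next
    case (Suc j)
    have "\<bar>y\<bar> * norm (quot V (Suc j) y) = norm (V (Suc j) y - real (Suc j) *\<^sub>R quot V j y)"
      unfolding quot_Suc[OF V, symmetric] by simp
    also have "\<dots> \<le> norm (V (Suc j) y) + real (Suc j) * norm (quot V j y)"
      by (rule order_trans[OF norm_triangle_ineq4]) simp
    finally have "\<bar>y\<bar> * norm (quot V (Suc j) y) * h ^ Suc j \<le> (norm (V (Suc j) y) + real (Suc j) * norm (quot V j y)) * h ^ Suc j"
      using h by (intro mult_right_mono) auto
    also have "\<dots> = norm (V (Suc j) y) * h ^ Suc j + real (Suc j) * (norm (quot V j y) * h ^ j * h)"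
      by (simp add: algebra_simps)
    also have "\<dots> \<le> B + real (Suc j) * B"
      using B[of "Suc j" y] near[of j] k Suc by (intro add_mono mult_left_mono) auto
    also have "\<dots> = real (j + 2) * B" by (simp add: algebra_simps)
    also have "\<dots> \<le> real (n + 2) * B" using B0 k Suc by (intro mult_right_mono) auto
    finally show ?thesis using Suc by (simp add: mult.assoc)
  qed
  have "(norm (quot V k y) * h ^ k) * (h + \<bar>y\<bar>) \<le> B + real (n + 2) * B"
    unfolding distrib_left using near[OF k] far by (intro add_mono) (auto simp: mult.commute mult.assoc)
  also have "\<dots> = real (n + 3) * B" by (simp add: algebra_simps)
  finally show ?thesis using h by (simp add: pos_le_divide_eq add_pos_nonneg)
qed

section \<open>Dyadic level sums and splitting into bumps\<close>

text \<open>A substitute for the infimum of \<open>F\<close> over \<open>ball u h\<close>: the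
  dyadic levels below the infimum form a geometric sum comparable with it. Unlike the infimum it is
  a sum of indicators, so the levels can be treated one at a time.\<close>

definition level_sum :: "(real \<Rightarrow> ennreal) \<Rightarrow> real \<Rightarrow> real \<Rightarrow> ennreal" where
  "level_sum F h u = (\<integral>\<^sup>+k. ennreal (2 powr (real_of_int k + 1)) *
      indicator {u. ball u h \<subseteq> {z. ennreal (2 powr real_of_int k) < F z}} u \<partial>count_space UNIV)"

lemma dyadic_level:
  assumes "0 < (y::real)"
  obtains k :: int where "2 powr real_of_int k < y" "y \<le> 2 powr (real_of_int k + 1)"
proof
  define k where "k = \<lceil>log 2 y\<rceil> - 1"
  have "real_of_int k < log 2 y" "log 2 y \<le> real_of_int k + 1"
    unfolding k_def by linarith+
  then show "2 powr real_of_int k < y" "y \<le> 2 powr (real_of_int k + 1)"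
    using assms by (simp_all add: less_log_iff log_le_iff)
qed

text \<open>The largest dyadic level below \<open>X / c\<close> is exceeded by \<open>F\<close> on
  the whole ball, and its single term in the sum, which carries the next power of two, already
  reaches \<open>X / c\<close>.\<close>

lemma level_sum_ge:
  assumes "0 \<le> c" "\<And>z. \<bar>z - u\<bar> < h \<Longrightarrow> ennreal X \<le> ennreal c * F z" "0 < h"
  shows "ennreal X \<le> ennreal c * level_sum F h u"
proof (cases "X \<le> 0 \<or> c = 0")
  case True
  then show ?thesis using assms(2)[of u] assms(3) by (auto simp: ennreal_neg)
next
  case False
  then have X: "0 < X" and c: "0 < c" using assms by auto
  then have "0 < X / c" by simp
  then obtain k :: int where k: "2 powr real_of_int k < X / c" "X / c \<le> 2 powr (real_of_int k + 1)"
    by (rule dyadic_level)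
  have "ball u h \<subseteq> {z. ennreal (2 powr real_of_int k) < F z}"
  proof safe
    fix z assume "z \<in> ball u h"
    then have "ennreal X \<le> ennreal c * F z" using assms(2)[of z] by (simp add: dist_real_def abs_minus_commute)
    then have "ennreal (1 / c) * ennreal X \<le> ennreal (1 / c) * (ennreal c * F z)" by (rule mult_left_mono) simp
    also have "\<dots> = F z" using c by (simp add: mult.assoc[symmetric] ennreal_mult[symmetric])
    also have "ennreal (1 / c) * ennreal X = ennreal (X / c)" using X c by (simp add: ennreal_mult[symmetric])
    finally have "ennreal (X / c) \<le> F z" .
    moreover have "ennreal (2 powr real_of_int k) < ennreal (X / c)" using k(1) by (simp add: ennreal_less_iff)
    ultimately show "ennreal (2 powr real_of_int k) < F z" by (rule less_le_trans[rotated])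
  qed
  then have "ennreal (2 powr (real_of_int k + 1)) \<le> level_sum F h u"
    unfolding level_sum_def
    by (intro order_trans[OF _ nn_integral_ge_point[of k]]) auto
  then have "ennreal c * ennreal (X / c) \<le> ennreal c * level_sum F h u"
    using k(2) by (intro mult_left_mono) (auto intro: order_trans[OF ennreal_leI])
  then show ?thesis using X c by (simp add: ennreal_mult[symmetric])
qed

definition unit_bump :: "(nat \<Rightarrow> real \<Rightarrow> real) \<Rightarrow> bool" where
  "unit_bump \<rho> \<longleftrightarrow> dseq \<rho> \<and> (\<forall>k x. 1 \<le> \<bar>x\<bar> \<longrightarrow> \<rho> k x = 0) \<and> (LINT x|lborel. \<rho> 0 x) = 1"

lemma unit_bumpD:
  assumes "unit_bump \<rho>"
  shows "dseq \<rho>" "\<And>k x. 1 \<le> \<bar>x\<bar> \<Longrightarrow> \<rho> k x = 0" "(LINT x|lborel. \<rho> 0 x) = 1"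
  using assms by (auto simp: unit_bump_def)

definition bump_const :: "nat \<Rightarrow> (nat \<Rightarrow> real \<Rightarrow> real) \<Rightarrow> real" where
  "bump_const n \<rho> = (SOME C. 0 \<le> C \<and> (\<forall>k\<le>Suc n. \<forall>x. \<bar>\<rho> k x\<bar> \<le> C))"

lemma bump_const:
  assumes "unit_bump \<rho>"
  shows "0 \<le> bump_const n \<rho>" "\<And>k x. k \<le> Suc n \<Longrightarrow> \<bar>\<rho> k x\<bar> \<le> bump_const n \<rho>"
proof -
  note \<rho> = unit_bumpD[OF assms]
  have "\<exists>C\<ge>0. \<forall>x. \<bar>\<rho> k x\<bar> \<le> C" for k
  proof -
    have "bounded (range (\<rho> k))"
      by (rule compact_support_bounded[where a="-1" and b=1])
        (use dseq_continuous[OF \<rho>(1)] \<rho>(2)[of _ k] in \<open>auto simp: abs_if\<close>)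
    then obtain B where "\<forall>x. norm (\<rho> k x) \<le> B" by (auto simp: bounded_iff)
    then show ?thesis by (intro exI[of _ B]) (auto intro: order_trans[OF abs_ge_zero])
  qed
  then obtain C where C: "\<And>k. 0 \<le> C k" "\<And>k x. \<bar>\<rho> k x\<bar> \<le> C k" by metis
  have "0 \<le> (\<Sum>k\<le>Suc n. C k) \<and> (\<forall>k\<le>Suc n. \<forall>x. \<bar>\<rho> k x\<bar> \<le> (\<Sum>k\<le>Suc n. C k))"
  proof (intro conjI allI impI sum_nonneg)
    fix k x assume "k \<le> Suc n"
    then have "C k \<le> (\<Sum>k\<le>Suc n. C k)" using C(1) by (intro member_le_sum) auto
    then show "\<bar>\<rho> k x\<bar> \<le> (\<Sum>k\<le>Suc n. C k)" using C(2)[of k x] by linarith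
  qed (use C in auto)
  then have "0 \<le> bump_const n \<rho> \<and> (\<forall>k\<le>Suc n. \<forall>x. \<bar>\<rho> k x\<bar> \<le> bump_const n \<rho>)"
    unfolding bump_const_def by (rule someI)
  then show "0 \<le> bump_const n \<rho>" "\<And>k x. k \<le> Suc n \<Longrightarrow> \<bar>\<rho> k x\<bar> \<le> bump_const n \<rho>" by auto
qed

text \<open>The derivatives of \<open>\<rho> 0 ((s - u) / h)\<close>, with the argument in the
  affine form of \<open>dseq_affine\<close>.\<close>

definition scaled :: "(nat \<Rightarrow> real \<Rightarrow> real) \<Rightarrow> real \<Rightarrow> real \<Rightarrow> nat \<Rightarrow> real \<Rightarrow> complex" where
  "scaled \<rho> h u k s = of_real ((1 / h) ^ k *\<^sub>R \<rho> k (- u / h + (1 / h) * s))"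

lemma scaled_0: "h \<noteq> 0 \<Longrightarrow> scaled \<rho> h u 0 s = of_real (\<rho> 0 ((s - u) / h))"
  by (simp add: scaled_def diff_divide_distrib)

lemma scaled:
  assumes "unit_bump \<rho>" "0 < h"
  shows "dseq (scaled \<rho> h u)" "\<And>k s. h \<le> \<bar>s - u\<bar> \<Longrightarrow> scaled \<rho> h u k s = 0"
    "\<And>k s. k \<le> Suc n \<Longrightarrow> norm (scaled \<rho> h u k s) * h ^ k \<le> bump_const n \<rho>"
proof -
  show "dseq (scaled \<rho> h u)"
    unfolding scaled_def[abs_def] by (intro dseq_of_real dseq_affine unit_bumpD assms)
  show "scaled \<rho> h u k s = 0" if "h \<le> \<bar>s - u\<bar>" for k s
  proof -
    have "- u / h + (1 / h) * s = (s - u) / h" using assms(2) by (simp add: field_simps)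
    moreover have "1 \<le> \<bar>(s - u) / h\<bar>" using that assms(2) by (simp add: field_simps)
    ultimately show ?thesis using unit_bumpD(2)[OF assms(1)] by (simp add: scaled_def)
  qed
  show "norm (scaled \<rho> h u k s) * h ^ k \<le> bump_const n \<rho>" if "k \<le> Suc n" for k s
    using bump_const(2)[OF assms(1) that, of "- u / h + (1 / h) * s"] assms(2)
    by (simp add: scaled_def abs_mult power_abs power_one_over norm_divide norm_power)
qed

lemma single_bump_bound:
  fixes G :: "nat \<Rightarrow> real \<Rightarrow> complex"
  assumes G: "dseq G" and bump: "unit_bump \<rho>" and h: "0 < h"
    and B: "\<And>k s. k \<le> Suc n \<Longrightarrow> \<bar>s - u\<bar> < h \<Longrightarrow> norm (G k s) * h ^ k \<le> B" and z: "\<bar>z - u\<bar> < h"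
  shows "ennreal (norm (LINT s|lborel. G 0 s * of_real (\<rho> 0 ((s - u) / h)) * f s))
    \<le> ennreal (pairing_const n * (2 ^ Suc n * B * bump_const n \<rho>) * h) * grand_max n f z"
proof -
  note sc = scaled[OF bump h]
  have B0: "0 \<le> B" using B[of 0 u] h by (auto intro: order_trans[rotated])
  have "ennreal (norm (LINT s|lborel. dmul G (scaled \<rho> h u) 0 s * f s))
    \<le> ennreal (pairing_const n * (2 ^ Suc n * B * bump_const n \<rho>) * h) * grand_max n f z"
  proof (rule grand_max_pairing[OF dseq_dmul[OF G sc(1)] h _ _ z])
    show z: "dmul G (scaled \<rho> h u) k s = 0" if "h \<le> \<bar>s - u\<bar>" for k s
      by (rule dmul_eq_0) (use sc(2)[OF that] in auto)
    show "norm (dmul G (scaled \<rho> h u) k s) * h ^ k \<le> 2 ^ Suc n * B * bump_const n \<rho>" if k: "k \<le> Suc n" for k s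
    proof (cases "\<bar>s - u\<bar> < h")
      case True
      have "norm (dmul G (scaled \<rho> h u) k s) * h ^ k \<le> 2 ^ k * B * bump_const n \<rho>"
        by (rule dmul_bound) (use B sc(3) True k h in auto)
      also have "\<dots> \<le> 2 ^ Suc n * B * bump_const n \<rho>"
        using k B0 bump_const(1)[OF bump] by (intro mult_right_mono power_increasing) auto
      finally show ?thesis .
    next
      case False
      then show ?thesis using z B0 bump_const(1)[OF bump] by simp
    qed
  qed
  then show ?thesis using h by (simp add: scaled_0)
qed

text \<open>A smooth function of compact support is split into bumps of width \<open>h\<close> with a continuous
  partition of unity, the average of the translates of \<open>\<rho>\<close>.\<close>

lemma partitioned_pairing:
  fixes G :: "nat \<Rightarrow> real \<Rightarrow> complex"
  assumes G: "dseq G" and supp: "\<And>s. s \<notin> {a..b} \<Longrightarrow> G 0 s = 0"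
    and bump: "unit_bump \<rho>" and h: "0 < h"
    and B: "\<And>k s u. k \<le> Suc n \<Longrightarrow> \<bar>s - u\<bar> < h \<Longrightarrow> norm (G k s) * h ^ k \<le> w u"
    and f: "continuous_on UNIV f"
  shows "ennreal (norm (LINT s|lborel. G 0 s * f s))
    \<le> (\<integral>\<^sup>+u. ennreal (pairing_const n * (2 ^ Suc n * w u * bump_const n \<rho>)) * level_sum (grand_max n f) h u \<partial>lborel)"
proof -
  note \<rho> = unit_bumpD[OF bump]
  define T where "T u s = G 0 s * of_real (\<rho> 0 ((s - u) / h)) * f s" for u s
  have G0: "continuous_on S (G 0)" for S by (rule dseq_continuous[OF G])
  have Tc: "continuous_on S (\<lambda>(u, s). T u s)" for S
    unfolding split_beta T_def
    by (intro continuous_on_mult continuous_on_of_real dseq_continuous2[OF G] dseq_continuous2[OF \<rho>(1)]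
        continuous_on_compose2[OF f] continuous_intros) (use h in auto)
  have Tc1: "continuous_on UNIV (T u)" for u
    unfolding T_def
    by (intro continuous_on_mult continuous_on_of_real dseq_continuous2[OF G] dseq_continuous2[OF \<rho>(1)]
        continuous_on_compose2[OF f] continuous_intros) (use h in auto)
  have Ts: "T u s = 0" if "s \<notin> {a..b}" for u s using supp[OF that] by (simp add: T_def)
  have Tu: "T u s = 0" if "u \<notin> {a-h..b+h}" for u s
  proof (cases "s \<in> {a..b}")
    case True
    then have "1 \<le> \<bar>(s - u) / h\<bar>" using that h by (auto simp: field_simps abs_if)
    then show ?thesis by (simp add: T_def \<rho>(2))
  qed (rule Ts)
  define J where "J u = (LINT s|lborel. T u s)" for u
  have J_eq: "J u = integral (cbox a b) (T u)" for u
    unfolding J_def using compact_support_integral(2)[OF Tc1 Ts] by simp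
  have Jc: "continuous_on UNIV J"
    unfolding J_eq[abs_def] by (rule integral_continuous_on_param) (rule Tc)
  have Js: "J u = 0" if "u \<notin> {a-h..b+h}" for u
  proof -
    have "T u = (\<lambda>s. 0)" using Tu[OF that] by blast
    then show ?thesis by (simp add: J_def)
  qed
  note Ji = compact_support_integral[OF Jc Js]
  \<comment> \<open>The translates of the bump have total mass \<open>h\<close> at every
    \<open>s\<close> of the support: divided by \<open>h\<close> they form the partition of
    unity.\<close>
  have one: "integral {a-h..b+h} (\<lambda>u. \<rho> 0 ((s - u) / h)) = h" if "s \<in> {a..b}" for s
  proof -
    have "integral {a-h..b+h} (\<lambda>u. \<rho> 0 ((s - u) / h)) = (LINT u|lborel. \<rho> 0 ((s - u) / h))"
    proof (rule compact_support_integral(2)[symmetric])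
      show "continuous_on UNIV (\<lambda>u. \<rho> 0 ((s - u) / h))"
        by (intro dseq_continuous2[OF \<rho>(1)] continuous_intros) (use h in auto)
      fix u assume "u \<notin> {a-h..b+h}"
      then show "\<rho> 0 ((s - u) / h) = 0"
        using that h by (intro \<rho>(2)) (auto simp: field_simps abs_if)
    qed
    also have "\<dots> = \<bar>- h\<bar> *\<^sub>R (LINT x|lborel. \<rho> 0 ((s - (s + (- h) * x)) / h))"
      by (rule lborel_integral_real_affine) (use h in simp)
    finally show ?thesis using h \<rho>(3) by simp
  qed
  have "of_real h * (LINT s|lborel. G 0 s * f s) = of_real h * integral (cbox a b) (\<lambda>s. G 0 s * f s)"
    using compact_support_integral(2)[of "\<lambda>s. G 0 s * f s" a b] supp
    by (auto intro!: continuous_on_mult G0 f)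
  also have "\<dots> = integral (cbox a b) (\<lambda>s. of_real h * (G 0 s * f s))"
    by (rule integral_mult_right[symmetric])
  also have "\<dots> = integral (cbox a b) (\<lambda>s. integral (cbox (a-h) (b+h)) (\<lambda>u. T u s))"
  proof (rule Henstock_Kurzweil_Integration.integral_cong)
    fix s assume s: "s \<in> cbox a b"
    have "integral (cbox (a-h) (b+h)) (\<lambda>u. T u s) = integral (cbox (a-h) (b+h)) (\<lambda>u. \<rho> 0 ((s - u) / h) *\<^sub>R (G 0 s * f s))"
      by (rule Henstock_Kurzweil_Integration.integral_cong) (simp add: T_def scaleR_conv_of_real algebra_simps)
    also have "\<dots> = integral (cbox (a-h) (b+h)) (\<lambda>u. \<rho> 0 ((s - u) / h)) *\<^sub>R (G 0 s * f s)"
    proof -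
      have "(\<lambda>u. \<rho> 0 ((s - u) / h)) integrable_on cbox (a-h) (b+h)"
        by (intro integrable_continuous dseq_continuous2[OF \<rho>(1)] continuous_intros) (use h in auto)
      from has_integral_scaleR_left[OF integrable_integral[OF this]] show ?thesis
        by (rule integral_unique)
    qed
    also have "\<dots> = of_real h * (G 0 s * f s)" using one[of s] s by (simp add: scaleR_conv_of_real)
    finally show "of_real h * (G 0 s * f s) = integral (cbox (a-h) (b+h)) (\<lambda>u. T u s)" ..
  qed
  also have "\<dots> = integral (cbox (a-h) (b+h)) (\<lambda>u. integral (cbox a b) (T u))"
    by (rule integral_swap_continuous[symmetric]) (rule Tc)
  also have "\<dots> = (LINT u|lborel. J u)" using Ji(2) by (simp add: J_eq)
  finally have "h * norm (LINT s|lborel. G 0 s * f s) = norm (LINT u|lborel. J u)"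
    using h by (metis abs_of_pos norm_mult norm_of_real)
  then have "norm (LINT s|lborel. G 0 s * f s) = norm (LINT u|lborel. (1 / h) *\<^sub>R J u)"
    using h by (simp add: field_simps)
  then have "ennreal (norm (LINT s|lborel. G 0 s * f s)) \<le> (\<integral>\<^sup>+u. ennreal (norm ((1 / h) *\<^sub>R J u)) \<partial>lborel)"
    using integral_norm_bound_ennreal[OF integrable_scaleR_right[OF Ji(1)], of "1 / h"] by simp
  also have "\<dots> \<le> (\<integral>\<^sup>+u. ennreal (pairing_const n * (2 ^ Suc n * w u * bump_const n \<rho>)) * level_sum (grand_max n f) h u \<partial>lborel)"
  proof (rule nn_integral_mono)
    fix u
    have w: "0 \<le> w u" using B[of 0 u u] h by (auto intro: order_trans[rotated])
    define c where "c = pairing_const n * (2 ^ Suc n * w u * bump_const n \<rho>)"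
    have c: "0 \<le> c" using w h bump_const(1)[OF bump] by (simp add: c_def pairing_const_def)
    \<comment> \<open>Pairing with one bump gains its width \<open>h\<close>, which cancels the
      \<open>1 / h\<close> of the partition.\<close>
    have "ennreal (norm (J u)) \<le> ennreal (c * h) * level_sum (grand_max n f) h u"
      unfolding J_def T_def c_def
      by (rule level_sum_ge[OF _ single_bump_bound[OF G bump h] h]) (use B c h in \<open>auto simp: c_def\<close>)
    then have "ennreal (1 / h) * ennreal (norm (J u)) \<le> ennreal (1 / h) * (ennreal (c * h) * level_sum (grand_max n f) h u)"
      by (rule mult_left_mono) simp
    then show "ennreal (norm ((1 / h) *\<^sub>R J u)) \<le> ennreal c * level_sum (grand_max n f) h u"
      using h c by (simp add: mult.assoc[symmetric] ennreal_mult[symmetric])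
  qed
  finally show ?thesis .
qed

subsection \<open>Powers of extended nonnegative functions\<close>

lemma epowr_ennreal: "0 \<le> x \<Longrightarrow> epowr (ennreal x) a = ennreal (x powr a)"
  by (simp add: epowr_def)

lemma epowr_top [simp]: "epowr top a = top"
  by (simp add: epowr_def)

lemma epowr_0 [simp]: "epowr 0 a = 0"
  by (simp add: epowr_def)

lemma epowr_one [simp]: "epowr u 1 = u"
  by (cases u) (auto simp: epowr_ennreal)

lemma epowr_mono: "0 \<le> a \<Longrightarrow> u \<le> v \<Longrightarrow> epowr u a \<le> epowr v a"
  by (cases u; cases v) (auto simp: epowr_ennreal ennreal_le_iff powr_mono2 top_unique)

lemma epowr_mult: "0 < a \<Longrightarrow> epowr (u * v) a = epowr u a * epowr v a"
proof (cases u; cases v)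
  fix x y assume "0 < a" "0 \<le> x" "u = ennreal x" "0 \<le> y" "v = ennreal y"
  then show ?thesis by (simp add: ennreal_mult[symmetric] epowr_ennreal powr_mult)
next
  fix x assume "0 < a" "0 \<le> x" "u = ennreal x" "v = top"
  then show ?thesis by (cases "x = 0") (auto simp: epowr_ennreal ennreal_mult_top)
next
  fix x assume "0 < a" "0 \<le> x" "v = ennreal x" "u = top"
  then show ?thesis by (cases "x = 0") (auto simp: epowr_ennreal ennreal_top_mult)
qed (simp add: ennreal_top_mult)

lemma epowr_epowr: "0 < a \<Longrightarrow> 0 < b \<Longrightarrow> epowr (epowr u a) b = epowr u (a * b)"
  by (cases u) (auto simp: epowr_ennreal powr_powr)

lemma epowr_add: "0 < a \<Longrightarrow> 0 < b \<Longrightarrow> epowr u (a + b) = epowr u a * epowr u b"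
  by (cases u) (auto simp: epowr_ennreal powr_add ennreal_mult[symmetric])

lemma epowr_less_top [simp]: "epowr u a < top \<longleftrightarrow> u < top"
  by (cases u) (auto simp: epowr_ennreal)

lemma epowr_eq_0 [simp]: "epowr u a = 0 \<longleftrightarrow> u = 0"
  by (cases u) (auto simp: epowr_ennreal)

lemma measurable_epowr [measurable]:
  assumes [measurable]: "f \<in> borel_measurable M"
  shows "(\<lambda>x. epowr (f x) a) \<in> borel_measurable M"
  unfolding epowr_def by measurable

text \<open>The graph of the convex function \<open>y powr p\<close> lies above its tangent at
  \<open>l\<close>; this is Young's inequality with exponents \<open>1 / p\<close> and
  \<open>1 - 1 / p\<close>.\<close>

lemma tangent_powr:
  fixes y l p :: real
  assumes "0 \<le> y" "0 < l" "1 \<le> p"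
  shows "p * l powr (p - 1) * y \<le> y powr p + (p - 1) * l powr p"
proof (cases "y = 0")
  case True
  then show ?thesis using assms by simp
next
  case False
  have "(y powr p) powr (1 / p) * (l powr p) powr (1 - 1 / p) \<le> (1 / p) * y powr p + (1 - 1 / p) * l powr p"
    using assms False by (intro Youngs_inequality_0) auto
  moreover have "(y powr p) powr (1 / p) = y" "(l powr p) powr (1 - 1 / p) = l powr (p - 1)"
    using assms False by (auto simp: powr_powr right_diff_distrib)
  ultimately have "p * (y * l powr (p - 1)) \<le> p * ((1 / p) * y powr p + (1 - 1 / p) * l powr p)"
    using assms by (intro mult_left_mono) auto
  then show ?thesis using assms by (simp add: algebra_simps)
qed

lemma tangent_epowr:
  assumes "0 < l" "1 \<le> p"
  shows "ennreal (p * l powr (p - 1)) * y \<le> epowr y p + ennreal ((p - 1) * l powr p)"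
proof (cases y)
  case (real r)
  then show ?thesis
    using tangent_powr[OF real(1) assms] assms
    by (simp add: epowr_ennreal ennreal_mult[symmetric] ennreal_plus[symmetric] del: ennreal_plus)
qed simp

text \<open>Jensen's inequality: the tangent inequality is integrated against the weight, with the
  mean as point of contact. Values in \<open>ennreal\<close> are allowed, so finiteness has to be
  established on the way.\<close>

lemma power_mean:
  assumes [measurable]: "w \<in> borel_measurable M" "y \<in> borel_measurable M"
    and W: "(\<integral>\<^sup>+x. w x \<partial>M) \<le> ennreal W" "0 \<le> W" and p: "1 \<le> p"
  shows "epowr (\<integral>\<^sup>+x. w x * y x \<partial>M) p \<le> ennreal (W powr (p - 1)) * (\<integral>\<^sup>+x. w x * epowr (y x) p \<partial>M)"
proof (cases "W = 0 \<or> (\<integral>\<^sup>+x. w x * epowr (y x) p \<partial>M) = top")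
  case True
  show ?thesis
  proof (cases "W = 0")
    case True
    then have "AE x in M. w x = 0" using W by (simp add: nn_integral_0_iff_AE)
    then have "(\<integral>\<^sup>+x. w x * y x \<partial>M) = (\<integral>\<^sup>+x. 0 \<partial>M)"
      by (intro nn_integral_cong_AE) auto
    then show ?thesis by simp
  next
    case False
    then show ?thesis using \<open>W = 0 \<or> _\<close> W by (simp add: ennreal_mult_top)
  qed
next
  case False
  then have W0: "0 < W" using W by simp
  define I where "I = (\<integral>\<^sup>+x. w x * y x \<partial>M)"
  define R where "R = enn2real (\<integral>\<^sup>+x. w x * epowr (y x) p \<partial>M)"
  have R: "(\<integral>\<^sup>+x. w x * epowr (y x) p \<partial>M) = ennreal R" "0 \<le> R"
    using False by (auto simp: R_def less_top)
  have key: "ennreal (p * l powr (p - 1)) * I \<le> ennreal (R + (p - 1) * l powr p * W)" if "0 < l" for l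
  proof -
    have "ennreal (p * l powr (p - 1)) * I = (\<integral>\<^sup>+x. w x * (ennreal (p * l powr (p - 1)) * y x) \<partial>M)"
      unfolding I_def by (subst nn_integral_cmult[symmetric]) (auto simp: mult_ac)
    also have "\<dots> \<le> (\<integral>\<^sup>+x. w x * epowr (y x) p + ennreal ((p - 1) * l powr p) * w x \<partial>M)"
      by (intro nn_integral_mono) (use mult_left_mono[OF tangent_epowr[OF that p]] in \<open>simp add: distrib_left mult.commute\<close>)
    also have "\<dots> = ennreal R + ennreal ((p - 1) * l powr p) * (\<integral>\<^sup>+x. w x \<partial>M)"
      by (subst nn_integral_add) (auto simp: R nn_integral_cmult)
    also have "\<dots> \<le> ennreal R + ennreal ((p - 1) * l powr p) * ennreal W"
      by (intro add_left_mono mult_left_mono W) auto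
    also have "\<dots> = ennreal (R + (p - 1) * l powr p * W)"
      using R W p by (simp add: ennreal_mult)
    finally show ?thesis .
  qed
  \<comment> \<open>The tangent at 1 already bounds the integral by a real number.\<close>
  have "I \<noteq> top" using key[of 1] p by (auto simp: top_unique ennreal_mult_top)
  then obtain i where i: "I = ennreal i" "0 \<le> i" by (cases I) auto
  show ?thesis
  proof (cases "i = 0")
    case True
    then show ?thesis using i by (simp add: I_def)
  next
    case False
    then have i0: "0 < i" using i by simp
    define l where "l = i / W"
    have l: "0 < l" using i0 W0 by (simp add: l_def)
    have "ennreal (p * l powr (p - 1) * i) \<le> ennreal (R + (p - 1) * l powr p * W)"
      using key[OF l] i p by (simp add: ennreal_mult)
    then have "p * l powr (p - 1) * i \<le> R + (p - 1) * l powr p * W"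
      using R p W by (subst (asm) ennreal_le_iff) auto
    moreover have "l powr p * W = l powr (p - 1) * i"
      using l W0 i0 by (simp add: powr_diff l_def)
    ultimately have "p * (l powr (p - 1) * i) \<le> R + (p - 1) * (l powr (p - 1) * i)" by (simp add: mult.assoc)
    then have "l powr (p - 1) * i \<le> R" by (simp add: left_diff_distrib)
    then have "W powr (p - 1) * (l powr (p - 1) * i) \<le> W powr (p - 1) * R"
      by (intro mult_left_mono) auto
    moreover have "W powr (p - 1) * (l powr (p - 1) * i) = i powr p"
      using W0 i0 by (simp add: l_def powr_divide powr_diff)
    ultimately show ?thesis
      using i R by (simp add: I_def[symmetric] epowr_ennreal ennreal_mult[symmetric])
  qed
qed

subsection \<open>Sums over the integers\<close>

text \<open>An integral for the counting measure, so that monotonicity, exchange with other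
  integrals and single-term bounds are those of \<open>nn_integral\<close>.\<close>

abbreviation isum :: "(int \<Rightarrow> ennreal) \<Rightarrow> ennreal" where
  "isum f \<equiv> integral\<^sup>N (count_space UNIV) f"

lemma measurable_isum [measurable (raw)]:
  assumes "\<And>k. f k \<in> borel_measurable M" shows "(\<lambda>x. isum (\<lambda>k. f k x)) \<in> borel_measurable M"
proof -
  have "isum (\<lambda>k. f k x) = (\<Sum>i. f (int_decode i) x)" for x
    using nn_integral_bij_count_space[OF bij_int_decode, of "\<lambda>k. f k x"]
    by (simp add: nn_integral_count_space_nat)
  then show ?thesis using assms by simp
qed

lemma isum_nn_integral:
  assumes "\<And>k. f k \<in> borel_measurable M"
  shows "(\<integral>\<^sup>+x. isum (\<lambda>k. f k x) \<partial>M) = isum (\<lambda>k. \<integral>\<^sup>+x. f k x \<partial>M)"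
  using assms by (intro nn_integral_count_space_nn_integral) auto

text \<open>The top exponent is \<open>\<lfloor>log 2 e\<rfloor>\<close>; below it the terms form a
  geometric series.\<close>

lemma isum_geometric:
  assumes "0 < e" "0 < \<gamma>"
  shows "isum (\<lambda>j. ennreal (2 powr (real_of_int j * \<gamma>)) * indicator {j. 2 powr real_of_int j \<le> e} j)
    \<le> ennreal (e powr \<gamma> / (1 - 2 powr (- \<gamma>)))"
proof -
  define J where "J = \<lfloor>log 2 e\<rfloor>"
  have J: "{j. 2 powr real_of_int j \<le> e} = {..J}"
    using assms by (auto simp: J_def le_floor_iff le_log_iff)
  have q: "norm (2 powr (- \<gamma>)) < 1" using assms by (simp add: powr_less_one)
  have "bij_betw (\<lambda>i. J - int i) UNIV {..J}"
    by (rule bij_betwI[where g="\<lambda>j. nat (J - j)"]) auto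
  from nn_integral_bij_count_space[OF this, of "\<lambda>j. ennreal (2 powr (real_of_int j * \<gamma>))"]
  have "isum (\<lambda>j. ennreal (2 powr (real_of_int j * \<gamma>)) * indicator {..J} j) =
     (\<Sum>i. ennreal (2 powr (real_of_int (J - int i) * \<gamma>)))"
    by (subst nn_integral_count_space_indicator[symmetric]) (auto simp flip: nn_integral_count_space_nat)
  also have "\<dots> = (\<Sum>i. ennreal (2 powr (real_of_int J * \<gamma>) * (2 powr (- \<gamma>)) ^ i))"
  proof -
    have "2 powr (real_of_int (J - int i) * \<gamma>) = 2 powr (real_of_int J * \<gamma>) * (2 powr (- \<gamma>)) ^ i" for i
      by (simp add: powr_power powr_add[symmetric] algebra_simps)
    then show ?thesis by simp
  qed
  also have "\<dots> = ennreal (2 powr (real_of_int J * \<gamma>) * (1 / (1 - 2 powr (- \<gamma>))))"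
    using suminf_geometric[OF q] summable_geometric[OF q]
    by (subst suminf_ennreal2) (auto simp: suminf_mult)
  also have "\<dots> \<le> ennreal (e powr \<gamma> / (1 - 2 powr (- \<gamma>)))"
  proof (rule ennreal_leI)
    have "2 powr real_of_int J \<le> e" using J by auto
    then have "(2 powr real_of_int J) powr \<gamma> \<le> e powr \<gamma>" using assms by (intro powr_mono2) auto
    then show "2 powr (real_of_int J * \<gamma>) * (1 / (1 - 2 powr (- \<gamma>))) \<le> e powr \<gamma> / (1 - 2 powr (- \<gamma>))"
      using q by (simp add: powr_powr divide_right_mono)
  qed
  finally show ?thesis unfolding J .
qed

lemma isum_geometric_upper:
  assumes "0 < e" "0 < \<gamma>"
  shows "isum (\<lambda>j. ennreal (2 powr (- (real_of_int j * \<gamma>))) * indicator {j. e \<le> 2 powr real_of_int j} j)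
    \<le> ennreal (e powr (- \<gamma>) / (1 - 2 powr (- \<gamma>)))"
proof -
  have b: "bij_betw (uminus :: int \<Rightarrow> int) UNIV UNIV" by (rule bij_betwI[where g=uminus]) auto
  have "isum (\<lambda>j. ennreal (2 powr (- (real_of_int j * \<gamma>))) * indicator {j. e \<le> 2 powr real_of_int j} j)
    = isum (\<lambda>j. ennreal (2 powr (real_of_int j * \<gamma>)) * indicator {j. 2 powr real_of_int j \<le> 1 / e} j)"
    by (subst nn_integral_bij_count_space[OF b, symmetric])
       (use assms in \<open>auto intro!: nn_integral_cong simp: indicator_def powr_minus field_simps\<close>)
  also have "\<dots> \<le> ennreal ((1 / e) powr \<gamma> / (1 - 2 powr (- \<gamma>)))"
    using assms by (intro isum_geometric) auto
  finally show ?thesis using assms by (simp add: powr_divide powr_minus field_simps)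
qed

lemma isum_mult: "isum (\<lambda>k. c * f k) = c * isum f"
  by (rule nn_integral_cmult) simp

text \<open>Each \<open>epowr (a k) r\<close> is \<open>a k\<close> times
  \<open>epowr (a k) (r - 1)\<close>, and the second factor is at most that power of the whole
  sum.\<close>

lemma isum_powr_superadditive:
  assumes "1 \<le> r" shows "isum (\<lambda>k. epowr (a k) r) \<le> epowr (isum a) r"
proof (cases "r = 1")
  case False
  then have r: "0 < r - 1" using assms by simp
  have split: "epowr u r = u * epowr u (r - 1)" for u
    using epowr_add[of 1 "r - 1" u] r by simp
  have "isum (\<lambda>k. epowr (a k) r) \<le> isum (\<lambda>k. epowr (isum a) (r - 1) * a k)"
    unfolding split using r
    by (intro nn_integral_mono) (auto simp: mult.commute intro!: mult_left_mono epowr_mono nn_integral_ge_point)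
  also have "\<dots> = epowr (isum a) r" unfolding isum_mult split[of "isum a"] by (rule mult.commute)
  finally show ?thesis .
qed simp

text \<open>Minkowski's inequality as an instance of \<open>power_mean\<close>: the quotients of
  \<open>g k\<close> by \<open>c k\<close> have p-th power integral at most 1 and are averaged with
  weights \<open>c k\<close>. The condition for \<open>c k = 0\<close> keeps the division
  harmless.\<close>

lemma isum_minkowski:
  assumes g: "\<And>k. g k \<in> borel_measurable M" and p: "1 \<le> p"
    and c: "\<And>k. 0 \<le> c k" "\<And>k x. c k = 0 \<Longrightarrow> g k x = 0"
    and b: "\<And>k. (\<integral>\<^sup>+x. epowr (g k x) p \<partial>M) \<le> ennreal (c k powr p)"
    and S: "isum (\<lambda>k. ennreal (c k)) \<le> ennreal S" "0 \<le> S"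
  shows "(\<integral>\<^sup>+x. epowr (isum (\<lambda>k. g k x)) p \<partial>M) \<le> ennreal (S powr p)"
proof -
  define y where "y k x = ennreal (1 / c k) * g k x" for k x
  have [measurable]: "y k \<in> borel_measurable M" for k using g[of k] by (simp add: y_def[abs_def])
  have y: "g k x = ennreal (c k) * y k x" for k x
    using c(1)[of k] c(2)[of k x] by (cases "c k = 0") (auto simp: y_def mult.assoc[symmetric] ennreal_mult[symmetric])
  have yb: "ennreal (c k) * (\<integral>\<^sup>+x. epowr (y k x) p \<partial>M) \<le> ennreal (c k)" for k
  proof (cases "c k = 0")
    case False
    then have ck: "0 < c k" using c(1)[of k] by simp
    have "(\<integral>\<^sup>+x. epowr (y k x) p \<partial>M) = ennreal ((1 / c k) powr p) * (\<integral>\<^sup>+x. epowr (g k x) p \<partial>M)"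
      unfolding y_def using p ck g[of k]
      by (subst epowr_mult) (auto simp: epowr_ennreal nn_integral_cmult)
    also have "\<dots> \<le> ennreal ((1 / c k) powr p) * ennreal (c k powr p)" by (intro mult_left_mono b) auto
    also have "\<dots> = 1" using ck by (simp add: ennreal_mult[symmetric] powr_mult[symmetric])
    finally have "ennreal (c k) * (\<integral>\<^sup>+x. epowr (y k x) p \<partial>M) \<le> ennreal (c k) * 1" by (rule mult_left_mono) simp
    then show ?thesis by simp
  qed simp
  have "(\<integral>\<^sup>+x. epowr (isum (\<lambda>k. g k x)) p \<partial>M) \<le> (\<integral>\<^sup>+x. ennreal (S powr (p - 1)) * isum (\<lambda>k. ennreal (c k) * epowr (y k x) p) \<partial>M)"
    unfolding y by (intro nn_integral_mono power_mean S p) auto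
  also have "\<dots> = ennreal (S powr (p - 1)) * isum (\<lambda>k. ennreal (c k) * (\<integral>\<^sup>+x. epowr (y k x) p \<partial>M))"
    by (subst nn_integral_cmult, measurable, subst isum_nn_integral) (auto simp: nn_integral_cmult)
  also have "\<dots> \<le> ennreal (S powr (p - 1)) * ennreal S"
    by (intro mult_left_mono order_trans[OF nn_integral_mono S(1)] yb) auto
  also have "\<dots> = ennreal (S powr p)" using S(2) p by (cases "S = 0") (auto simp: ennreal_mult[symmetric] powr_diff)
  finally show ?thesis .
qed

subsection \<open>Integrals of powers\<close>

lemma nn_integral_powr_near:
  fixes a e :: real
  assumes "a < 1" "0 < e"
  shows "(\<integral>\<^sup>+z. ennreal (indicator {z. \<bar>z\<bar> \<le> e} z * \<bar>z\<bar> powr (- a)) \<partial>lborel) \<le> ennreal (2 * (e powr (1 - a) / (1 - a)))"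
proof -
  let ?f = "\<lambda>z::real. ennreal (indicator {0..e} z * z powr (- a))"
  have "((\<lambda>z. indicator {0..e} z * z powr (- a)) has_integral (e powr (1 - a) / (1 - a))) UNIV"
  proof -
    have eq: "(\<lambda>z. indicator {0..e} z * z powr (- a)) = (\<lambda>z. if z \<in> {0..e} then z powr (- a) else 0)"
      by auto
    show ?thesis
      unfolding eq has_integral_restrict_UNIV using has_integral_powr_from_0[of "- a" e] assms by simp
  qed
  then have i: "(\<integral>\<^sup>+z. ?f z \<partial>lborel) = ennreal (e powr (1 - a) / (1 - a))"
    by (intro nn_integral_has_integral_lborel) auto
  have "(\<integral>\<^sup>+z. ?f z \<partial>lborel) = ennreal \<bar>- 1\<bar> * (\<integral>\<^sup>+z. ?f (0 + (- 1) * z) \<partial>lborel)"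
    by (rule nn_integral_real_affine) auto
  then have i': "(\<integral>\<^sup>+z. ?f (- z) \<partial>lborel) = ennreal (e powr (1 - a) / (1 - a))" using i by simp
  have "(\<integral>\<^sup>+z. ennreal (indicator {z. \<bar>z\<bar> \<le> e} z * \<bar>z\<bar> powr (- a)) \<partial>lborel) \<le> (\<integral>\<^sup>+z. ?f z + ?f (- z) \<partial>lborel)"
    by (intro nn_integral_mono) (auto simp: indicator_def)
  also have "\<dots> = ennreal (e powr (1 - a) / (1 - a)) + ennreal (e powr (1 - a) / (1 - a))"
    by (subst nn_integral_add) (auto simp: i i')
  also have "\<dots> = ennreal (2 * (e powr (1 - a) / (1 - a)))"
    using assms by (simp add: ennreal_plus[symmetric] del: ennreal_plus)
  finally show ?thesis .
qed

lemma nn_integral_powr_far: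
  fixes a e :: real
  assumes "1 < a" "0 < e"
  shows "(\<integral>\<^sup>+z. ennreal (indicator {z. e \<le> \<bar>z\<bar>} z * \<bar>z\<bar> powr (- a)) \<partial>lborel) \<le> ennreal (2 * (e powr (1 - a) / (a - 1)))"
proof -
  let ?f = "\<lambda>z::real. ennreal (indicator {e..} z * z powr (- a))"
  have "((\<lambda>z. indicator {e..} z * z powr (- a)) has_integral (e powr (1 - a) / (a - 1))) UNIV"
  proof -
    have "- (e powr (- a + 1)) / (- a + 1) = e powr (1 - a) / (a - 1)" using assms by (simp add: field_simps)
    moreover have eq: "(\<lambda>z. indicator {e..} z * z powr (- a)) = (\<lambda>z. if z \<in> {e..} then z powr (- a) else 0)"
      by auto
    ultimately show ?thesis
      unfolding eq has_integral_restrict_UNIV using has_integral_powr_to_inf[of "- a" e] assms by simp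
  qed
  then have i: "(\<integral>\<^sup>+z. ?f z \<partial>lborel) = ennreal (e powr (1 - a) / (a - 1))"
    by (intro nn_integral_has_integral_lborel) auto
  have "(\<integral>\<^sup>+z. ?f z \<partial>lborel) = ennreal \<bar>- 1\<bar> * (\<integral>\<^sup>+z. ?f (0 + (- 1) * z) \<partial>lborel)"
    by (rule nn_integral_real_affine) auto
  then have i': "(\<integral>\<^sup>+z. ?f (- z) \<partial>lborel) = ennreal (e powr (1 - a) / (a - 1))" using i by simp
  have "(\<integral>\<^sup>+z. ennreal (indicator {z. e \<le> \<bar>z\<bar>} z * \<bar>z\<bar> powr (- a)) \<partial>lborel) \<le> (\<integral>\<^sup>+z. ?f z + ?f (- z) \<partial>lborel)"
    by (intro nn_integral_mono) (use assms in \<open>auto simp: indicator_def\<close>)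
  also have "\<dots> = ennreal (e powr (1 - a) / (a - 1)) + ennreal (e powr (1 - a) / (a - 1))"
    by (subst nn_integral_add) (auto simp: i i')
  also have "\<dots> = ennreal (2 * (e powr (1 - a) / (a - 1)))"
    using assms by (simp add: ennreal_plus[symmetric] del: ennreal_plus)
  finally show ?thesis .
qed

subsection \<open>Dyadic level sets\<close>

lemma dyadic_sum_le:
  assumes "0 < q"
  shows "isum (\<lambda>k. ennreal (2 powr (real_of_int k * q)) * indicator {k. ennreal (2 powr real_of_int k) < y} k)
    \<le> ennreal (1 / (1 - 2 powr (- q))) * epowr y q"
proof (cases y)
  case (real r)
  show ?thesis
  proof (cases "r = 0")
    case True
    then show ?thesis using real by simp
  next
    case False
    then have r: "0 < r" using real by simp
    have "isum (\<lambda>k. ennreal (2 powr (real_of_int k * q)) * indicator {k. ennreal (2 powr real_of_int k) < y} k)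
      \<le> isum (\<lambda>k. ennreal (2 powr (real_of_int k * q)) * indicator {k. 2 powr real_of_int k \<le> r} k)"
      using real by (intro nn_integral_mono) (auto simp: indicator_def ennreal_less_iff)
    also have "\<dots> \<le> ennreal (r powr q / (1 - 2 powr (- q)))" by (rule isum_geometric[OF r assms])
    also have "\<dots> = ennreal (1 / (1 - 2 powr (- q))) * epowr y q"
      using real assms by (simp add: epowr_ennreal ennreal_mult[symmetric] powr_less_one less_imp_le)
    finally show ?thesis .
  qed
next
  case top
  have "2 powr (- q) < 1" using assms by (simp add: powr_less_one)
  then show ?thesis using top assms by (simp add: ennreal_mult_top)
qed

text \<open>One term is enough for finite \<open>y\<close>: the largest level below
  \<open>y\<close>, whose successor is at least \<open>y\<close>. For infinite \<open>y\<close> all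
  levels count and the sum is infinite.\<close>

lemma dyadic_sum_ge:
  assumes "0 < q"
  shows "epowr y q \<le> isum (\<lambda>k. ennreal (2 powr ((real_of_int k + 1) * q)) * indicator {k. ennreal (2 powr real_of_int k) < y} k)"
    (is "_ \<le> isum ?f")
proof (cases y)
  case (real r)
  show ?thesis
  proof (cases "r = 0")
    case True
    then show ?thesis using real by simp
  next
    case False
    then have "0 < r" using real by simp
    then obtain k :: int where k: "2 powr real_of_int k < r" "r \<le> 2 powr (real_of_int k + 1)" by (rule dyadic_level)
    have "r powr q \<le> (2 powr (real_of_int k + 1)) powr q" using k assms real by (intro powr_mono2) auto
    then have "epowr y q \<le> ?f k"
      using real k by (simp add: epowr_ennreal powr_powr ennreal_less_iff ennreal_leI)
    also have "?f k \<le> isum ?f" by (rule nn_integral_ge_point) auto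
    finally show ?thesis .
  qed
next
  case top
  have "ennreal (2 powr ((real_of_int k + 1) * q)) \<le> isum ?f" for k :: int
    using nn_integral_ge_point[of k UNIV ?f] top by simp
  then have *: "ennreal x \<le> isum ?f" if "0 < x" for x
  proof -
    have "0 < x powr (1 / q)" using that by simp
    then obtain k :: int where "x powr (1 / q) \<le> 2 powr (real_of_int k + 1)" by (rule dyadic_level)
    then have "(x powr (1 / q)) powr q \<le> (2 powr (real_of_int k + 1)) powr q" using assms by (intro powr_mono2) auto
    then have "x \<le> 2 powr ((real_of_int k + 1) * q)" using that assms by (simp add: powr_powr)
    then show ?thesis using \<open>\<And>k. ennreal (2 powr ((real_of_int k + 1) * q)) \<le> isum ?f\<close>[of k]
      by (meson ennreal_leI order_trans)
  qed
  have "isum ?f = top"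
  proof (rule ccontr)
    assume "isum ?f \<noteq> top"
    then obtain r where r: "isum ?f = ennreal r" "0 \<le> r" by (cases "isum ?f") auto
    from *[of "r + 1"] r show False by (simp add: ennreal_le_iff)
  qed
  then show ?thesis by simp
qed

text \<open>The ball about \<open>u\<close> leaves \<open>E\<close> exactly if \<open>u\<close> is
  closer than \<open>h\<close> to some point outside \<open>E\<close>, an open condition for any set
  \<open>E\<close>.\<close>

lemma closed_inner_points: "closed {u::real. ball u h \<subseteq> E}"
proof -
  have "- {u. ball u h \<subseteq> E} = (\<Union>z\<in>-E. ball z h)"
    by (auto simp: dist_commute subset_eq)
  then show ?thesis by (simp add: closed_def open_UN)
qed

lemma inner_points_measurable [measurable]: "{u::real. ball u h \<subseteq> E} \<in> sets borel"
  by (rule borel_closed) (rule closed_inner_points)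

text \<open>The size of the piece of the operator at scale \<open>2 powr j\<close>: the numerator is
  the Lipschitz bound, the denominator the decay of a difference quotient as in
  \<open>quot_decay\<close>.\<close>

definition kern :: "real \<Rightarrow> int \<Rightarrow> real \<Rightarrow> real" where
  "kern \<alpha> j z = (2 powr real_of_int j) powr \<alpha> / (2 powr real_of_int j + \<bar>z\<bar>)"

lemma measurable_kern [measurable]: "(\<lambda>z. kern \<alpha> j z) \<in> borel_measurable borel"
  unfolding kern_def by measurable

lemma kern_nonneg [simp]: "0 \<le> kern \<alpha> j z"
  by (simp add: kern_def)

text \<open>A weighted geometric mean of \<open>h\<close> and \<open>\<bar>z\<bar>\<close> is at
  most \<open>h + \<bar>z\<bar>\<close>. The parameter \<theta> trades powers of the scale for decay
  in \<open>z\<close>.\<close>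

lemma kern_le:
  assumes "0 < \<theta>" "\<theta> \<le> 1" "z \<noteq> 0"
  shows "kern \<alpha> j z \<le> 2 powr (real_of_int j * (\<alpha> - 1 + \<theta>)) * \<bar>z\<bar> powr (- \<theta>)"
proof -
  define h where "h = 2 powr real_of_int j"
  have h: "0 < h" by (simp add: h_def)
  have "h powr (1 - \<theta>) * \<bar>z\<bar> powr \<theta> \<le> (h + \<bar>z\<bar>) powr (1 - \<theta>) * (h + \<bar>z\<bar>) powr \<theta>"
    using assms h by (intro mult_mono powr_mono2) auto
  also have "\<dots> = h + \<bar>z\<bar>" using h by (simp add: powr_add[symmetric])
  finally have "h powr \<alpha> / (h + \<bar>z\<bar>) \<le> h powr \<alpha> / (h powr (1 - \<theta>) * \<bar>z\<bar> powr \<theta>)"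
    using assms h by (intro divide_left_mono) auto
  also have "\<dots> = h powr (\<alpha> - 1 + \<theta>) * \<bar>z\<bar> powr (- \<theta>)"
    using h by (simp add: powr_diff powr_add powr_minus field_simps)
  finally show ?thesis by (simp add: h_def kern_def powr_powr)
qed

text \<open>The contribution of one level set to the pointwise bound, all scales together.\<close>

definition level_potential :: "real \<Rightarrow> real set \<Rightarrow> real \<Rightarrow> ennreal" where
  "level_potential \<alpha> E x = isum (\<lambda>j. \<integral>\<^sup>+u. ennreal (kern \<alpha> j (x - u)) *
      indicator {u. ball u (2 powr real_of_int j) \<subseteq> E} u \<partial>lborel)"

lemma measurable_level_potential [measurable]: "level_potential \<alpha> E \<in> borel_measurable borel"
  unfolding level_potential_def[abs_def] by measurable

text \<open>A ball inside \<open>E\<close> has measure at most \<open>e\<close>, so only scales up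
  to \<open>e\<close> occur. By \<open>kern_le\<close> their sum is a geometric series, convergent
  because \<open>1 - \<alpha> < \<theta>\<close>; an exponent below 1 keeps it locally integrable
  for \<open>\<bar>z\<bar> \<le> e\<close>, and the exponent 1 gives the decay beyond.\<close>

lemma level_potential_le:
  assumes \<alpha>: "0 < \<alpha>" and \<theta>: "0 < \<theta>" "\<theta> < 1" "1 - \<alpha> < \<theta>"
    and E[measurable]: "E \<in> sets borel" and e: "0 < e" "emeasure lborel E \<le> ennreal e"
  defines "K \<equiv> 1 / (1 - 2 powr (- (\<alpha> - 1 + \<theta>))) + 1 / (1 - 2 powr (- \<alpha>))"
  shows "level_potential \<alpha> E x \<le> (\<integral>\<^sup>+u. indicator E u *
     ennreal (K * (e powr (\<alpha> - 1 + \<theta>) * (indicator {z. \<bar>z\<bar> \<le> e} (x - u) * \<bar>x - u\<bar> powr (- \<theta>)) +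
       e powr \<alpha> * (indicator {z. e \<le> \<bar>z\<bar>} (x - u) * \<bar>x - u\<bar> powr (- 1)))) \<partial>lborel)" (is "_ \<le> (\<integral>\<^sup>+u. _ * ennreal (?L u) \<partial>lborel)")
proof -
  have q: "2 powr (- (\<alpha> - 1 + \<theta>)) < 1" "2 powr (- \<alpha>) < 1"
    using \<alpha> \<theta> by (auto intro!: powr_less_one)
  have small: "2 powr real_of_int j \<le> e" if "ball u (2 powr real_of_int j) \<subseteq> E" for j u
  proof -
    have "ennreal (2 * 2 powr real_of_int j) = emeasure lborel (ball u (2 powr real_of_int j))"
      by (simp add: ball_eq_greaterThanLessThan)
    also have "\<dots> \<le> ennreal e" using emeasure_mono[OF that, of lborel] e by simp
    finally have "2 * 2 powr real_of_int j \<le> e" using e by (simp add: ennreal_le_iff)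
    moreover have "(0::real) < 2 powr real_of_int j" by simp
    ultimately show ?thesis by linarith
  qed
  have "level_potential \<alpha> E x \<le> isum (\<lambda>j. \<integral>\<^sup>+u. ennreal (kern \<alpha> j (x - u)) * (indicator {j. 2 powr real_of_int j \<le> e} j * indicator E u) \<partial>lborel)"
    unfolding level_potential_def
  proof (intro nn_integral_mono mult_left_mono)
    fix j u
    show "(indicator {u. ball u (2 powr real_of_int j) \<subseteq> E} u :: ennreal) \<le> indicator {j. 2 powr real_of_int j \<le> e} j * indicator E u"
    proof -
      have "u \<in> E" if "ball u (2 powr real_of_int j) \<subseteq> E" using that by (rule subsetD) simp
      then show ?thesis using small[of u j] by (auto simp: indicator_def)
    qed
  qed simp
  also have "\<dots> = (\<integral>\<^sup>+u. isum (\<lambda>j. ennreal (kern \<alpha> j (x - u)) * (indicator {j. 2 powr real_of_int j \<le> e} j * indicator E u)) \<partial>lborel)"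
    by (subst isum_nn_integral) measurable
  also have "\<dots> \<le> (\<integral>\<^sup>+u. indicator E u * ennreal (?L u) \<partial>lborel)"
  proof (rule nn_integral_mono_AE)
    have "AE u in lborel. u \<noteq> x" by (rule AE_lborel_singleton)
    then show "AE u in lborel. isum (\<lambda>j. ennreal (kern \<alpha> j (x - u)) * (indicator {j. 2 powr real_of_int j \<le> e} j * indicator E u))
        \<le> indicator E u * ennreal (?L u)"
    proof eventually_elim
      case (elim u)
      define z where "z = x - u"
      have z: "z \<noteq> 0" using elim by (simp add: z_def)
      have b: "isum (\<lambda>j. ennreal (kern \<alpha> j z) * indicator {j. 2 powr real_of_int j \<le> e} j) \<le>
         ennreal (e powr (\<alpha> - 1 + \<theta>') / (1 - 2 powr (- (\<alpha> - 1 + \<theta>'))) * \<bar>z\<bar> powr (- \<theta>'))"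
        if t: "0 < \<theta>'" "\<theta>' \<le> 1" "1 - \<alpha> < \<theta>'" for \<theta>'
      proof -
        have "isum (\<lambda>j. ennreal (kern \<alpha> j z) * indicator {j. 2 powr real_of_int j \<le> e} j)
          \<le> isum (\<lambda>j. ennreal (\<bar>z\<bar> powr (- \<theta>')) * (ennreal (2 powr (real_of_int j * (\<alpha> - 1 + \<theta>'))) * indicator {j. 2 powr real_of_int j \<le> e} j))"
        proof (intro nn_integral_mono)
          fix j
          have "ennreal (kern \<alpha> j z) \<le> ennreal (\<bar>z\<bar> powr (- \<theta>')) * ennreal (2 powr (real_of_int j * (\<alpha> - 1 + \<theta>')))"
            using kern_le[OF t(1,2) z, of \<alpha> j] by (simp add: ennreal_mult[symmetric] ennreal_leI mult.commute)
          then show "ennreal (kern \<alpha> j z) * indicator {j. 2 powr real_of_int j \<le> e} j \<le> ennreal (\<bar>z\<bar> powr (- \<theta>')) * (ennreal (2 powr (real_of_int j * (\<alpha> - 1 + \<theta>'))) * indicator {j. 2 powr real_of_int j \<le> e} j)"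
            unfolding mult.assoc[symmetric] by (rule mult_right_mono) simp
        qed
        also have "\<dots> \<le> ennreal (\<bar>z\<bar> powr (- \<theta>')) * ennreal (e powr (\<alpha> - 1 + \<theta>') / (1 - 2 powr (- (\<alpha> - 1 + \<theta>'))))"
          unfolding isum_mult using e t by (intro mult_left_mono isum_geometric) auto
        also have "\<dots> = ennreal (e powr (\<alpha> - 1 + \<theta>') / (1 - 2 powr (- (\<alpha> - 1 + \<theta>'))) * \<bar>z\<bar> powr (- \<theta>'))"
          by (subst ennreal_mult'[symmetric]) (auto simp: mult.commute)
        finally show ?thesis .
      qed
      have "isum (\<lambda>j. ennreal (kern \<alpha> j z) * indicator {j. 2 powr real_of_int j \<le> e} j) \<le> ennreal (?L u)"
      proof (cases "\<bar>z\<bar> \<le> e")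
        case True
        have "isum (\<lambda>j. ennreal (kern \<alpha> j z) * indicator {j. 2 powr real_of_int j \<le> e} j) \<le>
          ennreal (e powr (\<alpha> - 1 + \<theta>) / (1 - 2 powr (- (\<alpha> - 1 + \<theta>))) * \<bar>z\<bar> powr (- \<theta>))"
          using \<theta> by (intro b) auto
        also have "\<dots> \<le> ennreal (K * (e powr (\<alpha> - 1 + \<theta>) * \<bar>z\<bar> powr (- \<theta>)))"
        proof (rule ennreal_leI)
          have "1 / (1 - 2 powr (- (\<alpha> - 1 + \<theta>))) * (e powr (\<alpha> - 1 + \<theta>) * \<bar>z\<bar> powr (- \<theta>)) \<le> K * (e powr (\<alpha> - 1 + \<theta>) * \<bar>z\<bar> powr (- \<theta>))"
            using q by (intro mult_right_mono) (auto simp: K_def)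
          then show "e powr (\<alpha> - 1 + \<theta>) / (1 - 2 powr (- (\<alpha> - 1 + \<theta>))) * \<bar>z\<bar> powr (- \<theta>) \<le> K * (e powr (\<alpha> - 1 + \<theta>) * \<bar>z\<bar> powr (- \<theta>))"
            by simp
        qed
        also have "\<dots> \<le> ennreal (?L u)"
          using True q by (intro ennreal_leI mult_left_mono) (auto simp: z_def K_def indicator_def)
        finally show ?thesis .
      next
        case False
        have "isum (\<lambda>j. ennreal (kern \<alpha> j z) * indicator {j. 2 powr real_of_int j \<le> e} j) \<le>
          ennreal (e powr \<alpha> / (1 - 2 powr (- \<alpha>)) * \<bar>z\<bar> powr (- 1))"
          using b[of 1] \<alpha> by simp
        also have "\<dots> \<le> ennreal (K * (e powr \<alpha> * \<bar>z\<bar> powr (- 1)))"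
        proof (rule ennreal_leI)
          have "1 / (1 - 2 powr (- \<alpha>)) * (e powr \<alpha> * \<bar>z\<bar> powr (- 1)) \<le> K * (e powr \<alpha> * \<bar>z\<bar> powr (- 1))"
            using q by (intro mult_right_mono) (auto simp: K_def)
          then show "e powr \<alpha> / (1 - 2 powr (- \<alpha>)) * \<bar>z\<bar> powr (- 1) \<le> K * (e powr \<alpha> * \<bar>z\<bar> powr (- 1))"
            by simp
        qed
        also have "\<dots> \<le> ennreal (?L u)"
          using False q by (intro ennreal_leI mult_left_mono) (auto simp: z_def K_def indicator_def)
        finally show ?thesis .
      qed
      then have "isum (\<lambda>j. ennreal (kern \<alpha> j z) * indicator {j. 2 powr real_of_int j \<le> e} j) * indicator E u \<le> ennreal (?L u) * indicator E u"
        by (rule mult_right_mono) simp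
      moreover have "isum (\<lambda>j. ennreal (kern \<alpha> j (x - u)) * (indicator {j. 2 powr real_of_int j \<le> e} j * indicator E u))
        = isum (\<lambda>j. ennreal (kern \<alpha> j z) * indicator {j. 2 powr real_of_int j \<le> e} j) * indicator E u"
        unfolding z_def mult.assoc[symmetric] by (rule nn_integral_multc) simp
      ultimately show ?case by (simp add: mult.commute)
    qed
  qed
  finally show ?thesis .
qed

lemma nn_integral_reflect:
  assumes "f \<in> borel_measurable borel"
  shows "(\<integral>\<^sup>+u. f (x - u) \<partial>lborel) = (\<integral>\<^sup>+z. f z \<partial>lborel)" "(\<integral>\<^sup>+x. f (x - u) \<partial>lborel) = (\<integral>\<^sup>+z. f z \<partial>(lborel :: real measure))"
  using nn_integral_real_affine[OF assms, of "-1" x] nn_integral_real_affine[OF assms, of 1 "-u"] by simp_all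

text \<open>The potential is dominated by the indicator of \<open>E\<close> convolved with an
  explicit kernel. Its supremum is bounded directly, its integral to a power \<open>s\<close> above
  1 by Jensen's inequality, and the power \<open>p\<close> is split into \<open>p - s\<close> and
  \<open>s\<close>. Homogeneity in \<open>e\<close> yields the exponent.\<close>

lemma level_potential_Lp:
  assumes \<alpha>: "0 < \<alpha>" and p: "1 < p"
  obtains C where "0 < C" "\<And>E e. E \<in> sets borel \<Longrightarrow> 0 < e \<Longrightarrow> emeasure lborel E \<le> ennreal e \<Longrightarrow>
    (\<integral>\<^sup>+x. epowr (level_potential \<alpha> E x) p \<partial>lborel) \<le> ennreal (C * e powr (\<alpha> * p + 1))"
proof -
  \<comment> \<open>Strictly between \<open>1 - \<alpha>\<close> and 1, and positive also when
    \<alpha> is large.\<close>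
  define \<theta> where "\<theta> = max (1 / 2) (1 - \<alpha> / 2)"
  have \<theta>: "0 < \<theta>" "\<theta> < 1" "1 - \<alpha> < \<theta>" using \<alpha> by (auto simp: \<theta>_def max_def)
  \<comment> \<open>\<open>1 < s\<close> makes the tail \<open>\<bar>z\<bar> powr (- s)\<close>
    integrable, \<open>s * \<theta> < 1\<close> the singularity. The midpoint between 1 and
    \<open>1 / \<theta>\<close> is taken, capped at \<open>p\<close>.\<close>
  define s where "s = min p ((1 + 1 / \<theta>) / 2)"
  have "s \<le> (1 + 1 / \<theta>) / 2" unfolding s_def by (rule min.cobounded2)
  then have "s * \<theta> \<le> (1 + 1 / \<theta>) / 2 * \<theta>" by (rule mult_right_mono) (use \<theta> in simp)
  also have "\<dots> < 1" using \<theta> by (simp add: field_simps)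
  finally have s\<theta>: "s * \<theta> < 1" .
  have s: "1 < s" "s \<le> p" using p \<theta> by (auto simp: s_def field_simps)
  define K where "K = 1 / (1 - 2 powr (- (\<alpha> - 1 + \<theta>))) + 1 / (1 - 2 powr (- \<alpha>))"
  have q: "2 powr (- (\<alpha> - 1 + \<theta>)) < 1" "2 powr (- \<alpha>) < 1"
    using \<alpha> \<theta> by (auto intro!: powr_less_one)
  have K: "0 < K" unfolding K_def using q by (intro add_pos_pos) auto
  define K1 where "K1 = K * (2 / (1 - \<theta>) + 1)"
  have K1: "0 < K1" using K \<theta> by (simp add: K1_def add_pos_pos)
  define K2 where "K2 = K powr s * (2 / (1 - s * \<theta>) + 2 / (s - 1))"
  have K2: "0 < K2" using K s s\<theta> by (simp add: K2_def add_pos_pos)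
  show thesis
  proof (rule that[of "K1 powr (p - s) * K2"])
    show "0 < K1 powr (p - s) * K2" using K1 K2 by simp
    fix E :: "real set" and e :: real
    assume E[measurable]: "E \<in> sets borel" and e: "0 < e" "emeasure lborel E \<le> ennreal e"
    define N where "N z = indicator {z. \<bar>z\<bar> \<le> e} z * \<bar>z\<bar> powr (- \<theta>)" for z :: real
    define F where "F z = indicator {z. e \<le> \<bar>z\<bar>} z * \<bar>z\<bar> powr (- 1)" for z :: real
    define L where "L z = K * (e powr (\<alpha> - 1 + \<theta>) * N z + e powr \<alpha> * F z)" for z
    have NF: "0 \<le> N z" "0 \<le> F z" for z by (auto simp: N_def F_def)
    have L0: "0 \<le> L z" for z using K NF[of z] by (simp add: L_def)
    have [measurable]: "N \<in> borel_measurable borel" "F \<in> borel_measurable borel"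
      by (auto simp: N_def[abs_def] F_def[abs_def])
    then have [measurable]: "L \<in> borel_measurable borel" by (simp add: L_def[abs_def])
    have V: "level_potential \<alpha> E x \<le> (\<integral>\<^sup>+u. indicator E u * ennreal (L (x - u)) \<partial>lborel)" for x
      using level_potential_le[OF \<alpha> \<theta> E e, of x] unfolding K_def[symmetric] by (simp add: L_def N_def F_def)
    have sup: "level_potential \<alpha> E x \<le> ennreal (K1 * e powr \<alpha>)" for x
    proof -
      have Le: "L z \<le> K * e powr (\<alpha> - 1 + \<theta>) * N z + K * e powr (\<alpha> - 1)" for z
      proof -
        have "e powr \<alpha> * F z \<le> e powr (\<alpha> - 1)"
          using e by (auto simp: F_def indicator_def powr_diff powr_minus field_simps)
        then have "K * (e powr \<alpha> * F z) \<le> K * e powr (\<alpha> - 1)" using K by (intro mult_left_mono) auto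
        then show ?thesis by (simp add: L_def distrib_left)
      qed
      have "(\<integral>\<^sup>+u. indicator E u * ennreal (L (x - u)) \<partial>lborel) \<le> (\<integral>\<^sup>+u. ennreal (K * e powr (\<alpha> - 1 + \<theta>)) * ennreal (N (x - u)) + ennreal (K * e powr (\<alpha> - 1)) * indicator E u \<partial>lborel)"
      proof (rule nn_integral_mono)
        fix u
        show "indicator E u * ennreal (L (x - u)) \<le> ennreal (K * e powr (\<alpha> - 1 + \<theta>)) * ennreal (N (x - u)) + ennreal (K * e powr (\<alpha> - 1)) * indicator E u"
          using Le[of "x - u"] K NF[of "x - u"]
          by (auto simp: indicator_def ennreal_mult[symmetric] ennreal_plus[symmetric] intro!: ennreal_leI simp del: ennreal_plus)
      qed
      also have "\<dots> = ennreal (K * e powr (\<alpha> - 1 + \<theta>)) * (\<integral>\<^sup>+u. ennreal (N (x - u)) \<partial>lborel) + ennreal (K * e powr (\<alpha> - 1)) * emeasure lborel E"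
        by (subst nn_integral_add) (auto simp: nn_integral_cmult)
      also have "(\<integral>\<^sup>+u. ennreal (N (x - u)) \<partial>lborel) = (\<integral>\<^sup>+z. ennreal (N z) \<partial>lborel)"
        by (rule nn_integral_reflect(1)) measurable
      also have "ennreal (K * e powr (\<alpha> - 1 + \<theta>)) * (\<integral>\<^sup>+z. ennreal (N z) \<partial>lborel) + ennreal (K * e powr (\<alpha> - 1)) * emeasure lborel E
         \<le> ennreal (K * e powr (\<alpha> - 1 + \<theta>)) * ennreal (2 * (e powr (1 - \<theta>) / (1 - \<theta>))) + ennreal (K * e powr (\<alpha> - 1)) * ennreal e"
        unfolding N_def by (intro add_mono mult_left_mono nn_integral_powr_near \<theta> e) auto
      also have "\<dots> = ennreal (K * e powr (\<alpha> - 1 + \<theta>) * (2 * (e powr (1 - \<theta>) / (1 - \<theta>))) + K * e powr (\<alpha> - 1) * e)"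
        using K \<theta> e by (simp add: ennreal_mult[symmetric] ennreal_plus[symmetric] del: ennreal_plus)
      also have "K * e powr (\<alpha> - 1 + \<theta>) * (2 * (e powr (1 - \<theta>) / (1 - \<theta>))) + K * e powr (\<alpha> - 1) * e = K1 * e powr \<alpha>"
      proof -
        have "e powr (\<alpha> - 1 + \<theta>) * e powr (1 - \<theta>) = e powr \<alpha>" by (simp add: powr_add[symmetric])
        moreover have "e powr (\<alpha> - 1) * e = e powr \<alpha>" using e by (simp add: powr_diff)
        ultimately show ?thesis by (simp add: K1_def algebra_simps add_divide_distrib)
      qed
      finally show ?thesis using V[of x] order_trans by blast
    qed
    have Ls: "(\<integral>\<^sup>+z. epowr (ennreal (L z)) s \<partial>lborel) \<le> ennreal (K2 * e powr (s * (\<alpha> - 1) + 1))"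
    proof -
      \<comment> \<open>At \<open>\<bar>z\<bar> = e\<close> both indicators are one; off this null
        set \<open>L\<close> is a single power.\<close>
      have AE_ne: "AE z in lborel. \<bar>z\<bar> \<noteq> e"
        using AE_lborel_singleton[of e] AE_lborel_singleton[of "- e"] by eventually_elim auto
      have "(\<integral>\<^sup>+z. epowr (ennreal (L z)) s \<partial>lborel) \<le> (\<integral>\<^sup>+z. ennreal (K powr s * e powr (s * (\<alpha> - 1 + \<theta>))) * ennreal (indicator {z. \<bar>z\<bar> \<le> e} z * \<bar>z\<bar> powr (- (s * \<theta>))) +
         ennreal (K powr s * e powr (s * \<alpha>)) * ennreal (indicator {z. e \<le> \<bar>z\<bar>} z * \<bar>z\<bar> powr (- s)) \<partial>lborel)"
      proof (rule nn_integral_mono_AE, use AE_ne in eventually_elim)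
        fix z assume z: "\<bar>z\<bar> \<noteq> e"
        have 1: "L z powr s = K powr s * e powr (s * (\<alpha> - 1 + \<theta>)) * \<bar>z\<bar> powr (- (s * \<theta>))" if "\<bar>z\<bar> \<le> e"
        proof -
          have "L z = K * (e powr (\<alpha> - 1 + \<theta>) * \<bar>z\<bar> powr (- \<theta>))" using that z by (simp add: L_def N_def F_def indicator_def)
          then show ?thesis using K by (simp add: powr_mult powr_powr mult.commute)
        qed
        have 2: "L z powr s = K powr s * e powr (s * \<alpha>) * \<bar>z\<bar> powr (- s)" if "e \<le> \<bar>z\<bar>"
        proof -
          define w where "w = \<bar>z\<bar> powr (- 1)"
          have "L z = K * (e powr \<alpha> * w)" using that z by (simp add: L_def N_def F_def indicator_def w_def)
          moreover have "w powr s = \<bar>z\<bar> powr (- s)" unfolding w_def by (subst powr_powr) simp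
          moreover have "0 \<le> w" unfolding w_def by (rule powr_ge_zero)
          ultimately show ?thesis using K by (simp add: powr_mult powr_powr mult.commute)
        qed
        show "epowr (ennreal (L z)) s \<le> ennreal (K powr s * e powr (s * (\<alpha> - 1 + \<theta>))) * ennreal (indicator {z. \<bar>z\<bar> \<le> e} z * \<bar>z\<bar> powr (- (s * \<theta>))) +
         ennreal (K powr s * e powr (s * \<alpha>)) * ennreal (indicator {z. e \<le> \<bar>z\<bar>} z * \<bar>z\<bar> powr (- s))"
          using 1 2 z by (cases "\<bar>z\<bar> \<le> e") (auto simp: epowr_ennreal L0 ennreal_mult[symmetric] indicator_def)
      qed
      also have "\<dots> = ennreal (K powr s * e powr (s * (\<alpha> - 1 + \<theta>))) * (\<integral>\<^sup>+z. ennreal (indicator {z. \<bar>z\<bar> \<le> e} z * \<bar>z\<bar> powr (- (s * \<theta>))) \<partial>lborel) +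
         ennreal (K powr s * e powr (s * \<alpha>)) * (\<integral>\<^sup>+z. ennreal (indicator {z. e \<le> \<bar>z\<bar>} z * \<bar>z\<bar> powr (- s)) \<partial>lborel)"
        by (subst nn_integral_add) (auto simp: nn_integral_cmult)
      also have "\<dots> \<le> ennreal (K powr s * e powr (s * (\<alpha> - 1 + \<theta>))) * ennreal (2 * (e powr (1 - s * \<theta>) / (1 - s * \<theta>))) +
         ennreal (K powr s * e powr (s * \<alpha>)) * ennreal (2 * (e powr (1 - s) / (s - 1)))"
        by (intro add_mono mult_left_mono nn_integral_powr_near nn_integral_powr_far s\<theta> s e) auto
      also have "\<dots> = ennreal (K powr s * e powr (s * (\<alpha> - 1 + \<theta>)) * (2 * (e powr (1 - s * \<theta>) / (1 - s * \<theta>))) +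
         K powr s * e powr (s * \<alpha>) * (2 * (e powr (1 - s) / (s - 1))))"
        using K s\<theta> s e by (simp add: ennreal_mult[symmetric] ennreal_plus[symmetric] del: ennreal_plus)
      also have "K powr s * e powr (s * (\<alpha> - 1 + \<theta>)) * (2 * (e powr (1 - s * \<theta>) / (1 - s * \<theta>))) +
         K powr s * e powr (s * \<alpha>) * (2 * (e powr (1 - s) / (s - 1))) = K2 * e powr (s * (\<alpha> - 1) + 1)"
      proof -
        have "s * (\<alpha> - 1 + \<theta>) + (1 - s * \<theta>) = s * (\<alpha> - 1) + 1" "s * \<alpha> + (1 - s) = s * (\<alpha> - 1) + 1"
          by (simp_all add: algebra_simps)
        then have "e powr (s * (\<alpha> - 1 + \<theta>)) * e powr (1 - s * \<theta>) = e powr (s * (\<alpha> - 1) + 1)"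
           "e powr (s * \<alpha>) * e powr (1 - s) = e powr (s * (\<alpha> - 1) + 1)"
          by (simp_all only: powr_add[symmetric])
        then have "K powr s * (2 / (1 - s * \<theta>)) * (e powr (s * (\<alpha> - 1 + \<theta>)) * e powr (1 - s * \<theta>)) +
           K powr s * (2 / (s - 1)) * (e powr (s * \<alpha>) * e powr (1 - s)) = K2 * e powr (s * (\<alpha> - 1) + 1)"
          by (simp only: K2_def distrib_left distrib_right)
        then show ?thesis by (simp add: mult_ac)
      qed
      finally show ?thesis .
    qed
    have "(\<integral>\<^sup>+x. epowr (level_potential \<alpha> E x) s \<partial>lborel) \<le> (\<integral>\<^sup>+x. ennreal (e powr (s - 1)) * (\<integral>\<^sup>+u. indicator E u * epowr (ennreal (L (x - u))) s \<partial>lborel) \<partial>lborel)"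
    proof (rule nn_integral_mono)
      fix x
      have "epowr (level_potential \<alpha> E x) s \<le> epowr (\<integral>\<^sup>+u. indicator E u * ennreal (L (x - u)) \<partial>lborel) s"
        using s V by (intro epowr_mono) auto
      also have "\<dots> \<le> ennreal (e powr (s - 1)) * (\<integral>\<^sup>+u. indicator E u * epowr (ennreal (L (x - u))) s \<partial>lborel)"
        by (rule power_mean) (use e s in auto)
      finally show "epowr (level_potential \<alpha> E x) s \<le> \<dots>" .
    qed
    also have "\<dots> = ennreal (e powr (s - 1)) * (\<integral>\<^sup>+u. \<integral>\<^sup>+x. indicator E u * epowr (ennreal (L (x - u))) s \<partial>lborel \<partial>lborel)"
      by (subst nn_integral_cmult, measurable, subst lborel_pair.Fubini', measurable)
    also have "(\<integral>\<^sup>+u. \<integral>\<^sup>+x. indicator E u * epowr (ennreal (L (x - u))) s \<partial>lborel \<partial>lborel) =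
       (\<integral>\<^sup>+u. (\<integral>\<^sup>+z. epowr (ennreal (L z)) s \<partial>lborel) * indicator E u \<partial>lborel)"
    proof (rule nn_integral_cong)
      fix u
      have "(\<integral>\<^sup>+x. indicator E u * epowr (ennreal (L (x - u))) s \<partial>lborel) = indicator E u * (\<integral>\<^sup>+x. epowr (ennreal (L (x - u))) s \<partial>lborel)"
        by (rule nn_integral_cmult) measurable
      also have "(\<integral>\<^sup>+x. epowr (ennreal (L (x - u))) s \<partial>lborel) = (\<integral>\<^sup>+z. epowr (ennreal (L z)) s \<partial>lborel)"
        by (rule nn_integral_reflect(2)) measurable
      finally show "(\<integral>\<^sup>+x. indicator E u * epowr (ennreal (L (x - u))) s \<partial>lborel) = (\<integral>\<^sup>+z. epowr (ennreal (L z)) s \<partial>lborel) * indicator E u"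
        by (simp add: mult.commute)
    qed
    also have "\<dots> = (\<integral>\<^sup>+z. epowr (ennreal (L z)) s \<partial>lborel) * emeasure lborel E"
      by (rule nn_integral_cmult_indicator) simp
    also have "ennreal (e powr (s - 1)) * \<dots> \<le> ennreal (e powr (s - 1)) * (ennreal (K2 * e powr (s * (\<alpha> - 1) + 1)) * ennreal e)"
      by (intro mult_left_mono mult_mono Ls e) auto
    also have "\<dots> = ennreal (K2 * e powr (s * \<alpha> + 1))"
    proof -
      have "e powr (s - 1) * (e powr (s * (\<alpha> - 1) + 1) * e powr 1) = e powr ((s - 1) + ((s * (\<alpha> - 1) + 1) + 1))"
        by (simp only: powr_add)
      also have "(s - 1) + ((s * (\<alpha> - 1) + 1) + 1) = s * \<alpha> + 1" by (simp add: algebra_simps)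
      finally show ?thesis using e K2 by (simp add: ennreal_mult[symmetric] mult_ac)
    qed
    finally have Vs: "(\<integral>\<^sup>+x. epowr (level_potential \<alpha> E x) s \<partial>lborel) \<le> ennreal (K2 * e powr (s * \<alpha> + 1))" .
    have "(\<integral>\<^sup>+x. epowr (level_potential \<alpha> E x) p \<partial>lborel) \<le> (\<integral>\<^sup>+x. ennreal ((K1 * e powr \<alpha>) powr (p - s)) * epowr (level_potential \<alpha> E x) s \<partial>lborel)"
    proof (rule nn_integral_mono)
      fix x
      show "epowr (level_potential \<alpha> E x) p \<le> ennreal ((K1 * e powr \<alpha>) powr (p - s)) * epowr (level_potential \<alpha> E x) s"
      proof (cases "p = s")
        case True
        then show ?thesis using K1 e by simp
      next
        case False
        then have "epowr (level_potential \<alpha> E x) p = epowr (level_potential \<alpha> E x) (p - s) * epowr (level_potential \<alpha> E x) s"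
          using s by (subst epowr_add[symmetric]) auto
        also have "\<dots> \<le> epowr (ennreal (K1 * e powr \<alpha>)) (p - s) * epowr (level_potential \<alpha> E x) s"
          using s by (intro mult_right_mono epowr_mono sup) auto
        finally show ?thesis using K1 by (simp add: epowr_ennreal)
      qed
    qed
    also have "\<dots> = ennreal ((K1 * e powr \<alpha>) powr (p - s)) * (\<integral>\<^sup>+x. epowr (level_potential \<alpha> E x) s \<partial>lborel)"
      by (rule nn_integral_cmult) measurable
    also have "\<dots> \<le> ennreal ((K1 * e powr \<alpha>) powr (p - s)) * ennreal (K2 * e powr (s * \<alpha> + 1))"
      by (intro mult_left_mono Vs) auto
    also have "\<dots> = ennreal (K1 powr (p - s) * K2 * e powr (\<alpha> * p + 1))"
    proof -
      have "\<alpha> * (p - s) + (s * \<alpha> + 1) = \<alpha> * p + 1" by (simp add: algebra_simps)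
      then have "e powr (\<alpha> * (p - s)) * e powr (s * \<alpha> + 1) = e powr (\<alpha> * p + 1)" by (simp only: powr_add[symmetric])
      then have "K1 powr (p - s) * K2 * (e powr (\<alpha> * (p - s)) * e powr (s * \<alpha> + 1)) = K1 powr (p - s) * K2 * e powr (\<alpha> * p + 1)"
        by simp
      then show ?thesis using K1 K2 by (simp add: ennreal_mult[symmetric] powr_mult powr_powr mult_ac)
    qed
    finally show "(\<integral>\<^sup>+x. epowr (level_potential \<alpha> E x) p \<partial>lborel) \<le> ennreal (K1 powr (p - s) * K2 * e powr (\<alpha> * p + 1))" .
  qed
qed

text \<open>Minkowski's inequality over the levels \<open>k\<close>, where level \<open>k\<close>
  contributes 2^k |E_k|^(1/q). As 1/q \<ge> 1, \<open>isum_powr_superadditive\<close> pulls this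
  power out of the sum, and what remains is the dyadic form of the integral of the q-th power of
  \<open>F\<close>.\<close>

lemma level_sum_Lp:
  assumes \<alpha>: "0 < \<alpha>" and p: "1 < p" and q: "0 < q" "q \<le> 1" and rel: "1 / q = \<alpha> + 1 / p"
  obtains C where "0 < C" "\<And>F. (\<And>t. open {z. t < F z}) \<Longrightarrow> (\<integral>\<^sup>+x. epowr (F x) q \<partial>lborel) < top \<Longrightarrow>
    (\<integral>\<^sup>+x. epowr (isum (\<lambda>j. \<integral>\<^sup>+u. ennreal (kern \<alpha> j (x - u)) * level_sum F (2 powr real_of_int j) u \<partial>lborel)) p \<partial>lborel)
      \<le> ennreal C * epowr (\<integral>\<^sup>+x. epowr (F x) q \<partial>lborel) (p / q)"
proof -
  obtain C where C: "0 < C" "\<And>E e. E \<in> sets borel \<Longrightarrow> 0 < e \<Longrightarrow> emeasure lborel E \<le> ennreal e \<Longrightarrow>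
    (\<integral>\<^sup>+x. epowr (level_potential \<alpha> E x) p \<partial>lborel) \<le> ennreal (C * e powr (\<alpha> * p + 1))"
    using level_potential_Lp[OF \<alpha> p] by metis
  have qp: "2 powr (- q) < 1" using q by (simp add: powr_less_one)
  define K where "K = 1 / (1 - 2 powr (- q))"
  have K: "0 < K" using qp by (simp add: K_def)
  \<comment> \<open>The relation between the exponents enters here: it turns the homogeneity of the
    potential into the power \<open>1 / q\<close> of the measure of the level set.\<close>
  have ap: "(\<alpha> * p + 1) / p = 1 / q" using p rel by (simp add: field_simps)
  define C' where "C' = (2 * C powr (1 / p) * K powr (1 / q)) powr p"
  show thesis
  proof (rule that[of C'])
    show "0 < C'" using C(1) K by (simp add: C'_def)
    fix F :: "real \<Rightarrow> ennreal"
    assume op: "\<And>t. open {z. t < F z}" and fin: "(\<integral>\<^sup>+x. epowr (F x) q \<partial>lborel) < top"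
    define X where "X = enn2real (\<integral>\<^sup>+x. epowr (F x) q \<partial>lborel)"
    have X: "(\<integral>\<^sup>+x. epowr (F x) q \<partial>lborel) = ennreal X" "0 \<le> X"
      using fin by (auto simp: X_def less_top)
    have [measurable]: "F \<in> borel_measurable borel"
      by (rule borel_measurableI_greater) (use op in \<open>auto intro: borel_open\<close>)
    define E where "E k = {z. ennreal (2 powr real_of_int k) < F z}" for k :: int
    have Eo: "open (E k)" for k using op by (simp add: E_def)
    then have [measurable]: "E k \<in> sets borel" for k by (rule borel_open)
    have sumE: "isum (\<lambda>k. ennreal (2 powr (real_of_int k * q)) * emeasure lborel (E k)) \<le> ennreal (K * X)"
    proof -
      have "isum (\<lambda>k. ennreal (2 powr (real_of_int k * q)) * emeasure lborel (E k)) =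
        isum (\<lambda>k. \<integral>\<^sup>+x. ennreal (2 powr (real_of_int k * q)) * indicator (E k) x \<partial>lborel)"
        by (intro nn_integral_cong) (subst nn_integral_cmult_indicator, auto)
      also have "\<dots> = (\<integral>\<^sup>+x. isum (\<lambda>k. ennreal (2 powr (real_of_int k * q)) * indicator (E k) x) \<partial>lborel)"
        by (rule isum_nn_integral[symmetric]) measurable
      also have "\<dots> \<le> (\<integral>\<^sup>+x. ennreal K * epowr (F x) q \<partial>lborel)"
      proof (rule nn_integral_mono)
        fix x
        have "isum (\<lambda>k. ennreal (2 powr (real_of_int k * q)) * indicator (E k) x) =
          isum (\<lambda>k. ennreal (2 powr (real_of_int k * q)) * indicator {k. ennreal (2 powr real_of_int k) < F x} k)"
          by (intro nn_integral_cong) (auto simp: E_def indicator_def)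
        then show "isum (\<lambda>k. ennreal (2 powr (real_of_int k * q)) * indicator (E k) x) \<le> ennreal K * epowr (F x) q"
          using dyadic_sum_le[OF q(1), of "F x"] by (simp add: K_def)
      qed
      also have "\<dots> = ennreal (K * X)"
        using X K by (subst nn_integral_cmult) (auto simp: ennreal_mult)
      finally show ?thesis .
    qed
    have Efin: "emeasure lborel (E k) \<noteq> top" for k
    proof
      assume "emeasure lborel (E k) = top"
      then have "top \<le> isum (\<lambda>k. ennreal (2 powr (real_of_int k * q)) * emeasure lborel (E k))"
        using nn_integral_ge_point[of k UNIV "\<lambda>k. ennreal (2 powr (real_of_int k * q)) * emeasure lborel (E k)"]
        by (simp add: ennreal_mult_top)
      then show False using sumE by (simp add: top_unique)
    qed
    define e where "e k = measure lborel (E k)" for k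
    have e: "emeasure lborel (E k) = ennreal (e k)" "0 \<le> e k" for k
      using Efin[of k] by (auto simp: e_def emeasure_eq_ennreal_measure)
    \<comment> \<open>A nonempty open set has positive measure. This covers the levels of weight
      zero in \<open>isum_minkowski\<close>.\<close>
    have empty: "E k = {}" if "e k = 0" for k
    proof (rule ccontr)
      assume "E k \<noteq> {}"
      then obtain z where "z \<in> E k" by blast
      then obtain d where d: "0 < d" "ball z d \<subseteq> E k" using Eo open_contains_ball by blast
      have "ennreal (2 * d) = emeasure lborel (ball z d)" using d by (simp add: ball_eq_greaterThanLessThan)
      also have "\<dots> \<le> emeasure lborel (E k)" by (rule emeasure_mono) (use d in auto)
      finally show False using e[of k] that d by simp
    qed
    define g where "g k x = ennreal (2 powr (real_of_int k + 1)) * level_potential \<alpha> (E k) x" for k x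
    define c where "c k = 2 powr (real_of_int k + 1) * (C powr (1 / p) * e k powr (1 / q))" for k
    define S where "S = 2 * C powr (1 / p) * (K * X) powr (1 / q)"
    have eq: "isum (\<lambda>j. \<integral>\<^sup>+u. ennreal (kern \<alpha> j (x - u)) * level_sum F (2 powr real_of_int j) u \<partial>lborel) = isum (\<lambda>k. g k x)" for x
    proof -
      have "(\<integral>\<^sup>+u. ennreal (kern \<alpha> j (x - u)) * level_sum F (2 powr real_of_int j) u \<partial>lborel) =
         isum (\<lambda>k. ennreal (2 powr (real_of_int k + 1)) * (\<integral>\<^sup>+u. ennreal (kern \<alpha> j (x - u)) * indicator {u. ball u (2 powr real_of_int j) \<subseteq> E k} u \<partial>lborel))" for j
      proof -
        have "(\<integral>\<^sup>+u. ennreal (kern \<alpha> j (x - u)) * level_sum F (2 powr real_of_int j) u \<partial>lborel) =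
          (\<integral>\<^sup>+u. isum (\<lambda>k. ennreal (2 powr (real_of_int k + 1)) * (ennreal (kern \<alpha> j (x - u)) * indicator {u. ball u (2 powr real_of_int j) \<subseteq> E k} u)) \<partial>lborel)"
          unfolding level_sum_def E_def[symmetric] isum_mult[symmetric]
          by (intro nn_integral_cong) (simp add: mult_ac)
        also have "\<dots> = isum (\<lambda>k. \<integral>\<^sup>+u. ennreal (2 powr (real_of_int k + 1)) * (ennreal (kern \<alpha> j (x - u)) * indicator {u. ball u (2 powr real_of_int j) \<subseteq> E k} u) \<partial>lborel)"
          by (rule isum_nn_integral) measurable
        finally show ?thesis by (simp add: nn_integral_cmult)
      qed
      then have "isum (\<lambda>j. \<integral>\<^sup>+u. ennreal (kern \<alpha> j (x - u)) * level_sum F (2 powr real_of_int j) u \<partial>lborel) =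
        isum (\<lambda>j. isum (\<lambda>k. ennreal (2 powr (real_of_int k + 1)) * (\<integral>\<^sup>+u. ennreal (kern \<alpha> j (x - u)) * indicator {u. ball u (2 powr real_of_int j) \<subseteq> E k} u \<partial>lborel)))"
        by simp
      also have "\<dots> = isum (\<lambda>k. isum (\<lambda>j. ennreal (2 powr (real_of_int k + 1)) * (\<integral>\<^sup>+u. ennreal (kern \<alpha> j (x - u)) * indicator {u. ball u (2 powr real_of_int j) \<subseteq> E k} u \<partial>lborel)))"
        by (rule isum_nn_integral) simp
      finally show ?thesis by (simp add: g_def level_potential_def isum_mult)
    qed
    have "(\<integral>\<^sup>+x. epowr (isum (\<lambda>k. g k x)) p \<partial>lborel) \<le> ennreal (S powr p)"
    proof (rule isum_minkowski)
      show "g k \<in> borel_measurable lborel" for k by (simp add: g_def[abs_def])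
      show "1 \<le> p" using p by simp
      show "0 \<le> c k" for k by (simp add: c_def)
      show "g k x = 0" if "c k = 0" for k x
      proof -
        have "e k = 0" using that C(1) by (simp add: c_def)
        then have "E k = {}" by (rule empty)
        then show ?thesis by (simp add: g_def level_potential_def)
      qed
      show "(\<integral>\<^sup>+x. epowr (g k x) p \<partial>lborel) \<le> ennreal (c k powr p)" for k
      proof (cases "e k = 0")
        case True
        then have "g k x = 0" for x using empty[OF True] by (simp add: g_def level_potential_def)
        then show ?thesis by simp
      next
        case False
        then have ek: "0 < e k" using e(2)[of k] by simp
        have "(\<integral>\<^sup>+x. epowr (g k x) p \<partial>lborel) = ennreal ((2 powr (real_of_int k + 1)) powr p) * (\<integral>\<^sup>+x. epowr (level_potential \<alpha> (E k) x) p \<partial>lborel)"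
          unfolding g_def using p by (subst epowr_mult) (auto simp: epowr_ennreal nn_integral_cmult)
        also have "\<dots> \<le> ennreal ((2 powr (real_of_int k + 1)) powr p) * ennreal (C * e k powr (\<alpha> * p + 1))"
          by (intro mult_left_mono C(2)) (use ek e in auto)
        also have "\<dots> = ennreal (c k powr p)"
        proof -
          have "(e k powr (1 / q)) powr p = e k powr (\<alpha> * p + 1)"
            using p unfolding ap[symmetric] by (simp add: powr_powr)
          then show ?thesis using p C(1) by (simp add: c_def powr_mult powr_powr ennreal_mult[symmetric])
        qed
        finally show ?thesis .
      qed
      show "0 \<le> S" using C(1) by (simp add: S_def)
      show "isum (\<lambda>k. ennreal (c k)) \<le> ennreal S"
      proof -
        have "ennreal (c k) = ennreal (2 * C powr (1 / p)) * epowr (ennreal (2 powr (real_of_int k * q)) * emeasure lborel (E k)) (1 / q)" for k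
        proof -
          have "c k = (2 * C powr (1 / p)) * (2 powr (real_of_int k * q) * e k) powr (1 / q)"
            using q e(2)[of k] by (simp add: c_def powr_mult powr_powr powr_add)
          then show ?thesis using e[of k] by (simp add: ennreal_mult[symmetric] epowr_ennreal)
        qed
        then have "isum (\<lambda>k. ennreal (c k)) = ennreal (2 * C powr (1 / p)) * isum (\<lambda>k. epowr (ennreal (2 powr (real_of_int k * q)) * emeasure lborel (E k)) (1 / q))"
          by (simp add: isum_mult)
        also have "\<dots> \<le> ennreal (2 * C powr (1 / p)) * epowr (isum (\<lambda>k. ennreal (2 powr (real_of_int k * q)) * emeasure lborel (E k))) (1 / q)"
          using q by (intro mult_left_mono isum_powr_superadditive) auto
        also have "\<dots> \<le> ennreal (2 * C powr (1 / p)) * epowr (ennreal (K * X)) (1 / q)"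
          using q by (intro mult_left_mono epowr_mono sumE) auto
        also have "\<dots> = ennreal S" using K X by (simp add: S_def epowr_ennreal ennreal_mult[symmetric])
        finally show ?thesis .
      qed
    qed
    also have "S powr p = C' * X powr (p / q)"
      using K X C(1) by (simp add: S_def C'_def powr_mult powr_powr mult.assoc)
    also have "ennreal (C' * X powr (p / q)) = ennreal C' * epowr (\<integral>\<^sup>+x. epowr (F x) q \<partial>lborel) (p / q)"
      using X by (simp add: epowr_ennreal ennreal_mult' C'_def)
    finally show "(\<integral>\<^sup>+x. epowr (isum (\<lambda>j. \<integral>\<^sup>+u. ennreal (kern \<alpha> j (x - u)) * level_sum F (2 powr real_of_int j) u \<partial>lborel)) p \<partial>lborel)
      \<le> ennreal C' * epowr (\<integral>\<^sup>+x. epowr (F x) q \<partial>lborel) (p / q)" unfolding eq .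
  qed
qed

subsection \<open>The Hardy--Littlewood maximal function\<close>

definition hl_max :: "(real \<Rightarrow> ennreal) \<Rightarrow> real \<Rightarrow> ennreal" where
  "hl_max g x = (SUP r\<in>{0<..}. ennreal (1 / (2 * r)) * (\<integral>\<^sup>+y. g y * indicator (ball x r) y \<partial>lborel))"

lemma hl_max_ge:
  "0 < r \<Longrightarrow> (\<integral>\<^sup>+y. g y * indicator (ball x r) y \<partial>lborel) \<le> ennreal (2 * r) * hl_max g x"
proof -
  assume r: "0 < r"
  have "ennreal (1 / (2 * r)) * (\<integral>\<^sup>+y. g y * indicator (ball x r) y \<partial>lborel) \<le> hl_max g x"
    unfolding hl_max_def using r by (intro SUP_upper) auto
  then have "ennreal (2 * r) * (ennreal (1 / (2 * r)) * (\<integral>\<^sup>+y. g y * indicator (ball x r) y \<partial>lborel)) \<le> ennreal (2 * r) * hl_max g x"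
    by (rule mult_left_mono) simp
  then show ?thesis using r by (simp add: mult.assoc[symmetric] ennreal_mult[symmetric])
qed

lemma hl_max_gtD:
  assumes "ennreal t < hl_max g x" "0 \<le> t"
  obtains r where "0 < r" "ennreal (2 * r * t) < (\<integral>\<^sup>+y. g y * indicator (ball x r) y \<partial>lborel)"
proof -
  obtain r where r: "0 < r" "ennreal t < ennreal (1 / (2 * r)) * (\<integral>\<^sup>+y. g y * indicator (ball x r) y \<partial>lborel)"
    using assms(1) unfolding hl_max_def less_SUP_iff by auto
  then have "ennreal (2 * r) * ennreal t < ennreal (2 * r) * (ennreal (1 / (2 * r)) * (\<integral>\<^sup>+y. g y * indicator (ball x r) y \<partial>lborel))"
    by (intro ennreal_mult_strict_left_mono) auto
  then have "ennreal (2 * r * t) < (\<integral>\<^sup>+y. g y * indicator (ball x r) y \<partial>lborel)"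
    using r(1) assms(2) by (simp add: mult.assoc[symmetric] ennreal_mult[symmetric])
  then show thesis using that r(1) by blast
qed

text \<open>Vitali's covering lemma, whose dilation factor 5 gives the constant. The superlevel set
  is enclosed in an open set, whose measure can be used in place of that of the superlevel set
  itself.\<close>

lemma hl_weak_type:
  assumes g[measurable]: "g \<in> borel_measurable borel" and t: "0 < t"
    and fin: "(\<integral>\<^sup>+y. g y \<partial>lborel) < top"
  shows "\<exists>U. open U \<and> {x. ennreal t < hl_max g x} \<subseteq> U \<and> emeasure lborel U \<le> ennreal (5 / t) * (\<integral>\<^sup>+y. g y \<partial>lborel)"
proof -
  define I where "I = enn2real (\<integral>\<^sup>+y. g y \<partial>lborel)"
  have I: "(\<integral>\<^sup>+y. g y \<partial>lborel) = ennreal I" "0 \<le> I" using fin by (auto simp: I_def less_top)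
  define S where "S = {x. ennreal t < hl_max g x}"
  have "\<exists>r. 0 < r \<and> ennreal (2 * r * t) < (\<integral>\<^sup>+y. g y * indicator (ball x r) y \<partial>lborel)" if "x \<in> S" for x
    using hl_max_gtD[of t g x] that t unfolding S_def by auto
  then obtain r where r: "\<And>x. x \<in> S \<Longrightarrow> 0 < r x" "\<And>x. x \<in> S \<Longrightarrow> ennreal (2 * r x * t) < (\<integral>\<^sup>+y. g y * indicator (ball x (r x)) y \<partial>lborel)"
    by metis
  \<comment> \<open>The covering lemma asks for bounded radii; the finite integral of
    \<open>g\<close> bounds them.\<close>
  have bound: "0 < r x \<and> r x \<le> I / (2 * t)" if "x \<in> S" for x
  proof
    have "ennreal (2 * r x * t) \<le> (\<integral>\<^sup>+y. g y \<partial>lborel)"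
      by (rule order_trans[OF less_imp_le[OF r(2)[OF that]]], rule nn_integral_mono) (auto simp: indicator_def)
    then have "2 * r x * t \<le> I" using I by (simp add: ennreal_le_iff)
    then show "r x \<le> I / (2 * t)" using t by (simp add: field_simps)
  qed (rule r(1)[OF that])
  have "S \<subseteq> (\<Union>x\<in>S. ball x (r x))" using r(1) by force
  then obtain C where C: "countable C" "C \<subseteq> S" "pairwise (\<lambda>i j. disjnt (ball i (r i)) (ball j (r j))) C"
     "S \<subseteq> (\<Union>i\<in>C. ball i (5 * r i))"
    by (rule Vitali_covering_lemma_balls[OF _ bound])
  have dis: "disjoint_family_on (\<lambda>i. ball i (r i)) C"
    using C(3) by (auto simp: disjoint_family_on_def pairwise_def disjnt_def)
  have [measurable]: "ball (i::real) d \<in> sets borel" for i d by (rule borel_open[OF open_ball])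
  define U where "U = (\<Union>i\<in>C. ball i (5 * r i))"
  have "emeasure lborel U \<le> (\<integral>\<^sup>+i. emeasure lborel (ball i (5 * r i)) \<partial>count_space C)"
  proof -
    have "U \<in> sets lborel" unfolding U_def by (auto intro!: borel_open open_UN)
    then have "emeasure lborel U = (\<integral>\<^sup>+x. indicator U x \<partial>lborel)" by simp
    also have "\<dots> \<le> (\<integral>\<^sup>+x. \<integral>\<^sup>+i. indicator (ball i (5 * r i)) x \<partial>count_space C \<partial>lborel)"
    proof (rule nn_integral_mono)
      fix x
      show "(indicator U x :: ennreal) \<le> (\<integral>\<^sup>+i. indicator (ball i (5 * r i)) x \<partial>count_space C)"
      proof (cases "x \<in> U")
        case True
        then obtain i where i: "i \<in> C" "x \<in> ball i (5 * r i)" by (auto simp: U_def)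
        then show ?thesis
          using nn_integral_ge_point[OF i(1), of "\<lambda>i. indicator (ball i (5 * r i)) x :: ennreal"] True by simp
      qed simp
    qed
    also have "\<dots> = (\<integral>\<^sup>+i. \<integral>\<^sup>+x. indicator (ball i (5 * r i)) x \<partial>lborel \<partial>count_space C)"
      by (rule nn_integral_count_space_nn_integral) (use C in \<open>auto intro!: borel_measurable_indicator\<close>)
    finally show ?thesis by simp
  qed
  also have "\<dots> \<le> (\<integral>\<^sup>+i. ennreal (5 / t) * (\<integral>\<^sup>+y. g y * indicator (ball i (r i)) y \<partial>lborel) \<partial>count_space C)"
  proof (rule nn_integral_mono)
    fix i assume "i \<in> space (count_space C)"
    then have i: "i \<in> S" using C by auto
    have "emeasure lborel (ball i (5 * r i)) = ennreal (5 / t) * ennreal (2 * r i * t)"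
      using r(1)[OF i] t by (simp add: ball_eq_greaterThanLessThan ennreal_mult[symmetric])
    also have "\<dots> \<le> ennreal (5 / t) * (\<integral>\<^sup>+y. g y * indicator (ball i (r i)) y \<partial>lborel)"
      by (rule mult_left_mono[OF less_imp_le[OF r(2)[OF i]]]) simp
    finally show "emeasure lborel (ball i (5 * r i)) \<le> \<dots>" .
  qed
  also have "\<dots> = ennreal (5 / t) * (\<integral>\<^sup>+i. (\<integral>\<^sup>+y. g y * indicator (ball i (r i)) y \<partial>lborel) \<partial>count_space C)"
    by (rule nn_integral_cmult) simp
  also have "(\<integral>\<^sup>+i. (\<integral>\<^sup>+y. g y * indicator (ball i (r i)) y \<partial>lborel) \<partial>count_space C) = (\<integral>\<^sup>+y. \<integral>\<^sup>+i. g y * indicator (ball i (r i)) y \<partial>count_space C \<partial>lborel)"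
    by (rule nn_integral_count_space_nn_integral[symmetric, OF C(1)]) measurable
  also have "\<dots> \<le> (\<integral>\<^sup>+y. g y \<partial>lborel)"
  proof (rule nn_integral_mono)
    fix y
    have "(\<integral>\<^sup>+i. indicator (ball i (r i)) y \<partial>count_space C) \<le> (1 :: ennreal)"
    proof (cases "\<exists>i\<in>C. y \<in> ball i (r i)")
      case True
      then obtain i where i: "i \<in> C" "y \<in> ball i (r i)" by blast
      have u: "j = i" if "j \<in> C" "y \<in> ball j (r j)" for j
        using disjoint_family_onD[OF dis that(1) i(1)] that i by blast
      have "(\<integral>\<^sup>+j. indicator (ball j (r j)) y \<partial>count_space C) = (\<integral>\<^sup>+j. indicator {i} j \<partial>count_space C)"
      proof (rule nn_integral_cong)
        fix j assume "j \<in> space (count_space C)"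
        then have "y \<in> ball j (r j) \<longleftrightarrow> j \<in> {i}" using u[of j] i(2) by (metis singletonD singletonI space_count_space)
        then show "(indicator (ball j (r j)) y :: ennreal) = indicator {i} j"
          unfolding indicator_def by (simp only:)
      qed
      then show ?thesis using i by simp
    next
      case False
      then have "(\<integral>\<^sup>+i. indicator (ball i (r i)) y \<partial>count_space C) = (\<integral>\<^sup>+i. (0::ennreal) \<partial>count_space C)"
        by (intro nn_integral_cong) (auto simp: indicator_def)
      then show ?thesis by simp
    qed
    then have "g y * (\<integral>\<^sup>+i. indicator (ball i (r i)) y \<partial>count_space C) \<le> g y * 1" by (rule mult_left_mono) simp
    then show "(\<integral>\<^sup>+i. g y * indicator (ball i (r i)) y \<partial>count_space C) \<le> g y" by (simp add: nn_integral_cmult)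
  qed
  finally have "emeasure lborel U \<le> ennreal (5 / t) * (\<integral>\<^sup>+y. g y \<partial>lborel)"
    by (simp add: mult_left_mono)
  then show ?thesis using C(4) unfolding U_def S_def by (intro exI[of _ "\<Union>i\<in>C. ball i (5 * r i)"]) auto
qed

text \<open>Interpolation level by level: the part of \<open>g\<close> below
  \<open>2 powr (k - 1)\<close> has averages at most that number, so only the part above it can push
  the maximal function past \<open>2 powr k\<close>. The weak type bounds of these parts are summed
  over \<open>k\<close>.\<close>

lemma hl_strong_type:
  assumes p: "1 < p"
  obtains C where "0 < C" "\<And>g. g \<in> borel_measurable borel \<Longrightarrow>
    (\<integral>\<^sup>+x. epowr (hl_max g x) p \<partial>lborel) \<le> ennreal C * (\<integral>\<^sup>+x. epowr (g x) p \<partial>lborel)"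
proof -
  have q: "2 powr (- (p - 1)) < 1" using p by (intro powr_less_one) auto
  define C where "C = 5 * 4 powr p * (1 / (1 - 2 powr (- (p - 1))))"
  have C0: "0 < C" using q by (simp add: C_def)
  show thesis
  proof (rule that[OF C0])
    fix g :: "real \<Rightarrow> ennreal" assume g[measurable]: "g \<in> borel_measurable borel"
    show "(\<integral>\<^sup>+x. epowr (hl_max g x) p \<partial>lborel) \<le> ennreal C * (\<integral>\<^sup>+x. epowr (g x) p \<partial>lborel)"
    proof (cases "(\<integral>\<^sup>+x. epowr (g x) p \<partial>lborel) = top")
      case True
      then show ?thesis using C0 by (simp add: ennreal_mult_top)
    next
      case False
      define G where "G k x = g x * indicator {x. ennreal (2 powr (real_of_int k - 1)) < g x} x" for k :: int and x
      have [measurable]: "G k \<in> borel_measurable borel" for k by (simp add: G_def[abs_def])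
      define h where "h k y = ennreal (2 powr (real_of_int k * (p - 1))) * indicator {k. ennreal (2 powr real_of_int k) < g y} k" for k :: int and y
      have [measurable]: "h k \<in> borel_measurable borel" for k
      proof -
        have "h k = (\<lambda>y. ennreal (2 powr (real_of_int k * (p - 1))) * indicator {y. ennreal (2 powr real_of_int k) < g y} y)"
          by (auto simp: h_def indicator_def)
        then show ?thesis by simp
      qed
      have Gle: "g x \<le> G k x + ennreal (2 powr (real_of_int k - 1))" for k x
        by (auto simp: G_def indicator_def)
      \<comment> \<open>The weak type bound needs a finite integral. Where \<open>g\<close> exceeds
        a positive level it is at most a multiple of its p-th power, as
        \<open>1 < p\<close>.\<close>
      have Gfin: "(\<integral>\<^sup>+x. G k x \<partial>lborel) < top" for k
      proof -
        have "G k x \<le> ennreal ((2 powr (real_of_int k - 1)) powr (1 - p)) * epowr (g x) p" for x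
        proof (cases "g x")
          case (real y)
          have "y \<le> (2 powr (real_of_int k - 1)) powr (1 - p) * y powr p" if "2 powr (real_of_int k - 1) < y"
          proof -
            have "0 < y" by (rule less_trans[OF _ that]) simp
            have "y powr (1 - p) \<le> (2 powr (real_of_int k - 1)) powr (1 - p)"
              using that p by (intro powr_mono2') auto
            then have "y powr (1 - p) * y powr p \<le> (2 powr (real_of_int k - 1)) powr (1 - p) * y powr p" by (rule mult_right_mono) simp
            then show ?thesis using \<open>0 < y\<close> by (simp add: powr_add[symmetric])
          qed
          then show ?thesis using real by (auto simp: G_def indicator_def epowr_ennreal ennreal_mult[symmetric] ennreal_less_iff intro!: ennreal_leI)
        next
          case top
          then show ?thesis by (simp add: ennreal_mult_top)
        qed
        then have "(\<integral>\<^sup>+x. G k x \<partial>lborel) \<le> (\<integral>\<^sup>+x. ennreal ((2 powr (real_of_int k - 1)) powr (1 - p)) * epowr (g x) p \<partial>lborel)"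
          by (intro nn_integral_mono) auto
        also have "\<dots> = ennreal ((2 powr (real_of_int k - 1)) powr (1 - p)) * (\<integral>\<^sup>+x. epowr (g x) p \<partial>lborel)"
          by (rule nn_integral_cmult) measurable
        also have "\<dots> < top" using False by (simp add: ennreal_mult_less_top less_top)
        finally show ?thesis .
      qed
      have sub: "hl_max g x \<le> hl_max (G k) x + ennreal (2 powr (real_of_int k - 1))" for k x
        unfolding hl_max_def[of g]
      proof (rule SUP_least)
        fix r :: real assume "r \<in> {0<..}"
        then have r: "0 < r" by simp
        have "(\<integral>\<^sup>+y. g y * indicator (ball x r) y \<partial>lborel) \<le> (\<integral>\<^sup>+y. G k y * indicator (ball x r) y + ennreal (2 powr (real_of_int k - 1)) * indicator (ball x r) y \<partial>lborel)"
          using Gle by (intro nn_integral_mono) (auto simp: indicator_def)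
        also have "\<dots> = (\<integral>\<^sup>+y. G k y * indicator (ball x r) y \<partial>lborel) + ennreal (2 powr (real_of_int k - 1)) * ennreal (2 * r)"
          using r by (subst nn_integral_add) (auto simp: nn_integral_cmult ball_eq_greaterThanLessThan)
        also have "\<dots> \<le> ennreal (2 * r) * hl_max (G k) x + ennreal (2 powr (real_of_int k - 1)) * ennreal (2 * r)"
          by (intro add_right_mono hl_max_ge r)
        finally have "ennreal (1 / (2 * r)) * (\<integral>\<^sup>+y. g y * indicator (ball x r) y \<partial>lborel) \<le> ennreal (1 / (2 * r)) * (ennreal (2 * r) * hl_max (G k) x + ennreal (2 * r) * ennreal (2 powr (real_of_int k - 1)))"
          by (intro mult_left_mono) (auto simp: mult.commute)
        also have "\<dots> = hl_max (G k) x + ennreal (2 powr (real_of_int k - 1))"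
          unfolding distrib_left[symmetric] mult.assoc[symmetric] using r by (simp add: ennreal_mult[symmetric])
        finally show "ennreal (1 / (2 * r)) * (\<integral>\<^sup>+y. g y * indicator (ball x r) y \<partial>lborel) \<le> hl_max (G k) x + ennreal (2 powr (real_of_int k - 1))" .
      qed
      have "\<exists>U. open U \<and> {x. ennreal (2 powr real_of_int k) < hl_max g x} \<subseteq> U \<and> emeasure lborel U \<le> ennreal (10 * 2 powr (- real_of_int k)) * (\<integral>\<^sup>+y. G k y \<partial>lborel)" for k
      proof -
        have t: "0 < 2 powr (real_of_int k - 1)" by simp
        obtain U where U: "open U" "{x. ennreal (2 powr (real_of_int k - 1)) < hl_max (G k) x} \<subseteq> U" "emeasure lborel U \<le> ennreal (5 / 2 powr (real_of_int k - 1)) * (\<integral>\<^sup>+y. G k y \<partial>lborel)"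
          using hl_weak_type[OF _ t Gfin[of k]] by auto
        have "ennreal (2 powr (real_of_int k - 1)) < hl_max (G k) x" if "ennreal (2 powr real_of_int k) < hl_max g x" for x
        proof (rule ccontr)
          assume "\<not> ?thesis"
          then have "hl_max g x \<le> ennreal (2 powr (real_of_int k - 1)) + ennreal (2 powr (real_of_int k - 1))"
            using sub[of x k] by (meson add_right_mono linorder_not_less order_trans)
          also have "\<dots> = ennreal (2 powr real_of_int k)"
            by (simp add: ennreal_plus[symmetric] powr_diff del: ennreal_plus)
          finally show False using that by simp
        qed
        moreover have "5 / 2 powr (real_of_int k - 1) = 10 * 2 powr (- real_of_int k)" by (simp add: powr_diff powr_minus field_simps)
        ultimately show ?thesis using U by (intro exI[of _ U]) auto
      qed
      then obtain U where U: "\<And>k. open (U k)" "\<And>k. {x. ennreal (2 powr real_of_int k) < hl_max g x} \<subseteq> U k"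
         "\<And>k. emeasure lborel (U k) \<le> ennreal (10 * 2 powr (- real_of_int k)) * (\<integral>\<^sup>+y. G k y \<partial>lborel)" by metis
      have [measurable]: "U k \<in> sets borel" for k using U(1) by (rule borel_open)
      have "(\<integral>\<^sup>+x. epowr (hl_max g x) p \<partial>lborel) \<le> (\<integral>\<^sup>+x. isum (\<lambda>k. ennreal (2 powr ((real_of_int k + 1) * p)) * indicator (U k) x) \<partial>lborel)"
      proof (rule nn_integral_mono)
        fix x
        have "epowr (hl_max g x) p \<le> isum (\<lambda>k. ennreal (2 powr ((real_of_int k + 1) * p)) * indicator {k. ennreal (2 powr real_of_int k) < hl_max g x} k)"
          using p by (intro dyadic_sum_ge) auto
        also have "\<dots> \<le> isum (\<lambda>k. ennreal (2 powr ((real_of_int k + 1) * p)) * indicator (U k) x)"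
          using U(2) by (intro nn_integral_mono) (auto simp: indicator_def)
        finally show "epowr (hl_max g x) p \<le> \<dots>" .
      qed
      also have "\<dots> = isum (\<lambda>k. ennreal (2 powr ((real_of_int k + 1) * p)) * emeasure lborel (U k))"
        by (subst isum_nn_integral, measurable) (simp add: nn_integral_cmult_indicator)
      also have "\<dots> \<le> isum (\<lambda>k. ennreal (2 powr ((real_of_int k + 1) * p)) * (ennreal (10 * 2 powr (- real_of_int k)) * (\<integral>\<^sup>+y. G k y \<partial>lborel)))"
        by (intro nn_integral_mono mult_left_mono U) auto
      \<comment> \<open>The powers of two are regrouped around \<open>k - 1\<close>, the level that
        defines \<open>G k\<close>, so that the sum becomes a dyadic sum below \<open>g y\<close>
        with exponent \<open>p - 1\<close>.\<close>
      also have "\<dots> = isum (\<lambda>k. \<integral>\<^sup>+y. ennreal (5 * 4 powr p) * (g y * h (k - 1) y) \<partial>lborel)"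
      proof (rule nn_integral_cong)
        fix k :: int
        have "(real_of_int k + 1) * p + - real_of_int k + 1 = 2 * p + real_of_int (k - 1) * (p - 1)"
          by (simp add: algebra_simps)
        then have "2 powr ((real_of_int k + 1) * p) * 2 powr (- real_of_int k) * 2 powr 1 = 2 powr (2 * p) * 2 powr (real_of_int (k - 1) * (p - 1))"
          by (simp only: powr_add[symmetric])
        moreover have "2 powr (2 * p) = 4 powr p" by (simp add: powr_powr[symmetric])
        ultimately have e: "2 powr ((real_of_int k + 1) * p) * (10 * 2 powr (- real_of_int k)) = 5 * 4 powr p * 2 powr (real_of_int (k - 1) * (p - 1))"
          by (simp add: mult_ac)
        have "ennreal (2 powr ((real_of_int k + 1) * p)) * (ennreal (10 * 2 powr (- real_of_int k)) * (\<integral>\<^sup>+y. G k y \<partial>lborel)) =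
           ennreal (5 * 4 powr p) * (ennreal (2 powr (real_of_int (k - 1) * (p - 1))) * (\<integral>\<^sup>+y. G k y \<partial>lborel))"
          using arg_cong[OF e, of ennreal] by (simp add: ennreal_mult mult.assoc[symmetric])
        also have "\<dots> = (\<integral>\<^sup>+y. ennreal (5 * 4 powr p) * (ennreal (2 powr (real_of_int (k - 1) * (p - 1))) * G k y) \<partial>lborel)"
          by (simp add: nn_integral_cmult)
        also have "\<dots> = (\<integral>\<^sup>+y. ennreal (5 * 4 powr p) * (g y * h (k - 1) y) \<partial>lborel)"
          by (intro nn_integral_cong) (simp add: G_def h_def indicator_def mult_ac)
        finally show "ennreal (2 powr ((real_of_int k + 1) * p)) * (ennreal (10 * 2 powr (- real_of_int k)) * (\<integral>\<^sup>+y. G k y \<partial>lborel)) =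
          (\<integral>\<^sup>+y. ennreal (5 * 4 powr p) * (g y * h (k - 1) y) \<partial>lborel)" .
      qed
      also have "\<dots> = (\<integral>\<^sup>+y. isum (\<lambda>k. ennreal (5 * 4 powr p) * (g y * h (k - 1) y)) \<partial>lborel)"
        by (rule isum_nn_integral[symmetric]) (measurable)
      also have "\<dots> \<le> (\<integral>\<^sup>+y. ennreal C * epowr (g y) p \<partial>lborel)"
      proof (rule nn_integral_mono)
        fix y
        have "bij_betw (\<lambda>k::int. k - 1) UNIV UNIV" by (rule bij_betwI[where g="\<lambda>k. k + 1"]) auto
        from nn_integral_bij_count_space[OF this, of "\<lambda>k. h k y"]
        have "isum (\<lambda>k. h (k - 1) y) \<le> ennreal (1 / (1 - 2 powr (- (p - 1)))) * epowr (g y) (p - 1)"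
          using dyadic_sum_le[of "p - 1" "g y"] p by (simp add: h_def)
        then have "isum (\<lambda>k. ennreal (5 * 4 powr p) * (g y * h (k - 1) y)) \<le>
           ennreal (5 * 4 powr p) * (g y * (ennreal (1 / (1 - 2 powr (- (p - 1)))) * epowr (g y) (p - 1)))"
          unfolding isum_mult by (intro mult_left_mono) auto
        also have "\<dots> = ennreal C * (epowr (g y) 1 * epowr (g y) (p - 1))"
        proof -
          have "ennreal C = ennreal (5 * 4 powr p) * ennreal (1 / (1 - 2 powr (- (p - 1))))"
            unfolding C_def by (rule ennreal_mult) (use q in auto)
          then show ?thesis by (simp only: epowr_one mult_ac)
        qed
        also have "epowr (g y) 1 * epowr (g y) (p - 1) = epowr (g y) p"
          using p by (subst epowr_add[symmetric]) auto
        finally show "isum (\<lambda>k. ennreal (5 * 4 powr p) * (g y * h (k - 1) y)) \<le> ennreal C * epowr (g y) p" .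
      qed
      also have "\<dots> = ennreal C * (\<integral>\<^sup>+x. epowr (g x) p \<partial>lborel)"
        by (rule nn_integral_cmult) measurable
      finally show ?thesis .
    qed
  qed
qed

section \<open>The grand maximal function against the Hardy--Littlewood maximal function\<close>

lemma norm_integral_le_nn_integral:
  fixes f :: "'a \<Rightarrow> 'b::{banach, second_countable_topology}"
  shows "ennreal (norm (integral\<^sup>L M f)) \<le> (\<integral>\<^sup>+x. ennreal (norm (f x)) \<partial>M)"
  by (cases "integrable M f") (simp_all add: integral_norm_bound_ennreal not_integrable_integral_eq)

text \<open>The condition \<open>\<bar>y - x\<bar> < t\<close> is symmetric: a mean value at
  \<open>y\<close> that exceeds the threshold counts for all \<open>x\<close> in a ball about
  \<open>y\<close>. Openness gives measurability and, for level sets, the alternative between empty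
  and of positive measure.\<close>

lemma grand_max_open: "open {x. t < grand_max n f x}"
proof -
  have "{x. t < grand_max n f x} = (\<Union>\<phi>\<in>test_class n. \<Union>s\<in>{0<..}. \<Union>y\<in>{y. t < ennreal (norm (LINT z|lborel. (\<phi> ((y - z) / s) /\<^sub>R s) * f z))}. ball y s)"
        (is "?L = ?R")
  proof (intro set_eqI iffI)
    fix x assume "x \<in> ?L"
    then obtain \<phi> s y where "\<phi> \<in> test_class n" "0 < s" "y \<in> {x - s<..<x + s}" "t < ennreal (norm (LINT z|lborel. (\<phi> ((y - z) / s) /\<^sub>R s) * f z))"
      unfolding grand_max_def less_SUP_iff by auto
    then show "x \<in> ?R" by (intro UN_I[of \<phi>] UN_I[of s] UN_I[of y]) (auto simp: dist_real_def abs_less_iff)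
  next
    fix x assume "x \<in> ?R"
    then obtain \<phi> s y where *: "\<phi> \<in> test_class n" "0 < s" "x \<in> ball y s" "t < ennreal (norm (LINT z|lborel. (\<phi> ((y - z) / s) /\<^sub>R s) * f z))"
      by auto
    then have "y \<in> {x - s<..<x + s}" by (auto simp: dist_real_def abs_less_iff)
    then show "x \<in> ?L" unfolding grand_max_def less_SUP_iff mem_Collect_eq using * by blast
  qed
  then show ?thesis by (auto intro!: open_UN)
qed

lemma integrable_decay: "integrable lborel (\<lambda>x::real. 1 / (1 + \<bar>x\<bar>) ^ 2)"
proof (rule integrableI_bounded)
  have "(\<integral>\<^sup>+x. ennreal (norm (1 / (1 + \<bar>x::real\<bar>) ^ 2)) \<partial>lborel) \<le>
    (\<integral>\<^sup>+x. ennreal (indicator {z. \<bar>z\<bar> \<le> 1} x * \<bar>x\<bar> powr (- 0)) + ennreal (indicator {z. 1 \<le> \<bar>z\<bar>} x * \<bar>x\<bar> powr (- 2)) \<partial>lborel)"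
  proof (rule nn_integral_mono_AE, use AE_lborel_singleton[of 0] in eventually_elim)
    fix x :: real assume x: "x \<noteq> 0"
    have 1: "1 / (1 + \<bar>x\<bar>) ^ 2 \<le> 1" by (simp add: divide_le_eq_1 one_le_power)
    have 2: "1 / (1 + \<bar>x\<bar>) ^ 2 \<le> \<bar>x\<bar> powr (- 2)"
    proof -
      have "\<bar>x\<bar> powr (- 2) = 1 / \<bar>x\<bar> ^ 2" using x by (simp add: powr_minus divide_inverse powr_numeral)
      also have "1 / (1 + \<bar>x\<bar>) ^ 2 \<le> 1 / \<bar>x\<bar> ^ 2" using x by (intro divide_left_mono power_mono) auto
      finally show ?thesis .
    qed
    show "ennreal (norm (1 / (1 + \<bar>x\<bar>) ^ 2)) \<le> ennreal (indicator {z. \<bar>z\<bar> \<le> 1} x * \<bar>x\<bar> powr (- 0)) + ennreal (indicator {z. 1 \<le> \<bar>z\<bar>} x * \<bar>x\<bar> powr (- 2))"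
    proof (cases "\<bar>x\<bar> \<le> 1")
      case True
      then have "ennreal (norm (1 / (1 + \<bar>x\<bar>) ^ 2)) \<le> ennreal (indicator {z. \<bar>z\<bar> \<le> 1} x * \<bar>x\<bar> powr (- 0))"
        using 1 x by (intro ennreal_leI) auto
      then show ?thesis by (rule order_trans) simp
    next
      case False
      then have "ennreal (norm (1 / (1 + \<bar>x\<bar>) ^ 2)) \<le> ennreal (indicator {z. 1 \<le> \<bar>z\<bar>} x * \<bar>x\<bar> powr (- 2))"
        using 2 by (intro ennreal_leI) auto
      then show ?thesis by (rule order_trans) simp
    qed
  qed
  also have "\<dots> = (\<integral>\<^sup>+x. ennreal (indicator {z. \<bar>z\<bar> \<le> 1} x * \<bar>x\<bar> powr (- 0)) \<partial>(lborel::real measure)) + (\<integral>\<^sup>+x. ennreal (indicator {z. 1 \<le> \<bar>z\<bar>} x * \<bar>x\<bar> powr (- 2)) \<partial>(lborel::real measure))"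
    by (rule nn_integral_add) measurable
  also have "\<dots> \<le> ennreal (2 * (1 powr (1 - 0) / (1 - 0))) + ennreal (2 * (1 powr (1 - 2) / (2 - 1)))"
    by (intro add_mono nn_integral_powr_near nn_integral_powr_far) auto
  also have "\<dots> < \<infinity>" by (simp add: less_top[symmetric])
  finally show "(\<integral>\<^sup>+x. ennreal (norm (1 / (1 + \<bar>x::real\<bar>) ^ 2)) \<partial>lborel) < \<infinity>" .
qed measurable

lemma ftc_norm_bound:
  fixes \<phi> :: "real \<Rightarrow> complex"
  assumes "\<And>x. (\<phi> has_vector_derivative D x) (at x)" "continuous_on UNIV D" "a \<le> b"
  shows "ennreal (norm (\<phi> b - \<phi> a)) \<le> (\<integral>\<^sup>+\<xi>. indicator {a..b} \<xi> * ennreal (norm (D \<xi>)) \<partial>lborel)"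
proof -
  have "(D has_integral (\<phi> b - \<phi> a)) {a..b}"
    by (rule fundamental_theorem_of_calculus) (use assms in \<open>auto intro: has_vector_derivative_at_within\<close>)
  moreover have i: "set_integrable lborel {a..b} D"
    unfolding set_integrable_def
    by (rule borel_integrable_compact) (auto intro: continuous_on_subset[OF assms(2)])
  ultimately have "(LINT \<xi>|lborel. indicator {a..b} \<xi> *\<^sub>R D \<xi>) = \<phi> b - \<phi> a"
    using set_borel_integral_eq_integral(2)[OF i] by (simp add: set_lebesgue_integral_def integral_unique)
  then have "ennreal (norm (\<phi> b - \<phi> a)) \<le> (\<integral>\<^sup>+\<xi>. ennreal (norm (indicator {a..b} \<xi> *\<^sub>R D \<xi>)) \<partial>lborel)"
    using integral_norm_bound_ennreal[OF i[unfolded set_integrable_def]] by simp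
  also have "\<dots> = (\<integral>\<^sup>+\<xi>. indicator {a..b} \<xi> * ennreal (norm (D \<xi>)) \<partial>lborel)"
    by (intro nn_integral_cong) (auto simp: indicator_def)
  finally show ?thesis .
qed

text \<open>A test function is dominated by its least radially decreasing majorant, whose integral is
  controlled by the first moment of the derivative.\<close>

lemma schwartz_majorant:
  fixes \<phi> :: "real \<Rightarrow> complex"
  assumes d: "\<And>x. (\<phi> has_vector_derivative D x) (at x)" "continuous_on UNIV D"
    and b: "bounded (range (\<lambda>x. (1 + \<bar>x\<bar>) ^ 1 *\<^sub>R \<phi> x))"
  shows "ennreal (norm (\<phi> w)) \<le> (\<integral>\<^sup>+\<xi>. indicator {\<xi>. \<bar>w\<bar> \<le> \<bar>\<xi>\<bar>} \<xi> * ennreal (norm (D \<xi>)) \<partial>lborel)"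
proof (rule ennreal_le_epsilon)
  fix e :: real assume e: "0 < e"
  obtain B where B: "\<And>x. (1 + \<bar>x\<bar>) * norm (\<phi> x) \<le> B"
    using b by (auto simp: bounded_iff)
  have B0: "0 \<le> B" using B[of 0] by (auto intro: order_trans[OF norm_ge_zero])
  define R where "R = max \<bar>w\<bar> (B / e)"
  have small: "norm (\<phi> x) \<le> e" if "\<bar>x\<bar> = R" for x
  proof -
    have "norm (\<phi> x) \<le> B / (1 + R)" using B[of x] that B0 e by (simp add: field_simps)
    also have "\<dots> \<le> e"
    proof -
      have "B \<le> e * R" using e by (simp add: R_def max_def field_simps)
      also have "\<dots> \<le> e * (1 + R)" using e by simp
      finally show ?thesis using B0 e by (simp add: R_def pos_divide_le_eq add_pos_nonneg max_def)
    qed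
    finally show ?thesis .
  qed
  have R0: "0 \<le> R" and Rw: "\<bar>w\<bar> \<le> R" by (auto simp: R_def)
  define I where "I = (\<integral>\<^sup>+\<xi>. indicator {\<xi>. \<bar>w\<bar> \<le> \<bar>\<xi>\<bar>} \<xi> * ennreal (norm (D \<xi>)) \<partial>lborel)"
  have "\<exists>x. \<bar>x\<bar> = R \<and> ennreal (norm (\<phi> w - \<phi> x)) \<le> I"
  proof (cases "0 \<le> w")
    case True
    have "ennreal (norm (\<phi> R - \<phi> w)) \<le> (\<integral>\<^sup>+\<xi>. indicator {w..R} \<xi> * ennreal (norm (D \<xi>)) \<partial>lborel)"
      by (rule ftc_norm_bound[OF d]) (simp add: R_def)
    also have "\<dots> \<le> I" unfolding I_def using True
      by (intro nn_integral_mono mult_right_mono) (auto simp: indicator_def)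
    finally show ?thesis by (intro exI[of _ R]) (simp add: R0 norm_minus_commute)
  next
    case False
    have "ennreal (norm (\<phi> w - \<phi> (- R))) \<le> (\<integral>\<^sup>+\<xi>. indicator {-R..w} \<xi> * ennreal (norm (D \<xi>)) \<partial>lborel)"
      by (rule ftc_norm_bound[OF d]) (use Rw in linarith)
    also have "\<dots> \<le> I" unfolding I_def using False
      by (intro nn_integral_mono mult_right_mono) (auto simp: indicator_def)
    finally show ?thesis by (intro exI[of _ "- R"]) (simp add: R0)
  qed
  then obtain x where x: "\<bar>x\<bar> = R" "ennreal (norm (\<phi> w - \<phi> x)) \<le> I" by blast
  have "norm (\<phi> w) \<le> norm (\<phi> w - \<phi> x) + e"
    using small[OF x(1)] norm_triangle_sub[of "\<phi> w" "\<phi> x"] by simp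
  then have "ennreal (norm (\<phi> w)) \<le> ennreal (norm (\<phi> w - \<phi> x)) + ennreal e"
    using e by (simp add: ennreal_plus[symmetric] del: ennreal_plus)
  also have "\<dots> \<le> I + ennreal e" by (rule add_right_mono[OF x(2)])
  finally show "ennreal (norm (\<phi> w)) \<le> I + ennreal e" .
qed

text \<open>The radial majorant is a superposition of indicators. The interval of radius
  \<open>t * \<bar>\<xi>\<bar>\<close> about \<open>y\<close> lies in the one of radius
  \<open>t * (1 + \<bar>\<xi>\<bar>)\<close> about \<open>x\<close>, so each costs
  \<open>2 * (1 + \<bar>\<xi>\<bar>)\<close> times the maximal function; the weight of
  \<open>test_class 1\<close> bounds precisely this moment of the derivative.\<close>

lemma grand_max_le_hl_max:
  assumes g[measurable]: "g \<in> borel_measurable borel"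
  shows "grand_max 1 g x \<le> 2 * hl_max (\<lambda>y. ennreal (norm (g y))) x"
  unfolding grand_max_def
proof (intro SUP_least)
  fix \<phi> :: "real \<Rightarrow> complex" and t y :: real
  assume \<phi>: "\<phi> \<in> test_class 1" and "t \<in> {0<..}" and "y \<in> {x - t<..<x + t}"
  then have t: "0 < t" and y: "\<bar>y - x\<bar> < t" by (auto simp: abs_less_iff)
  have sch: "schwartz \<phi>" and int: "(LINT x|lborel. (1 + \<bar>x\<bar>) ^ 1 * (\<Sum>k\<le>1 + 1. norm (nth_deriv k \<phi> x))) \<le> 1"
    using \<phi> by (auto simp: test_class_def)
  have diff: "\<And>k x. nth_deriv k \<phi> differentiable (at x)" and bd: "\<And>m k. bounded (range (\<lambda>x. (1 + \<bar>x\<bar>) ^ m *\<^sub>R nth_deriv k \<phi> x))"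
    using sch by (auto simp: schwartz_def)
  define D where "D = nth_deriv 1 \<phi>"
  have cont: "continuous_on UNIV (nth_deriv k \<phi>)" for k
    by (intro continuous_at_imp_continuous_on ballI differentiable_imp_continuous_within diff)
  then have [measurable]: "nth_deriv k \<phi> \<in> borel_measurable borel" for k
    by (rule borel_measurable_continuous_onI)
  have [measurable]: "D \<in> borel_measurable borel" "\<phi> \<in> borel_measurable borel"
    using \<open>\<And>k. nth_deriv k \<phi> \<in> _\<close>[of 1] \<open>\<And>k. nth_deriv k \<phi> \<in> _\<close>[of 0] by (auto simp: D_def nth_deriv_def)
  have der: "(\<phi> has_vector_derivative D x) (at x)" for x
    using diff[of 0 x] by (simp add: D_def nth_deriv_def vector_derivative_works)
  have D1: "(\<integral>\<^sup>+\<xi>. ennreal ((1 + \<bar>\<xi>\<bar>) * norm (D \<xi>)) \<partial>lborel) \<le> 1"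
  proof -
    let ?G = "\<lambda>x. (1 + \<bar>x\<bar>) ^ 1 * (\<Sum>k\<le>1 + 1. norm (nth_deriv k \<phi> x))"
    have "\<exists>B. \<forall>x. (1 + \<bar>x\<bar>) ^ 3 * norm (nth_deriv k \<phi> x) \<le> B" for k
      using bd[of 3 k] by (auto simp: bounded_iff)
    then obtain B where B: "\<And>k x. (1 + \<bar>x\<bar>) ^ 3 * norm (nth_deriv k \<phi> x) \<le> B k" by metis
    \<comment> \<open>The integral in \<open>test_class\<close> would be 0 for a function that is
      not integrable, so Schwartz decay is needed before it can be read as a bound.\<close>
    have "integrable lborel ?G"
    proof (rule Bochner_Integration.integrable_bound)
      show "integrable lborel (\<lambda>x::real. (\<Sum>k\<le>1 + 1. B k) * (1 / (1 + \<bar>x\<bar>) ^ 2))"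
        using integrable_decay by (rule integrable_mult_right)
      show "AE x in lborel. norm (?G x) \<le> norm ((\<Sum>k\<le>1 + 1. B k) * (1 / (1 + \<bar>x\<bar>) ^ 2))"
      proof (rule AE_I2)
        fix x :: real
        have "?G x * (1 + \<bar>x\<bar>) ^ 2 = (\<Sum>k\<le>1 + 1. (1 + \<bar>x\<bar>) ^ 3 * norm (nth_deriv k \<phi> x))"
          by (simp add: sum_distrib_left power2_eq_square power3_eq_cube algebra_simps)
        also have "\<dots> \<le> (\<Sum>k\<le>1 + 1. B k)" by (intro sum_mono B)
        finally have "?G x \<le> (\<Sum>k\<le>1 + 1. B k) / (1 + \<bar>x\<bar>) ^ 2" by (subst pos_le_divide_eq) auto
        also have "\<dots> \<le> norm ((\<Sum>k\<le>1 + 1. B k) * (1 / (1 + \<bar>x\<bar>) ^ 2))"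
          unfolding real_norm_def times_divide_eq_right mult_1_right by (rule abs_ge_self)
        finally have "?G x \<le> norm ((\<Sum>k\<le>1 + 1. B k) * (1 / (1 + \<bar>x\<bar>) ^ 2))" .
        moreover have "0 \<le> ?G x" by (intro mult_nonneg_nonneg sum_nonneg) auto
        then have "norm (?G x) = ?G x" unfolding real_norm_def by (rule abs_of_nonneg)
        ultimately show "norm (?G x) \<le> norm ((\<Sum>k\<le>1 + 1. B k) * (1 / (1 + \<bar>x\<bar>) ^ 2))" by (simp only:)
      qed
    qed measurable
    then have "(\<integral>\<^sup>+\<xi>. ennreal (?G \<xi>) \<partial>lborel) = ennreal (LINT x|lborel. ?G x)"
      by (rule nn_integral_eq_integral) (auto intro!: AE_I2 mult_nonneg_nonneg sum_nonneg)
    also have "\<dots> \<le> 1" using int by simp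
    finally have 1: "(\<integral>\<^sup>+\<xi>. ennreal (?G \<xi>) \<partial>lborel) \<le> 1" .
    have "(1 + \<bar>\<xi>\<bar>) * norm (D \<xi>) \<le> ?G \<xi>" for \<xi>
    proof -
      have "norm (D \<xi>) \<le> (\<Sum>k\<le>1 + 1. norm (nth_deriv k \<phi> \<xi>))"
        unfolding D_def by (rule member_le_sum) auto
      then show ?thesis by (simp add: mult_left_mono)
    qed
    then have "(\<integral>\<^sup>+\<xi>. ennreal ((1 + \<bar>\<xi>\<bar>) * norm (D \<xi>)) \<partial>lborel) \<le> (\<integral>\<^sup>+\<xi>. ennreal (?G \<xi>) \<partial>lborel)"
      by (intro nn_integral_mono ennreal_leI)
    then show ?thesis using 1 by (rule order_trans)
  qed
  define M where "M = hl_max (\<lambda>y. ennreal (norm (g y))) x"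
  have "ennreal (norm (LINT z|lborel. (\<phi> ((y - z) / t) /\<^sub>R t) * g z)) \<le> (\<integral>\<^sup>+z. ennreal (norm ((\<phi> ((y - z) / t) /\<^sub>R t) * g z)) \<partial>lborel)"
    by (rule norm_integral_le_nn_integral)
  also have "\<dots> \<le> (\<integral>\<^sup>+z. \<integral>\<^sup>+\<xi>. ennreal (1 / t) * ennreal (norm (D \<xi>)) * (ennreal (norm (g z)) * indicator {z. \<bar>y - z\<bar> \<le> t * \<bar>\<xi>\<bar>} z) \<partial>lborel \<partial>lborel)"
  proof (rule nn_integral_mono)
    fix z
    have "ennreal (norm (\<phi> ((y - z) / t))) \<le> (\<integral>\<^sup>+\<xi>. indicator {\<xi>. \<bar>(y - z) / t\<bar> \<le> \<bar>\<xi>\<bar>} \<xi> * ennreal (norm (D \<xi>)) \<partial>lborel)"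
      by (rule schwartz_majorant[OF der]) (use cont[of 1] bd[of 1 0] in \<open>auto simp: D_def nth_deriv_def\<close>)
    then have "ennreal (1 / t) * ennreal (norm (g z)) * ennreal (norm (\<phi> ((y - z) / t))) \<le>
       ennreal (1 / t) * ennreal (norm (g z)) * (\<integral>\<^sup>+\<xi>. indicator {\<xi>. \<bar>(y - z) / t\<bar> \<le> \<bar>\<xi>\<bar>} \<xi> * ennreal (norm (D \<xi>)) \<partial>lborel)"
      by (rule mult_left_mono) simp
    also have "\<dots> = (\<integral>\<^sup>+\<xi>. ennreal (1 / t) * ennreal (norm (g z)) * (indicator {\<xi>. \<bar>(y - z) / t\<bar> \<le> \<bar>\<xi>\<bar>} \<xi> * ennreal (norm (D \<xi>))) \<partial>lborel)"
      by (rule nn_integral_cmult[symmetric]) measurable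
    also have "\<dots> = (\<integral>\<^sup>+\<xi>. ennreal (1 / t) * ennreal (norm (D \<xi>)) * (ennreal (norm (g z)) * indicator {z. \<bar>y - z\<bar> \<le> t * \<bar>\<xi>\<bar>} z) \<partial>lborel)"
      by (intro nn_integral_cong) (use t in \<open>auto simp: indicator_def field_simps abs_mult\<close>)
    finally show "ennreal (norm ((\<phi> ((y - z) / t) /\<^sub>R t) * g z)) \<le> \<dots>"
      using t by (simp add: norm_mult ennreal_mult[symmetric] field_simps)
  qed
  also have "\<dots> = (\<integral>\<^sup>+\<xi>. \<integral>\<^sup>+z. ennreal (1 / t) * ennreal (norm (D \<xi>)) * (ennreal (norm (g z)) * indicator {z. \<bar>y - z\<bar> \<le> t * \<bar>\<xi>\<bar>} z) \<partial>lborel \<partial>lborel)"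
    by (rule lborel_pair.Fubini'[symmetric]) measurable
  also have "\<dots> \<le> (\<integral>\<^sup>+\<xi>. 2 * M * ennreal ((1 + \<bar>\<xi>\<bar>) * norm (D \<xi>)) \<partial>lborel)"
  proof (rule nn_integral_mono)
    fix \<xi> :: real
    have r: "0 < t * (1 + \<bar>\<xi>\<bar>)" using t by simp
    have "(\<integral>\<^sup>+z. ennreal (norm (g z)) * indicator {z. \<bar>y - z\<bar> \<le> t * \<bar>\<xi>\<bar>} z \<partial>lborel) \<le> (\<integral>\<^sup>+z. ennreal (norm (g z)) * indicator (ball x (t * (1 + \<bar>\<xi>\<bar>))) z \<partial>lborel)"
      by (intro nn_integral_mono mult_left_mono) (use y in \<open>auto simp: indicator_def dist_real_def distrib_left\<close>)
    also have "\<dots> \<le> ennreal (2 * (t * (1 + \<bar>\<xi>\<bar>))) * M"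
      unfolding M_def by (rule hl_max_ge[OF r])
    finally have "ennreal (1 / t) * ennreal (norm (D \<xi>)) * (\<integral>\<^sup>+z. ennreal (norm (g z)) * indicator {z. \<bar>y - z\<bar> \<le> t * \<bar>\<xi>\<bar>} z \<partial>lborel) \<le> ennreal (1 / t) * ennreal (norm (D \<xi>)) * (ennreal (2 * (t * (1 + \<bar>\<xi>\<bar>))) * M)"
      by (rule mult_left_mono) simp
    also have "\<dots> = ennreal (1 / t * norm (D \<xi>) * (2 * (t * (1 + \<bar>\<xi>\<bar>)))) * M"
    proof -
      have "ennreal (1 / t * norm (D \<xi>) * (2 * (t * (1 + \<bar>\<xi>\<bar>)))) = ennreal (1 / t * norm (D \<xi>)) * ennreal (2 * (t * (1 + \<bar>\<xi>\<bar>)))"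
        by (rule ennreal_mult) (use t in auto)
      also have "ennreal (1 / t * norm (D \<xi>)) = ennreal (1 / t) * ennreal (norm (D \<xi>))"
        by (rule ennreal_mult) (use t in auto)
      finally show ?thesis by (simp only: mult.assoc)
    qed
    also have "1 / t * norm (D \<xi>) * (2 * (t * (1 + \<bar>\<xi>\<bar>))) = 2 * ((1 + \<bar>\<xi>\<bar>) * norm (D \<xi>))" using t by simp
    also have "ennreal (2 * ((1 + \<bar>\<xi>\<bar>) * norm (D \<xi>))) * M = 2 * M * ennreal ((1 + \<bar>\<xi>\<bar>) * norm (D \<xi>))"
      by (subst ennreal_mult) (auto simp: mult_ac)
    finally show "(\<integral>\<^sup>+z. ennreal (1 / t) * ennreal (norm (D \<xi>)) * (ennreal (norm (g z)) * indicator {z. \<bar>y - z\<bar> \<le> t * \<bar>\<xi>\<bar>} z) \<partial>lborel) \<le> 2 * M * ennreal ((1 + \<bar>\<xi>\<bar>) * norm (D \<xi>))"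
      by (subst nn_integral_cmult) auto
  qed
  also have "\<dots> = 2 * M * (\<integral>\<^sup>+\<xi>. ennreal ((1 + \<bar>\<xi>\<bar>) * norm (D \<xi>)) \<partial>lborel)"
    by (rule nn_integral_cmult) measurable
  also have "\<dots> \<le> 2 * M * 1" by (rule mult_left_mono[OF D1]) simp
  finally show "ennreal (norm (LINT z|lborel. (\<phi> ((y - z) / t) /\<^sub>R t) * g z)) \<le> 2 * hl_max (\<lambda>y. ennreal (norm (g y))) x"
    by (simp add: M_def)
qed

lemma unit_bump_exists:
  obtains \<rho> where "unit_bump \<rho>" "\<And>x. 0 \<le> \<rho> 0 x" "0 < \<rho> 0 0"
proof (rule bump_exists)
  fix \<rho> :: "nat \<Rightarrow> real \<Rightarrow> real"
  assume "dseq \<rho>" "\<And>k x. 1 \<le> \<bar>x\<bar> \<Longrightarrow> \<rho> k x = 0" "\<And>x. 0 \<le> \<rho> 0 x" "0 < \<rho> 0 0" "(LINT x|lborel. \<rho> 0 x) = 1"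
  then show thesis by (intro that[of \<rho>]) (auto simp: unit_bump_def)
qed

text \<open>Averages of \<open>f\<close> over bumps of any width are bounded by the grand maximal
  function with one constant, and they tend to \<open>f x\<close> by continuity. For
  \<open>1 < q\<close> this bounds the q-th power integral of \<open>f\<close> by the Hardy
  norm.\<close>

lemma norm_le_grand_max:
  obtains c where "0 < c" "\<And>f x. continuous_on UNIV f \<Longrightarrow> ennreal (norm (f x :: complex)) \<le> ennreal c * grand_max n f x"
proof -
  obtain \<rho> where bump: "unit_bump \<rho>" by (rule unit_bump_exists)
  note \<rho> = unit_bumpD[OF bump]
  define c where "c = pairing_const n * (2 ^ Suc n * 1 * bump_const n \<rho>)"
  have c: "0 \<le> c" using bump_const(1)[OF bump] by (simp add: c_def pairing_const_def)
  define I where "I = (LINT u|lborel. \<bar>\<rho> 0 u\<bar>)"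
  have I: "0 \<le> I" by (simp add: I_def)
  show thesis
  proof (rule that[of "c + 1"])
    show "0 < c + 1" using c by simp
    fix f :: "real \<Rightarrow> complex" and x assume f: "continuous_on UNIV f"
    have fc: "continuous_on UNIV (\<lambda>w. f (x + h * w))" for h by (rule continuous_on_affine_compose[OF f])
    have avg: "ennreal (norm (LINT w|lborel. \<rho> 0 w *\<^sub>R f (x + h * w))) \<le> ennreal c * grand_max n f x" if h: "0 < h" for h
    proof -
      \<comment> \<open>The constant function 1 with its derivatives: the bump itself is the whole
        test function.\<close>
      define G :: "nat \<Rightarrow> real \<Rightarrow> complex" where "G k s = (if k = 0 then 1 else 0)" for k s
      have G: "dseq G" unfolding dseq_def G_def[abs_def] by auto
      have "ennreal (norm (LINT s|lborel. G 0 s * of_real (\<rho> 0 ((s - x) / h)) * f s)) \<le> ennreal (c * h) * grand_max n f x"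
        unfolding c_def by (rule single_bump_bound[OF G bump h]) (use h in \<open>auto simp: G_def\<close>)
      moreover have "(LINT s|lborel. G 0 s * of_real (\<rho> 0 ((s - x) / h)) * f s) = h *\<^sub>R (LINT w|lborel. \<rho> 0 w *\<^sub>R f (x + h * w))"
        using h by (subst lborel_integral_real_affine[of h _ x]) (auto simp: G_def scaleR_conv_of_real)
      ultimately have "ennreal (1 / h) * ennreal (h * norm (LINT w|lborel. \<rho> 0 w *\<^sub>R f (x + h * w))) \<le> ennreal (1 / h) * (ennreal (c * h) * grand_max n f x)"
        using h by (intro mult_left_mono) auto
      then show ?thesis using h c by (simp add: mult.assoc[symmetric] ennreal_mult[symmetric])
    qed
    have "ennreal (norm (f x)) \<le> ennreal c * grand_max n f x"
    proof (rule ennreal_le_epsilon)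
      fix e :: real assume e: "0 < e"
      define e' where "e' = e / (I + 1)"
      have e': "0 < e'" using e I by (simp add: e'_def)
      have "continuous (at x) f" using f by (simp add: continuous_on_eq_continuous_at)
      then obtain d where d: "0 < d" "\<And>y. dist y x < d \<Longrightarrow> dist (f y) (f x) < e'"
        using e' unfolding continuous_at_eps_delta by blast
      define h where "h = d / 2"
      have h: "0 < h" using d by (simp add: h_def)
      have "(LINT w|lborel. \<rho> 0 w *\<^sub>R f (x + h * w)) - f x = (LINT w|lborel. \<rho> 0 w *\<^sub>R (f (x + h * w) - f x))"
      proof -
        have i: "integrable lborel (\<lambda>w. \<rho> 0 w *\<^sub>R f (x + h * w))" "integrable lborel (\<lambda>w. \<rho> 0 w *\<^sub>R f x)"
          by (rule scaled_bump_integral(1)[OF \<rho>(1,2)]; auto intro: fc)+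
        have "integrable lborel (\<lambda>w. \<rho> 0 w *\<^sub>R (1::real))" by (rule scaled_bump_integral(1)[OF \<rho>(1,2)]) auto
        then have "(LINT w|lborel. \<rho> 0 w *\<^sub>R f x) = f x"
          using \<rho>(3) by (subst integral_scaleR_left) auto
        then show ?thesis unfolding scaleR_diff_right by (subst Bochner_Integration.integral_diff[OF i]) simp
      qed
      also have "norm \<dots> \<le> I * e'"
        unfolding I_def
      proof (rule scaled_bump_bound[OF \<rho>(1,2)])
        fix w :: real assume w: "\<bar>w\<bar> \<le> 1"
        have "dist (x + h * w) x = h * \<bar>w\<bar>" using h by (simp add: dist_real_def abs_mult)
        also have "\<dots> \<le> h * 1" using w h by (intro mult_left_mono) auto
        also have "\<dots> < d" using d by (simp add: h_def)
        finally have "dist (x + h * w) x < d" .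
        from d(2)[OF this] show "norm (f (x + h * w) - f x) \<le> e'" by (simp add: dist_norm)
      qed (auto intro!: continuous_intros fc)
      also have "\<dots> \<le> e" using e I by (simp add: e'_def field_simps)
      finally have "norm (f x) \<le> norm (LINT w|lborel. \<rho> 0 w *\<^sub>R f (x + h * w)) + e"
        using norm_triangle_sub[of "f x" "LINT w|lborel. \<rho> 0 w *\<^sub>R f (x + h * w)"] by (simp add: norm_minus_commute)
      then have "ennreal (norm (f x)) \<le> ennreal (norm (LINT w|lborel. \<rho> 0 w *\<^sub>R f (x + h * w))) + ennreal e"
        using e by (simp add: ennreal_plus[symmetric] del: ennreal_plus)
      also have "\<dots> \<le> ennreal c * grand_max n f x + ennreal e" by (intro add_right_mono avg h)
      finally show "ennreal (norm (f x)) \<le> ennreal c * grand_max n f x + ennreal e" .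
    qed
    also have "\<dots> \<le> ennreal (c + 1) * grand_max n f x" using c by (intro mult_right_mono ennreal_leI) auto
    finally show "ennreal (norm (f x)) \<le> ennreal (c + 1) * grand_max n f x" .
  qed
qed

subsection \<open>Truncated operators\<close>

definition dq :: "real \<Rightarrow> (real \<Rightarrow> complex) \<Rightarrow> real \<Rightarrow> real \<Rightarrow> complex" where
  "dq \<beta> g x s = (g (x + \<beta> * (s - x)) - g x) / of_real (x - s)"

text \<open>The kernel of a single piece of \<open>b\<close> may decay only like
  \<open>1 / \<bar>x - s\<bar>\<close>, against which \<open>f\<close> need not be integrable. The
  cut-off confines every integral to a compact set; it is smooth so that the truncated kernel can
  still be paired with the grand maximal function.\<close>

definition trunc :: "real \<Rightarrow> (real \<Rightarrow> real) \<Rightarrow> real \<Rightarrow> (real \<Rightarrow> complex) \<Rightarrow> (real \<Rightarrow> complex) \<Rightarrow> real \<Rightarrow> complex" where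
  "trunc \<beta> \<eta> R g f x = (LINT s|lborel. dq \<beta> g x s * of_real (\<eta> ((s - x) / R)) * f s)"

lemma dq_add: "dq \<beta> (\<lambda>y. g1 y + g2 y) x s = dq \<beta> g1 x s + dq \<beta> g2 x s"
  by (simp add: dq_def diff_divide_distrib add_divide_distrib)

lemma dq_sum: "dq \<beta> (\<lambda>y. \<Sum>i\<in>I. g i y) x s = (\<Sum>i\<in>I. dq \<beta> (g i) x s)"
  by (simp add: dq_def sum_subtractf[symmetric] sum_divide_distrib)

text \<open>The kernel \<open>dq\<close> up to sign as a smooth function of \<open>s - x\<close>. It
  fills in the removable singularity, where \<open>dq\<close> takes the value 0 of a division by
  zero.\<close>

definition pull :: "real \<Rightarrow> real \<Rightarrow> (nat \<Rightarrow> real \<Rightarrow> complex) \<Rightarrow> nat \<Rightarrow> real \<Rightarrow> complex" where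
  "pull \<beta> x D = quot (\<lambda>k y. \<beta> ^ k *\<^sub>R D k (x + \<beta> * y))"

lemma dseq_pull: "dseq D \<Longrightarrow> dseq (\<lambda>k s. pull \<beta> x D k (s - x))"
  using dseq_affine[OF dseq_quot[OF dseq_affine], of D 1 \<beta> x "- x"] by (simp add: pull_def)

lemma dq_pull:
  assumes "dseq D" "s \<noteq> x"
  shows "dq \<beta> (D 0) x s = - pull \<beta> x D 0 (s - x)"
proof -
  have "(s - x) *\<^sub>R pull \<beta> x D 0 (s - x) = D 0 (x + \<beta> * (s - x)) - D 0 x"
    unfolding pull_def by (subst quot_0[OF dseq_affine[OF assms(1)]]) simp
  then have "dq \<beta> (D 0) x s = of_real (s - x) * pull \<beta> x D 0 (s - x) / of_real (x - s)"
    by (simp add: dq_def scaleR_conv_of_real)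
  also have "\<dots> = - pull \<beta> x D 0 (s - x)"
  proof -
    define X :: complex where "X = of_real (s - x)"
    have "of_real (x - s) = - X" "X \<noteq> 0" using assms(2) by (simp_all add: X_def)
    then show ?thesis unfolding X_def[symmetric] by simp
  qed
  finally show ?thesis .
qed

text \<open>The integrands agree except at \<open>s = x\<close>. For \<open>f\<close> arbitrary the
  product may fail to be measurable, and then both integrals are 0.\<close>

lemma trunc_pull:
  assumes "dseq D"
  shows "trunc \<beta> \<eta> R (D 0) f x = - (LINT s|lborel. pull \<beta> x D 0 (s - x) * of_real (\<eta> ((s - x) / R)) * f s)"
proof -
  have "trunc \<beta> \<eta> R (D 0) f x = (LINT s|lborel. - (pull \<beta> x D 0 (s - x) * of_real (\<eta> ((s - x) / R)) * f s))"
    unfolding trunc_def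
  proof (cases "(\<lambda>s. pull \<beta> x D 0 (s - x) * of_real (\<eta> ((s - x) / R)) * f s) \<in> borel_measurable lborel")
    case True
    have eq: "(\<lambda>s. dq \<beta> (D 0) x s * of_real (\<eta> ((s - x) / R)) * f s) =
        (\<lambda>s. if s = x then dq \<beta> (D 0) x x * of_real (\<eta> ((x - x) / R)) * f x else - (pull \<beta> x D 0 (s - x) * of_real (\<eta> ((s - x) / R)) * f s))"
      using dq_pull[OF assms] by auto
    have m: "(\<lambda>s. dq \<beta> (D 0) x s * of_real (\<eta> ((s - x) / R)) * f s) \<in> borel_measurable lborel"
      unfolding eq using True by measurable
    show "(LINT s|lborel. dq \<beta> (D 0) x s * of_real (\<eta> ((s - x) / R)) * f s) = (LINT s|lborel. - (pull \<beta> x D 0 (s - x) * of_real (\<eta> ((s - x) / R)) * f s))"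
      by (rule integral_cong_AE[OF m]) (use True AE_lborel_singleton[of x] dq_pull[OF assms] in auto)
  next
    case False
    have "(\<lambda>s. dq \<beta> (D 0) x s * of_real (\<eta> ((s - x) / R)) * f s) \<notin> borel_measurable lborel"
    proof
      assume m: "(\<lambda>s. dq \<beta> (D 0) x s * of_real (\<eta> ((s - x) / R)) * f s) \<in> borel_measurable lborel"
      have "(\<lambda>s. pull \<beta> x D 0 (s - x) * of_real (\<eta> ((s - x) / R)) * f s) =
        (\<lambda>s. if s = x then pull \<beta> x D 0 (x - x) * of_real (\<eta> ((x - x) / R)) * f x else - (dq \<beta> (D 0) x s * of_real (\<eta> ((s - x) / R)) * f s))"
        using dq_pull[OF assms] by auto
      also have "\<dots> \<in> borel_measurable lborel" using m by measurable
      finally show False using False by simp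
    qed
    then have "\<not> integrable lborel (\<lambda>s. dq \<beta> (D 0) x s * of_real (\<eta> ((s - x) / R)) * f s)" by auto
    moreover have "\<not> integrable lborel (\<lambda>s. pull \<beta> x D 0 (s - x) * of_real (\<eta> ((s - x) / R)) * f s)" using False by auto
    ultimately show "(LINT s|lborel. dq \<beta> (D 0) x s * of_real (\<eta> ((s - x) / R)) * f s) = (LINT s|lborel. - (pull \<beta> x D 0 (s - x) * of_real (\<eta> ((s - x) / R)) * f s))"
      by (simp add: not_integrable_integral_eq)
  qed
  then show ?thesis by simp
qed

text \<open>For data of width \<open>h\<close> the k-th derivative of the quotient is of size
  \<open>1 / (h + \<bar>s - x\<bar>)\<close> times the power \<open>- k\<close> of \<open>h\<close>,
  and the cut-off of radius \<open>R \<ge> h\<close> does not spoil this. It thus splits into bumps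
  of width \<open>h\<close> weighted by that decay. One derivative beyond the \<open>n + 1\<close>
  of the test class goes into the quotient.\<close>

lemma trunc_multi:
  fixes D :: "nat \<Rightarrow> real \<Rightarrow> complex"
  assumes D: "dseq D" and bump: "unit_bump \<rho>" and h: "0 < h" "h \<le> R"
    and B: "\<And>k y. k \<le> n + 2 \<Longrightarrow> norm (D k y) * h ^ k \<le> B" and f: "continuous_on UNIV f"
  defines "c \<equiv> pairing_const n * (2 ^ Suc n * (2 ^ Suc n * real (n + 4) * bump_const n \<rho> * 2) * bump_const n \<rho>)"
  shows "ennreal (norm (trunc \<beta> (\<rho> 0) R (D 0) f x)) \<le>
    (\<integral>\<^sup>+u. ennreal (c * (1 + \<bar>\<beta>\<bar>) ^ (n + 2) * (B / (h + \<bar>x - u\<bar>))) * level_sum (grand_max n f) h u \<partial>lborel)"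
proof -
  have R: "0 < R" using h by simp
  have B0: "0 \<le> B" using B[of 0 0] by (auto intro: order_trans[rotated])
  have bc: "0 \<le> bump_const n \<rho>" by (rule bump_const(1)[OF bump])
  define b where "b = (1 + \<bar>\<beta>\<bar>) ^ (n + 2)"
  have b1: "1 \<le> b" unfolding b_def by (rule one_le_power) simp
  define P where "P k s = pull \<beta> x D k (s - x)" for k s
  define G where "G = dmul P (scaled \<rho> R x)"
  have P: "dseq P" unfolding P_def[abs_def] by (rule dseq_pull[OF D])
  note sc = scaled[OF bump R]
  have G: "dseq G" unfolding G_def by (intro dseq_dmul P sc)
  have Pb: "norm (P k s) * h ^ k \<le> real (n + 4) * (b * B) / (h + \<bar>s - x\<bar>)" if "k \<le> Suc n" for k s
  proof -
    have "norm (quot (\<lambda>k y. \<beta> ^ k *\<^sub>R D k (x + \<beta> * y)) k (s - x)) * h ^ k \<le> real (Suc n + 3) * (b * B) / (h + \<bar>s - x\<bar>)"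
    proof (rule quot_decay[OF dseq_affine[OF D] h(1) _ that])
      fix k y assume k: "k \<le> Suc (Suc n)"
      have "\<bar>\<beta>\<bar> ^ k \<le> (1 + \<bar>\<beta>\<bar>) ^ k" by (intro power_mono) auto
      also have "\<dots> \<le> b" unfolding b_def using k by (intro power_increasing) auto
      finally have "\<bar>\<beta>\<bar> ^ k * (norm (D k (x + \<beta> * y)) * h ^ k) \<le> b * B"
        using B[of k] k b1 h by (intro mult_mono) auto
      then show "norm (\<beta> ^ k *\<^sub>R D k (x + \<beta> * y)) * h ^ k \<le> b * B" by (simp add: power_abs mult.assoc)
    qed
    then show ?thesis by (simp add: P_def pull_def add.commute)
  qed
  have Gb: "norm (G k s) * h ^ k \<le> 2 ^ Suc n * real (n + 4) * bump_const n \<rho> * 2 * (b * B / (h + \<bar>x - u\<bar>))"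
    if k: "k \<le> Suc n" and su: "\<bar>s - u\<bar> < h" for k s u
  proof -
    have "norm (G k s) * h ^ k \<le> 2 ^ k * (real (n + 4) * (b * B) / (h + \<bar>s - x\<bar>)) * bump_const n \<rho>"
      unfolding G_def
    proof (rule dmul_bound)
      fix i assume i: "i \<le> k"
      show "norm (P i s) * h ^ i \<le> real (n + 4) * (b * B) / (h + \<bar>s - x\<bar>)" using Pb i k by simp
      have "norm (scaled \<rho> R x i s) * h ^ i \<le> norm (scaled \<rho> R x i s) * R ^ i"
        using h by (intro mult_left_mono power_mono) auto
      also have "\<dots> \<le> bump_const n \<rho>" using sc(3)[of i n] i k by auto
      finally show "norm (scaled \<rho> R x i s) * h ^ i \<le> bump_const n \<rho>" .
    qed (use h in auto)
    also have "\<dots> \<le> 2 ^ Suc n * (real (n + 4) * (b * B) * (2 / (h + \<bar>x - u\<bar>))) * bump_const n \<rho>"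
    proof -
      \<comment> \<open>Within a bump \<open>s\<close> and \<open>u\<close> differ by less than
        \<open>h\<close>, so the weight changes by at most a factor 2.\<close>
      have "1 / (h + \<bar>s - x\<bar>) \<le> 2 / (h + \<bar>x - u\<bar>)"
      proof -
        have "\<bar>x - u\<bar> \<le> h + 2 * \<bar>s - x\<bar>"
        proof -
          have "\<bar>x - u\<bar> \<le> \<bar>x - s\<bar> + \<bar>s - u\<bar>" using abs_triangle_ineq[of "x - s" "s - u"] by simp
          moreover have "a \<le> h + 2 * b" if "a \<le> b + d" "d < h" "0 \<le> b" for a b d using that by linarith
          ultimately show ?thesis using su abs_ge_zero[of "s - x"] unfolding abs_minus_commute[of x s] by blast
        qed
        then show ?thesis using h by (simp add: field_simps)
      qed
      then have "real (n + 4) * (b * B) * (1 / (h + \<bar>s - x\<bar>)) \<le> real (n + 4) * (b * B) * (2 / (h + \<bar>x - u\<bar>))"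
        using B0 b1 by (intro mult_left_mono) auto
      then show ?thesis using k bc B0 b1 h
        by (intro mult_right_mono mult_mono power_increasing) auto
    qed
    finally show ?thesis by (simp only: divide_inverse mult_ac)
  qed
  have "ennreal (norm (LINT s|lborel. G 0 s * f s)) \<le>
     (\<integral>\<^sup>+u. ennreal (pairing_const n * (2 ^ Suc n * (2 ^ Suc n * real (n + 4) * bump_const n \<rho> * 2 * (b * B / (h + \<bar>x - u\<bar>))) * bump_const n \<rho>)) * level_sum (grand_max n f) h u \<partial>lborel)"
  proof (rule partitioned_pairing[OF G _ bump h(1) Gb f])
    show "G 0 s = 0" if "s \<notin> {x - R..x + R}" for s
    proof -
      have "R \<le> \<bar>s - x\<bar>" using that by (auto simp: abs_if)
      then show ?thesis using sc(2)[of s x 0] by (simp add: G_def)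
    qed
  qed
  moreover have "(LINT s|lborel. G 0 s * f s) = - trunc \<beta> (\<rho> 0) R (D 0) f x"
    unfolding trunc_pull[OF D] using R by (simp add: G_def P_def scaled_0)
  ultimately show ?thesis by (simp add: c_def b_def mult_ac)
qed

lemma trunc_single:
  fixes D :: "nat \<Rightarrow> real \<Rightarrow> complex"
  assumes D: "dseq D" and bump: "unit_bump \<rho>" and R: "0 < R"
    and B: "\<And>k z. k \<le> Suc n \<Longrightarrow> \<bar>z - x\<bar> \<le> \<bar>\<beta>\<bar> * R \<Longrightarrow> norm (D (Suc k) z) * R ^ k \<le> B"
    and z: "\<bar>z - x\<bar> < R"
  shows "ennreal (norm (trunc \<beta> (\<rho> 0) R (D 0) f x)) \<le>
    ennreal (pairing_const n * (2 ^ Suc n * ((1 + \<bar>\<beta>\<bar>) ^ (n + 2) * B) * bump_const n \<rho>) * R) * grand_max n f z"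
proof -
  have B0: "0 \<le> B" using B[of 0 x] R by (auto intro: order_trans[rotated])
  have "ennreal (norm (LINT s|lborel. pull \<beta> x D 0 (s - x) * of_real (\<rho> 0 ((s - x) / R)) * f s)) \<le>
    ennreal (pairing_const n * (2 ^ Suc n * ((1 + \<bar>\<beta>\<bar>) ^ (n + 2) * B) * bump_const n \<rho>) * R) * grand_max n f z"
  proof (rule single_bump_bound[OF dseq_pull[OF D] bump R _ z])
    fix k s assume k: "k \<le> Suc n" and s: "\<bar>s - x\<bar> < R"
    have "norm (pull \<beta> x D k (s - x)) \<le> (1 + \<bar>\<beta>\<bar>) ^ (n + 2) * (B / R ^ k)"
      unfolding pull_def
    proof (rule quot_bound[OF dseq_affine[OF D]])
      fix \<theta> :: real assume \<theta>: "0 \<le> \<theta>" "\<theta> \<le> 1"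
      have "\<bar>\<beta>\<bar> * (\<theta> * \<bar>s - x\<bar>) \<le> \<bar>\<beta>\<bar> * (1 * R)"
        using \<theta> s by (intro mult_left_mono mult_mono) auto
      then have "norm (D (Suc k) (x + \<beta> * (\<theta> * (s - x)))) * R ^ k \<le> B"
        using \<theta> by (intro B k) (auto simp: abs_mult)
      then have "norm (D (Suc k) (x + \<beta> * (\<theta> * (s - x)))) \<le> B / R ^ k"
        using R by (simp add: field_simps)
      moreover have "\<bar>\<beta>\<bar> ^ Suc k \<le> (1 + \<bar>\<beta>\<bar>) ^ (n + 2)"
        by (rule order_trans[OF power_mono[of "\<bar>\<beta>\<bar>" "1 + \<bar>\<beta>\<bar>"] power_increasing]) (use k in auto)
      ultimately have "\<bar>\<beta>\<bar> ^ Suc k * norm (D (Suc k) (x + \<beta> * (\<theta> * (s - x)))) \<le> (1 + \<bar>\<beta>\<bar>) ^ (n + 2) * (B / R ^ k)"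
        using B0 R by (intro mult_mono) auto
      then show "norm (\<beta> ^ Suc k *\<^sub>R D (Suc k) (x + \<beta> * (\<theta> * (s - x)))) \<le> (1 + \<bar>\<beta>\<bar>) ^ (n + 2) * (B / R ^ k)"
        by (simp only: norm_scaleR power_abs)
    qed
    then have "norm (pull \<beta> x D k (s - x)) * R ^ k \<le> (1 + \<bar>\<beta>\<bar>) ^ (n + 2) * (B / R ^ k) * R ^ k"
      using R by (intro mult_right_mono) auto
    then show "norm (pull \<beta> x D k (s - x)) * R ^ k \<le> (1 + \<bar>\<beta>\<bar>) ^ (n + 2) * B" using R by simp
  qed
  then show ?thesis unfolding trunc_pull[OF D] by simp
qed

lemma dq_lipschitz_bound:
  assumes L: "\<And>y z. \<bar>y\<bar> \<le> T \<Longrightarrow> \<bar>z\<bar> \<le> T \<Longrightarrow> norm (g y - g z) \<le> L * \<bar>y - z\<bar>"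
    and T: "\<bar>x\<bar> + \<bar>\<beta>\<bar> * R \<le> T" and R: "0 \<le> R" and s: "\<bar>s - x\<bar> \<le> R" and L0: "0 \<le> L"
  shows "norm (dq \<beta> g x s) \<le> L * \<bar>\<beta>\<bar>"
proof (cases "s = x")
  case True
  then show ?thesis using L0 by (simp add: dq_def)
next
  case False
  have "\<bar>\<beta> * (s - x)\<bar> \<le> \<bar>\<beta>\<bar> * R" unfolding abs_mult using s by (intro mult_left_mono) auto
  then have "norm (g (x + \<beta> * (s - x)) - g x) \<le> L * \<bar>\<beta> * (s - x)\<bar>"
    using L[of "x + \<beta> * (s - x)" x] T R mult_nonneg_nonneg[OF abs_ge_zero[of \<beta>] R] by auto
  then have "norm (g (x + \<beta> * (s - x)) - g x) / \<bar>x - s\<bar> \<le> (L * \<bar>\<beta> * (s - x)\<bar>) / \<bar>x - s\<bar>"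
    by (rule divide_right_mono) simp
  also have "\<dots> = L * \<bar>\<beta>\<bar>" using False by (simp add: abs_mult abs_minus_commute)
  finally show ?thesis by (simp add: dq_def norm_divide flip: of_real_diff)
qed

lemma measurable_dq [measurable]:
  assumes [measurable]: "g \<in> borel_measurable borel" shows "(\<lambda>s. dq \<beta> g x s) \<in> borel_measurable borel"
  unfolding dq_def by measurable

lemma trunc_majorant:
  fixes f :: "real \<Rightarrow> complex"
  assumes bump: "unit_bump \<rho>" and f: "continuous_on UNIV f" and R: "0 < R"
  obtains M where "0 \<le> M" "\<And>s. norm (of_real (\<rho> 0 ((s - x) / R)) * f s) \<le> M"
    "\<And>s. R \<le> \<bar>s - x\<bar> \<Longrightarrow> of_real (\<rho> 0 ((s - x) / R)) * f s = 0"
proof -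
  have z: "of_real (\<rho> 0 ((s - x) / R)) * f s = 0" if "R \<le> \<bar>s - x\<bar>" for s
    using unit_bumpD(2)[OF bump, of "(s - x) / R" 0] that R by (simp add: field_simps)
  have "bounded (range (\<lambda>s. of_real (\<rho> 0 ((s - x) / R)) * f s))"
  proof (rule compact_support_bounded)
    show "continuous_on UNIV (\<lambda>s. complex_of_real (\<rho> 0 ((s - x) / R)) * f s)"
      by (intro continuous_on_mult f continuous_on_of_real dseq_continuous2[OF unit_bumpD(1)[OF bump]] continuous_intros) (use R in auto)
    show "complex_of_real (\<rho> 0 ((s - x) / R)) * f s = 0" if "s \<notin> {x - R..x + R}" for s
      by (rule z) (use that in \<open>auto simp: abs_if\<close>)
  qed
  then obtain M where M: "\<forall>s. norm (complex_of_real (\<rho> 0 ((s - x) / R)) * f s) \<le> M" by (auto simp: bounded_iff)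
  show thesis
    by (rule that[of "max M 0"]) (use M z in \<open>auto simp: le_max_iff_disj\<close>)
qed

lemma trunc_integrable:
  assumes bump: "unit_bump \<rho>" and f: "continuous_on UNIV f" and R: "0 < R" and g: "continuous_on UNIV g"
    and L: "\<And>y z. \<bar>y\<bar> \<le> T \<Longrightarrow> \<bar>z\<bar> \<le> T \<Longrightarrow> norm (g y - g z) \<le> L * \<bar>y - z\<bar>"
    and T: "\<bar>x\<bar> + \<bar>\<beta>\<bar> * R \<le> T" and L0: "0 \<le> L"
  shows "integrable lborel (\<lambda>s. dq \<beta> g x s * of_real (\<rho> 0 ((s - x) / R)) * f s)"
proof -
  obtain M where M: "0 \<le> M" "\<And>s. norm (of_real (\<rho> 0 ((s - x) / R)) * f s) \<le> M"
    "\<And>s. R \<le> \<bar>s - x\<bar> \<Longrightarrow> of_real (\<rho> 0 ((s - x) / R)) * f s = 0"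
    by (rule trunc_majorant[OF bump f R, where x=x]) blast
  have [measurable]: "g \<in> borel_measurable borel" "f \<in> borel_measurable borel" "\<rho> 0 \<in> borel_measurable borel"
    using g f dseq_continuous[OF unit_bumpD(1)[OF bump]] by (auto intro: borel_measurable_continuous_onI)
  show ?thesis
  proof (rule Bochner_Integration.integrable_bound)
    show "integrable lborel (\<lambda>s. indicator {x - R..x + R} s *\<^sub>R (L * \<bar>\<beta>\<bar> * M))"
      by (rule borel_integrable_compact) auto
    show "AE s in lborel. norm (dq \<beta> g x s * of_real (\<rho> 0 ((s - x) / R)) * f s) \<le> norm (indicator {x - R..x + R} s *\<^sub>R (L * \<bar>\<beta>\<bar> * M))"
    proof (rule AE_I2)
      fix s
      show "norm (dq \<beta> g x s * of_real (\<rho> 0 ((s - x) / R)) * f s) \<le> norm (indicator {x - R..x + R} s *\<^sub>R (L * \<bar>\<beta>\<bar> * M))"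
      proof (cases "\<bar>s - x\<bar> < R")
        case True
        have "norm (dq \<beta> g x s * (of_real (\<rho> 0 ((s - x) / R)) * f s)) \<le> (L * \<bar>\<beta>\<bar>) * M"
          unfolding norm_mult[of "dq \<beta> g x s"]
          by (intro mult_mono dq_lipschitz_bound[OF L T] M) (use True R L0 in auto)
        then show ?thesis using True L0 M(1) by (auto simp: mult.assoc indicator_def abs_less_iff)
      next
        case False
        then have "dq \<beta> g x s * of_real (\<rho> 0 ((s - x) / R)) * f s = 0"
          using M(3)[of s] unfolding mult.assoc by (simp only: mult_zero_right not_less)
        then show ?thesis by (simp only:) simp
      qed
    qed
  qed measurable
qed

text \<open>Dominated convergence: the common local Lipschitz constant bounds all difference
  quotients, including those near \<open>s = x\<close>.\<close>

lemma trunc_tendsto_0: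
  assumes bump: "unit_bump \<rho>" and f: "continuous_on UNIV f" and R: "0 < R" and g: "\<And>i. continuous_on UNIV (g i)"
    and L: "\<And>i y z. \<bar>y\<bar> \<le> T \<Longrightarrow> \<bar>z\<bar> \<le> T \<Longrightarrow> norm (g i y - g i z) \<le> L * \<bar>y - z\<bar>"
    and T: "\<bar>x\<bar> + \<bar>\<beta>\<bar> * R \<le> T" and L0: "0 \<le> L" and lim: "\<And>y. (\<lambda>i. g i y) \<longlonglongrightarrow> 0"
  shows "(\<lambda>i::nat. trunc \<beta> (\<rho> 0) R (g i) f x) \<longlonglongrightarrow> 0"
proof -
  obtain M where M: "0 \<le> M" "\<And>s. norm (of_real (\<rho> 0 ((s - x) / R)) * f s) \<le> M"
    "\<And>s. R \<le> \<bar>s - x\<bar> \<Longrightarrow> of_real (\<rho> 0 ((s - x) / R)) * f s = 0"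
    by (rule trunc_majorant[OF bump f R, where x=x]) blast
  have [measurable]: "g i \<in> borel_measurable borel" "f \<in> borel_measurable borel" "\<rho> 0 \<in> borel_measurable borel" for i
    using g[of i] f dseq_continuous[OF unit_bumpD(1)[OF bump]] by (auto intro: borel_measurable_continuous_onI)
  have "(\<lambda>i::nat. trunc \<beta> (\<rho> 0) R (g i) f x) \<longlonglongrightarrow> (LINT s|(lborel :: real measure). (0::complex))"
    unfolding trunc_def
  proof (rule integral_dominated_convergence)
    show "integrable lborel (\<lambda>s. indicator {x - R..x + R} s *\<^sub>R (L * \<bar>\<beta>\<bar> * M))"
      by (rule borel_integrable_compact) auto
    show "AE s in lborel. (\<lambda>i. dq \<beta> (g i) x s * of_real (\<rho> 0 ((s - x) / R)) * f s) \<longlonglongrightarrow> 0"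
    proof (rule AE_I2)
      fix s
      have "(\<lambda>i. (g i (x + \<beta> * (s - x)) - g i x) * (inverse (of_real (x - s)) * of_real (\<rho> 0 ((s - x) / R)) * f s)) \<longlonglongrightarrow> (0 - 0) * (inverse (of_real (x - s)) * of_real (\<rho> 0 ((s - x) / R)) * f s)"
        by (intro tendsto_intros lim)
      then show "(\<lambda>i. dq \<beta> (g i) x s * of_real (\<rho> 0 ((s - x) / R)) * f s) \<longlonglongrightarrow> 0"
        by (simp add: dq_def divide_inverse mult.assoc)
    qed
    show "AE s in lborel. norm (dq \<beta> (g i) x s * of_real (\<rho> 0 ((s - x) / R)) * f s) \<le> indicator {x - R..x + R} s *\<^sub>R (L * \<bar>\<beta>\<bar> * M)" for i
    proof (rule AE_I2)
      fix s
      show "norm (dq \<beta> (g i) x s * of_real (\<rho> 0 ((s - x) / R)) * f s) \<le> indicator {x - R..x + R} s *\<^sub>R (L * \<bar>\<beta>\<bar> * M)"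
      proof (cases "\<bar>s - x\<bar> < R")
        case True
        have "norm (dq \<beta> (g i) x s * (of_real (\<rho> 0 ((s - x) / R)) * f s)) \<le> (L * \<bar>\<beta>\<bar>) * M"
          unfolding norm_mult[of "dq \<beta> (g i) x s"]
          by (intro mult_mono dq_lipschitz_bound[OF L T] M) (use True R L0 in auto)
        then show ?thesis using True L0 M(1) by (auto simp: mult.assoc indicator_def abs_less_iff)
      next
        case False
        then have "dq \<beta> (g i) x s * of_real (\<rho> 0 ((s - x) / R)) * f s = 0"
          using M(3)[of s] unfolding mult.assoc by (simp only: mult_zero_right not_less)
        then show ?thesis by (simp only:) (simp add: indicator_def M(1) L0)
      qed
    qed
  qed measurable
  then show ?thesis by simp
qed

text \<open>The cut-off tends pointwise to \<open>\<rho> 0 0\<close>, which is not normalised to 1;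
  the factor is divided out in the end.\<close>

lemma trunc_tendsto_H_op:
  assumes bump: "unit_bump \<rho>" and int: "integrable lborel (H_integrand \<beta> b f x)"
  shows "(\<lambda>i::nat. trunc \<beta> (\<rho> 0) (2 ^ i) b f x) \<longlonglongrightarrow> of_real (\<rho> 0 0) * H_op \<beta> b f x"
proof -
  have eq: "dq \<beta> b x s * of_real r * f s = of_real r * H_integrand \<beta> b f x s" for s r
    by (simp add: dq_def H_integrand_def)
  have [measurable]: "\<rho> 0 \<in> borel_measurable borel" "H_integrand \<beta> b f x \<in> borel_measurable lborel"
    using dseq_continuous[OF unit_bumpD(1)[OF bump]] int by (auto intro: borel_measurable_continuous_onI)
  have "(\<lambda>i::nat. LINT s|lborel. of_real (\<rho> 0 ((s - x) / 2 ^ i)) * H_integrand \<beta> b f x s) \<longlonglongrightarrow> (LINT s|lborel. of_real (\<rho> 0 0) * H_integrand \<beta> b f x s)"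
  proof (rule integral_dominated_convergence)
    show "integrable lborel (\<lambda>s. bump_const 0 \<rho> * norm (H_integrand \<beta> b f x s))"
      using int by simp
    show "AE s in lborel. (\<lambda>i. of_real (\<rho> 0 ((s - x) / 2 ^ i)) * H_integrand \<beta> b f x s) \<longlonglongrightarrow> of_real (\<rho> 0 0) * H_integrand \<beta> b f x s"
    proof (rule AE_I2)
      fix s
      have "(\<lambda>i. (s - x) / 2 ^ i) \<longlonglongrightarrow> 0"
        by (intro LIMSEQ_divide_realpow_zero) auto
      then have "(\<lambda>i. \<rho> 0 ((s - x) / 2 ^ i)) \<longlonglongrightarrow> \<rho> 0 0"
        using dseq_continuous[OF unit_bumpD(1)[OF bump], of UNIV 0]
        by (auto simp: continuous_on_eq_continuous_at intro: isCont_tendsto_compose)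
      then show "(\<lambda>i. of_real (\<rho> 0 ((s - x) / 2 ^ i)) * H_integrand \<beta> b f x s) \<longlonglongrightarrow> of_real (\<rho> 0 0) * H_integrand \<beta> b f x s"
        by (intro tendsto_intros)
    qed
    show "AE s in lborel. norm (of_real (\<rho> 0 ((s - x) / 2 ^ i)) * H_integrand \<beta> b f x s) \<le> bump_const 0 \<rho> * norm (H_integrand \<beta> b f x s)" for i
      using bump_const(2)[OF bump, of 0 0] by (intro AE_I2) (auto simp: norm_mult intro!: mult_right_mono)
  qed measurable
  then show ?thesis by (simp add: trunc_def eq H_op_def)
qed

lemma measurable_grand_max [measurable]: "grand_max n f \<in> borel_measurable borel"
  by (rule borel_measurableI_greater) (auto intro: borel_open grand_max_open)

section \<open>The coarsest scale and the pointwise bound\<close>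

context smoothing
begin

text \<open>The exponent \<open>\<gamma>\<close> is slightly larger than \<open>\<alpha>\<close>, which absorbs the constants and logarithms
  coming from the polynomial part of \<open>b\<close>.\<close>

lemma smoothed_growth:
  assumes b: "\<And>x. (b has_vector_derivative b' x) (at x)" "continuous_on UNIV b'"
    and A: "\<And>t y. norm ((fwd_diff t ^^ m) b y) \<le> A * \<bar>t\<bar> powr \<alpha>" "0 \<le> A"
    and m\<alpha>: "real m \<le> \<alpha> + 1" and \<gamma>: "\<alpha> < \<gamma>" and k: "1 \<le> k"
  shows "\<exists>C\<ge>0. \<forall>L z. \<bar>z - x\<bar> \<le> \<bar>\<beta>\<bar> * 2 ^ L \<longrightarrow>
    norm (smoothed m \<Phi> b (2 ^ L) k z) \<le> C * (2 ^ L) powr (\<gamma> - real k)"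
proof -
  have bc: "continuous_on UNIV b"
    using b(1) by (meson continuous_on_vector_derivative has_vector_derivative_at_within)
  define Q where "Q k \<longleftrightarrow> (\<exists>C\<ge>0. \<forall>L z. \<bar>z - x\<bar> \<le> \<bar>\<beta>\<bar> * 2 ^ L \<longrightarrow>
    norm (smoothed m \<Phi> b (2 ^ L) k z) \<le> C * (2 ^ L) powr (\<gamma> - real k))" for k
  have high: "Q k" if mk: "m \<le> k" for k
  proof -
    obtain C where C: "0 \<le> C" "\<And>h y. 0 < h \<Longrightarrow> norm (smoothed m \<Phi> b h k y) * h ^ k \<le> C * A * h powr \<alpha>"
      using smoothed_high_derivatives[OF mk] bc A by metis
    show ?thesis unfolding Q_def
    proof (intro exI[of _ "C * A"] conjI allI impI)
      fix L :: nat and z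
      have "norm (smoothed m \<Phi> b (2 ^ L) k z) \<le> C * A * (2 ^ L) powr \<alpha> / (2 ^ L) ^ k"
        using C(2)[of "2 ^ L" z] by (simp add: pos_le_divide_eq)
      also have "\<dots> = C * A * (2 ^ L) powr (\<alpha> - real k)" by (simp add: powr_diff powr_realpow)
      also have "\<dots> \<le> C * A * (2 ^ L) powr (\<gamma> - real k)"
        using C(1) A(2) \<gamma> by (intro mult_left_mono powr_mono) auto
      finally show "norm (smoothed m \<Phi> b (2 ^ L) k z) \<le> C * A * (2 ^ L) powr (\<gamma> - real k)" .
    qed (use C A in auto)
  qed
  have low: "Q k" if k: "1 \<le> k" "k < m" and IH: "Q (Suc k)" for k
  proof -
    obtain C1 where C1: "0 \<le> C1" "\<And>L z. \<bar>z - x\<bar> \<le> \<bar>\<beta>\<bar> * 2 ^ L \<Longrightarrow>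
       norm (smoothed m \<Phi> b (2 ^ L) (Suc k) z) \<le> C1 * (2 ^ L) powr (\<gamma> - real (Suc k))"
      using IH unfolding Q_def by blast
    obtain C2 where C2: "0 \<le> C2" "\<And>h y. 0 < h \<Longrightarrow> norm (smoothed m \<Phi> b h k y - smoothed m \<Phi> b (2 * h) k y) * h ^ k \<le> C2 * A * h powr \<alpha>"
      using smoothed_difference[of k] b A by (metis order_refl)
    \<comment> \<open>From \<open>k < m\<close> and \<open>m \<le> \<alpha> + 1\<close> follows
      \<open>k \<le> \<alpha> < \<gamma>\<close>, so the increments between consecutive scales are
      bounded by a growing geometric sequence.\<close>
    define g where "g = \<gamma> - real k"
    have g: "0 < g" using k m\<alpha> \<gamma> by (simp add: g_def)
    have g2: "1 < 2 powr g" using g by simp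
    \<comment> \<open>Large enough for scale 1 and for
      \<open>C2 * A \<le> C3 * (2 powr g - 1)\<close>: one more doubling then multiplies the bound
      by exactly \<open>2 powr g\<close>.\<close>
    define C3 where "C3 = norm (smoothed m \<Phi> b 1 k x) + C2 * A / (2 powr g - 1)"
    have C3: "0 \<le> C3" "C2 * A \<le> C3 * (2 powr g - 1)"
    proof -
      show "0 \<le> C3" using C2 A g2 by (simp add: C3_def)
      have "C2 * A = C2 * A / (2 powr g - 1) * (2 powr g - 1)" using g2 g by simp
      also have "\<dots> \<le> C3 * (2 powr g - 1)" using g2 by (intro mult_right_mono) (auto simp: C3_def)
      finally show "C2 * A \<le> C3 * (2 powr g - 1)" .
    qed
    have at_x: "norm (smoothed m \<Phi> b (2 ^ L) k x) \<le> C3 * (2 ^ L) powr g" for L :: nat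
    proof (induction L)
      case 0
      then show ?case using C2 A g2 by (simp add: C3_def)
    next
      case (Suc L)
      have "norm (smoothed m \<Phi> b (2 ^ L) k x - smoothed m \<Phi> b (2 * 2 ^ L) k x) \<le> C2 * A * (2 ^ L) powr \<alpha> / (2 ^ L) ^ k"
        using C2(2)[of "2 ^ L" x] by (simp add: pos_le_divide_eq)
      also have "\<dots> = C2 * A * (2 ^ L) powr (\<alpha> - real k)" by (simp add: powr_diff powr_realpow)
      also have "\<dots> \<le> C2 * A * (2 ^ L) powr g"
        using C2(1) A(2) \<gamma> by (intro mult_left_mono powr_mono) (auto simp: g_def)
      also have "\<dots> \<le> C3 * (2 powr g - 1) * (2 ^ L) powr g" using C3 by (intro mult_right_mono) auto
      finally have "norm (smoothed m \<Phi> b (2 ^ Suc L) k x) \<le> C3 * (2 ^ L) powr g + C3 * (2 powr g - 1) * (2 ^ L) powr g"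
        using Suc norm_triangle_sub[of "smoothed m \<Phi> b (2 ^ Suc L) k x" "smoothed m \<Phi> b (2 ^ L) k x"]
        by (simp add: norm_minus_commute)
      also have "\<dots> = C3 * (2 powr g * (2 ^ L) powr g)" by (simp add: algebra_simps)
      also have "2 powr g * (2 ^ L) powr g = (2 ^ Suc L) powr g" by (simp add: powr_mult)
      finally show ?case .
    qed
    show ?thesis unfolding Q_def
    proof (intro exI[of _ "C3 + C1 * \<bar>\<beta>\<bar>"] conjI allI impI)
      fix L :: nat and z assume z: "\<bar>z - x\<bar> \<le> \<bar>\<beta>\<bar> * 2 ^ L"
      let ?S = "{x - \<bar>\<beta>\<bar> * 2 ^ L..x + \<bar>\<beta>\<bar> * 2 ^ L}"
      have d: "dseq (smoothed m \<Phi> b (2 ^ L))" by (rule dseq_smoothed[OF b]) simp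
      \<comment> \<open>From the centre \<open>x\<close> to a nearby \<open>z\<close> by the mean
        value inequality, with the bound for the next order from the induction.\<close>
      have "norm (smoothed m \<Phi> b (2 ^ L) k z - smoothed m \<Phi> b (2 ^ L) k x) \<le> C1 * (2 ^ L) powr (\<gamma> - real (Suc k)) * \<bar>z - x\<bar>"
      proof (rule dseq_lipschitz[OF d, where S="?S"])
        show "norm (smoothed m \<Phi> b (2 ^ L) (Suc k) y) \<le> C1 * (2 ^ L) powr (\<gamma> - real (Suc k))" if "y \<in> ?S" for y
          by (rule C1(2)) (use that in \<open>auto simp: abs_le_iff\<close>)
      qed (use z in \<open>auto simp: abs_le_iff\<close>)
      also have "\<dots> \<le> C1 * (2 ^ L) powr (\<gamma> - real (Suc k)) * (\<bar>\<beta>\<bar> * 2 ^ L)"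
        using z C1(1) by (intro mult_left_mono) auto
      also have "\<dots> = C1 * \<bar>\<beta>\<bar> * ((2 ^ L) powr (\<gamma> - real (Suc k)) * (2 ^ L) powr 1)" by simp
      also have "(2 ^ L) powr (\<gamma> - real (Suc k)) * (2 ^ L) powr 1 = (2 ^ L) powr g"
        unfolding powr_add[symmetric] by (simp add: g_def)
      finally have "norm (smoothed m \<Phi> b (2 ^ L) k z) \<le> C3 * (2 ^ L) powr g + C1 * \<bar>\<beta>\<bar> * (2 ^ L) powr g"
        using at_x[of L] norm_triangle_sub[of "smoothed m \<Phi> b (2 ^ L) k z" "smoothed m \<Phi> b (2 ^ L) k x"] by simp
      then show "norm (smoothed m \<Phi> b (2 ^ L) k z) \<le> (C3 + C1 * \<bar>\<beta>\<bar>) * (2 ^ L) powr (\<gamma> - real k)"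
        by (simp add: g_def algebra_simps)
    qed (use C1 C3 in auto)
  qed
  have "Q k"
  proof (cases "m \<le> k")
    case False
    then have "k \<le> m" by simp
    then show ?thesis
      using k
    proof (induction rule: inc_induct)
      case base
      then show ?case by (intro high) simp
    next
      case (step j)
      then show ?case using low[of j] by simp
    qed
  qed (rule high)
  then show ?thesis unfolding Q_def .
qed

text \<open>With \<open>R = 2 ^ L\<close>, \<open>trunc_single\<close> bounds the term by a multiple
  of \<open>R powr \<gamma>\<close> times the grand maximal function at any point closer than
  \<open>R\<close> to \<open>x\<close>. Integrating the q-th power over this ball gains
  \<open>R powr (- 1 / q)\<close>, which wins as \<gamma> < 1/q.\<close>

lemma trunc_smoothed_tendsto_0:
  assumes b: "\<And>x. (b has_vector_derivative b' x) (at x)" "continuous_on UNIV b'"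
    and A: "\<And>t y. norm ((fwd_diff t ^^ m) b y) \<le> A * \<bar>t\<bar> powr \<alpha>" "0 \<le> A"
    and m\<alpha>: "real m \<le> \<alpha> + 1" and q: "0 < q" "\<alpha> < 1 / q" and bump: "unit_bump \<rho>"
    and fin: "(\<integral>\<^sup>+x. epowr (grand_max n f x) q \<partial>lborel) < top"
  shows "(\<lambda>L. trunc \<beta> (\<rho> 0) (2 ^ L) (smoothed m \<Phi> b (2 ^ L) 0) f x) \<longlonglongrightarrow> 0"
proof -
  define \<gamma> where "\<gamma> = (\<alpha> + 1 / q) / 2"
  have \<gamma>: "\<alpha> < \<gamma>" "\<gamma> < 1 / q" using q by (auto simp: \<gamma>_def)
  have "\<exists>C. \<forall>k\<in>{1..n + 2}. 0 \<le> C k \<and> (\<forall>L z. \<bar>z - x\<bar> \<le> \<bar>\<beta>\<bar> * 2 ^ L \<longrightarrow>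
    norm (smoothed m \<Phi> b (2 ^ L) k z) \<le> C k * (2 ^ L) powr (\<gamma> - real k))"
    using smoothed_growth[OF b A m\<alpha> \<gamma>(1), of _ x \<beta>] by (intro bchoice) auto
  then obtain C where C: "\<And>k. k \<in> {1..n+2} \<Longrightarrow> 0 \<le> C k" "\<And>k L z. k \<in> {1..n+2} \<Longrightarrow> \<bar>z - x\<bar> \<le> \<bar>\<beta>\<bar> * 2 ^ L \<Longrightarrow>
    norm (smoothed m \<Phi> b (2 ^ L) k z) \<le> C k * (2 ^ L) powr (\<gamma> - real k)" by blast
  define C1 where "C1 = (\<Sum>k\<in>{1..n+2}. C k)"
  have C1: "0 \<le> C1" "\<And>k. k \<in> {1..n+2} \<Longrightarrow> C k \<le> C1"
  proof -
    show "0 \<le> C1" unfolding C1_def by (rule sum_nonneg) (rule C(1))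
    show "C k \<le> C1" if "k \<in> {1..n+2}" for k
      unfolding C1_def using that by (rule member_le_sum) (use C(1) in auto)
  qed
  define X where "X = enn2real (\<integral>\<^sup>+x. epowr (grand_max n f x) q \<partial>lborel)"
  have X: "(\<integral>\<^sup>+x. epowr (grand_max n f x) q \<partial>lborel) = ennreal X" "0 \<le> X" using fin by (auto simp: X_def less_top)
  define c where "c = pairing_const n * (2 ^ Suc n * ((1 + \<bar>\<beta>\<bar>) ^ (n + 2) * C1) * bump_const n \<rho>)"
  have c: "0 \<le> c" using C1 bump_const(1)[OF bump, of n] by (simp add: c_def pairing_const_def)
  have bound: "norm (trunc \<beta> (\<rho> 0) (2 ^ L) (smoothed m \<Phi> b (2 ^ L) 0) f x) \<le> c * X powr (1 / q) * (2 powr (\<gamma> - 1 / q)) ^ L" for L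
  proof -
    define R :: real where "R = 2 ^ L"
    have R: "0 < R" by (simp add: R_def)
    define T where "T = norm (trunc \<beta> (\<rho> 0) R (smoothed m \<Phi> b R 0) f x)"
    have d: "dseq (smoothed m \<Phi> b R)" by (rule dseq_smoothed[OF b R])
    have T: "ennreal T \<le> ennreal (c * R powr \<gamma>) * grand_max n f z" if z: "\<bar>z - x\<bar> < R" for z
    proof -
      have "ennreal T \<le> ennreal (pairing_const n * (2 ^ Suc n * ((1 + \<bar>\<beta>\<bar>) ^ (n + 2) * (C1 * R powr (\<gamma> - 1))) * bump_const n \<rho>) * R) * grand_max n f z"
        unfolding T_def
      proof (rule trunc_single[OF d bump R _ z])
        fix k z assume k: "k \<le> Suc n" and z: "\<bar>z - x\<bar> \<le> \<bar>\<beta>\<bar> * R"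
        have "norm (smoothed m \<Phi> b R (Suc k) z) \<le> C (Suc k) * R powr (\<gamma> - real (Suc k))"
          unfolding R_def by (rule C(2)) (use k z in \<open>auto simp: R_def\<close>)
        also have "\<dots> \<le> C1 * R powr (\<gamma> - real (Suc k))" using k by (intro mult_right_mono C1) auto
        finally have "norm (smoothed m \<Phi> b R (Suc k) z) * R ^ k \<le> C1 * R powr (\<gamma> - real (Suc k)) * R ^ k"
          using R by (intro mult_right_mono) auto
        also have "\<dots> = C1 * (R powr (\<gamma> - real (Suc k)) * R powr (real k))" using R by (simp add: powr_realpow)
        also have "R powr (\<gamma> - real (Suc k)) * R powr (real k) = R powr (\<gamma> - 1)" unfolding powr_add[symmetric] by simp
        finally show "norm (smoothed m \<Phi> b R (Suc k) z) * R ^ k \<le> C1 * R powr (\<gamma> - 1)" .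
      qed
      also have "pairing_const n * (2 ^ Suc n * ((1 + \<bar>\<beta>\<bar>) ^ (n + 2) * (C1 * R powr (\<gamma> - 1))) * bump_const n \<rho>) * R = c * R powr \<gamma>"
        using R by (simp add: c_def powr_diff)
      finally show ?thesis .
    qed
    have "T powr q * (2 * R) \<le> (c * R powr \<gamma>) powr q * X"
    proof -
      have "ennreal (T powr q * (2 * R)) = (\<integral>\<^sup>+z. epowr (ennreal T) q * indicator (ball x R) z \<partial>lborel)"
        using R by (simp add: nn_integral_cmult ball_eq_greaterThanLessThan epowr_ennreal T_def ennreal_mult[symmetric])
      also have "\<dots> \<le> (\<integral>\<^sup>+z. ennreal ((c * R powr \<gamma>) powr q) * epowr (grand_max n f z) q \<partial>lborel)"
      proof (rule nn_integral_mono)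
        fix z
        show "epowr (ennreal T) q * indicator (ball x R) z \<le> ennreal ((c * R powr \<gamma>) powr q) * epowr (grand_max n f z) q"
        proof (cases "z \<in> ball x R")
          case True
          then have "\<bar>z - x\<bar> < R" by (simp add: dist_real_def abs_minus_commute)
          from epowr_mono[OF _ T[OF this], of q] q True show ?thesis
            using c by (simp add: epowr_mult epowr_ennreal)
        qed simp
      qed
      also have "\<dots> = ennreal ((c * R powr \<gamma>) powr q) * ennreal X"
        unfolding X(1)[symmetric]
        by (rule nn_integral_cmult) measurable
      finally show ?thesis using X by (simp add: ennreal_mult[symmetric] ennreal_le_iff)
    qed
    then have "T powr q \<le> (c * R powr \<gamma>) powr q * X / R"
    proof -
      have "T powr q * R \<le> T powr q * (2 * R)" using R by (intro mult_left_mono) auto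
      then have "T powr q * R \<le> (c * R powr \<gamma>) powr q * X"
        using \<open>T powr q * (2 * R) \<le> _\<close> by (rule order_trans)
      then show ?thesis using R by (simp add: pos_le_divide_eq)
    qed
    then have "(T powr q) powr (1 / q) \<le> ((c * R powr \<gamma>) powr q * X / R) powr (1 / q)"
      using q by (intro powr_mono2) auto
    then have "T \<le> c * R powr \<gamma> * X powr (1 / q) / R powr (1 / q)"
      using q X c R by (simp add: powr_powr powr_mult powr_divide T_def)
    also have "\<dots> = c * X powr (1 / q) * R powr (\<gamma> - 1 / q)" by (simp add: powr_diff)
    also have "R powr (\<gamma> - 1 / q) = (2 powr (\<gamma> - 1 / q)) ^ L"
    proof -
      have "R powr (\<gamma> - 1 / q) = (2 powr real L) powr (\<gamma> - 1 / q)" by (simp add: R_def powr_realpow)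
      also have "\<dots> = (2 powr (\<gamma> - 1 / q)) powr real L" by (simp only: powr_powr mult.commute)
      also have "\<dots> = (2 powr (\<gamma> - 1 / q)) ^ L" by (rule powr_realpow) simp
      finally show ?thesis .
    qed
    finally show ?thesis by (simp add: T_def R_def)
  qed
  have "norm (2 powr (\<gamma> - 1 / q)) < 1" using \<gamma> by (simp add: powr_less_one)
  from tendsto_mult_left[OF LIMSEQ_power_zero[OF this], of "c * X powr (1 / q)"]
  have lim: "(\<lambda>L. c * X powr (1 / q) * (2 powr (\<gamma> - 1 / q)) ^ L) \<longlonglongrightarrow> 0" by simp
  show ?thesis
    by (rule Lim_null_comparison[OF always_eventually lim]) (rule allI, rule bound)
qed

end

lemma C1_lipschitz:
  fixes g :: "real \<Rightarrow> complex"
  assumes "\<And>x. (g has_vector_derivative g' x) (at x)" "continuous_on UNIV g'"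
  obtains L where "0 \<le> L" "\<And>y z. \<bar>y\<bar> \<le> T \<Longrightarrow> \<bar>z\<bar> \<le> T \<Longrightarrow> norm (g y - g z) \<le> L * \<bar>y - z\<bar>"
proof -
  have "bounded (g' ` {-T..T})"
    by (intro compact_imp_bounded compact_continuous_image continuous_on_subset[OF assms(2)]) auto
  then obtain B where "\<forall>y\<in>g' ` {-T..T}. norm y \<le> B" unfolding bounded_iff by blast
  then have B: "norm (g' x) \<le> B" if "x \<in> {-T..T}" for x using that by blast
  show thesis
  proof (rule that[of "max B 0"])
    fix y z assume yz: "\<bar>y\<bar> \<le> T" "\<bar>z\<bar> \<le> T"
    have "norm (g y - g z) \<le> max B 0 * norm (y - z)"
    proof (rule differentiable_bound[where S="{-T..T}" and f'="\<lambda>x t. t *\<^sub>R g' x"])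
      fix x assume x: "x \<in> {-T..T}"
      show "(g has_derivative (\<lambda>t. t *\<^sub>R g' x)) (at x within {-T..T})"
        using has_vector_derivative_at_within[OF assms(1)] by (simp add: has_vector_derivative_def)
      have "norm (g' x) \<le> max B 0" using B[OF x] by simp
      then show "onorm (\<lambda>t. t *\<^sub>R g' x) \<le> max B 0"
        by (intro onorm_le, simp, subst mult.commute) (intro mult_right_mono abs_ge_zero)
    qed (use yz in auto)
    then show "norm (g y - g z) \<le> max B 0 * \<bar>y - z\<bar>" by simp
  qed simp
qed

lemma trunc_integrable_C1:
  assumes "unit_bump \<rho>" "continuous_on UNIV f" "0 < R"
    and g: "\<And>x. (g has_vector_derivative g' x) (at x)" "continuous_on UNIV g'"
  shows "integrable lborel (\<lambda>s. dq \<beta> g x s * of_real (\<rho> 0 ((s - x) / R)) * f s)"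
proof -
  obtain L where L: "0 \<le> L" "\<And>y z. \<bar>y\<bar> \<le> \<bar>x\<bar> + \<bar>\<beta>\<bar> * R \<Longrightarrow> \<bar>z\<bar> \<le> \<bar>x\<bar> + \<bar>\<beta>\<bar> * R \<Longrightarrow> norm (g y - g z) \<le> L * \<bar>y - z\<bar>"
    by (rule C1_lipschitz[OF g, where T="\<bar>x\<bar> + \<bar>\<beta>\<bar> * R"]) blast
  have "continuous_on UNIV g"
    using g(1) by (meson continuous_on_vector_derivative has_vector_derivative_at_within)
  then show ?thesis by (rule trunc_integrable[OF assms(1-3) _ L(2) order_refl L(1)])
qed

lemma sum_le_isum:
  assumes "finite A" shows "sum F A \<le> isum F"
proof -
  have "sum F A = (\<integral>\<^sup>+k. F k * indicator A k \<partial>count_space UNIV)"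
    by (subst nn_integral_count_space'[OF assms]) auto
  also have "\<dots> \<le> isum F" by (intro nn_integral_mono) (auto simp: indicator_def)
  finally show ?thesis .
qed

text \<open>The telescoping sum runs over the scales \<open>2 powr j\<close> with j from -J to L -
  1, and the cut-off radius is tied to the coarsest one, \<open>R = 2 ^ L\<close>. For fixed
  \<open>L\<close> the fine remainder vanishes as \<open>J\<close> grows; then the coarse term
  vanishes as \<open>L\<close> grows. The pieces between are bounded by the sum over all scales,
  independently of \<open>J\<close> and \<open>L\<close>.\<close>

lemma (in smoothing) H_op_pointwise:
  assumes m\<alpha>: "real m \<le> \<alpha> + 1"
  shows "\<exists>C\<ge>0. \<forall>b b' A \<beta> f x q. (\<forall>x. (b has_vector_derivative b' x) (at x)) \<longrightarrow> continuous_on UNIV b' \<longrightarrow>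
     (\<forall>t y. norm ((fwd_diff t ^^ m) b y) \<le> A * \<bar>t\<bar> powr \<alpha>) \<longrightarrow> 0 \<le> A \<longrightarrow> continuous_on UNIV f \<longrightarrow>
     0 < q \<longrightarrow> \<alpha> < 1 / q \<longrightarrow> (\<integral>\<^sup>+x. epowr (grand_max n f x) q \<partial>lborel) < top \<longrightarrow>
     integrable lborel (H_integrand \<beta> b f x) \<longrightarrow>
     ennreal (norm (H_op \<beta> b f x)) \<le> ennreal (C * A * (1 + \<bar>\<beta>\<bar>) ^ (n + 2)) *
       isum (\<lambda>j. \<integral>\<^sup>+u. ennreal (kern \<alpha> j (x - u)) * level_sum (grand_max n f) (2 powr real_of_int j) u \<partial>lborel)"
proof -
  obtain \<rho> where bump: "unit_bump \<rho>" and \<rho>0: "0 < \<rho> 0 0" by (rule unit_bump_exists)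
  obtain C2 where C2: "0 \<le> C2" "\<And>b b' A h k y. (\<forall>x. (b has_vector_derivative b' x) (at x)) \<Longrightarrow> continuous_on UNIV b' \<Longrightarrow>
     (\<forall>t y. norm ((fwd_diff t ^^ m) b y) \<le> A * \<bar>t\<bar> powr \<alpha>) \<Longrightarrow> 0 < h \<Longrightarrow> 0 \<le> A \<Longrightarrow> k \<le> n + 2 \<Longrightarrow>
     norm (smoothed m \<Phi> b h k y - smoothed m \<Phi> b (2 * h) k y) * h ^ k \<le> C2 * A * h powr \<alpha>"
    using smoothed_difference[of "n + 2"] by blast
  define c where "c = pairing_const n * (2 ^ Suc n * (2 ^ Suc n * real (n + 4) * bump_const n \<rho> * 2) * bump_const n \<rho>)"
  have c: "0 \<le> c" using bump_const(1)[OF bump, of n] by (simp add: c_def pairing_const_def)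
  show ?thesis
  proof (intro exI[of _ "c * C2 / \<rho> 0 0"] conjI allI impI)
    show "0 \<le> c * C2 / \<rho> 0 0" using c C2 \<rho>0 by simp
    fix b b' :: "real \<Rightarrow> complex" and A \<beta> :: real and f :: "real \<Rightarrow> complex" and x q :: real
    assume b: "\<forall>x. (b has_vector_derivative b' x) (at x)" "continuous_on UNIV b'"
      and A: "\<forall>t y. norm ((fwd_diff t ^^ m) b y) \<le> A * \<bar>t\<bar> powr \<alpha>" "0 \<le> A"
      and f: "continuous_on UNIV f" and q: "0 < q" "\<alpha> < 1 / q"
      and fin: "(\<integral>\<^sup>+x. epowr (grand_max n f x) q \<partial>lborel) < top"
      and int: "integrable lborel (H_integrand \<beta> b f x)"
    have bd: "\<And>x. (b has_vector_derivative b' x) (at x)" using b by blast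
    have bc: "continuous_on UNIV b"
      using bd by (meson continuous_on_vector_derivative has_vector_derivative_at_within)
    define s where "s j = smoothed m \<Phi> b (2 powr real_of_int j)" for j :: int
    have ds: "dseq (s j)" for j unfolding s_def by (rule dseq_smoothed[OF bd b(2)]) simp
    define v where "v j k y = s j k y - s (j + 1) k y" for j k y
    have dv: "dseq (v j)" for j unfolding v_def[abs_def] by (intro dseq_diff ds)
    define F where "F j = (\<integral>\<^sup>+u. ennreal (kern \<alpha> j (x - u)) * level_sum (grand_max n f) (2 powr real_of_int j) u \<partial>lborel)" for j
    define a where "a = c * C2 * A * (1 + \<bar>\<beta>\<bar>) ^ (n + 2)"
    have a: "0 \<le> a" using c C2 A by (simp add: a_def)
    have tv: "ennreal (norm (trunc \<beta> (\<rho> 0) R (v j 0) f x)) \<le> ennreal a * F j" if R: "2 powr real_of_int j \<le> R" for j R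
    proof -
      define h where "h = 2 powr real_of_int j"
      have h: "0 < h" by (simp add: h_def)
      have "s (j + 1) = smoothed m \<Phi> b (2 * h)" by (simp add: s_def h_def powr_add mult.commute)
      then have vb: "norm (v j k y) * h ^ k \<le> C2 * A * h powr \<alpha>" if "k \<le> n + 2" for k y
        using C2(2)[OF b A(1) h A(2) that, of y] by (simp add: v_def s_def h_def)
      have "ennreal (norm (trunc \<beta> (\<rho> 0) R (v j 0) f x)) \<le>
        (\<integral>\<^sup>+u. ennreal (c * (1 + \<bar>\<beta>\<bar>) ^ (n + 2) * (C2 * A * h powr \<alpha> / (h + \<bar>x - u\<bar>))) * level_sum (grand_max n f) h u \<partial>lborel)"
        unfolding c_def by (rule trunc_multi[OF dv bump h _ vb f]) (use R in \<open>simp_all add: h_def\<close>)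
      also have "\<dots> = (\<integral>\<^sup>+u. ennreal a * (ennreal (kern \<alpha> j (x - u)) * level_sum (grand_max n f) (2 powr real_of_int j) u) \<partial>lborel)"
      proof (rule nn_integral_cong)
        fix u
        have "c * (1 + \<bar>\<beta>\<bar>) ^ (n + 2) * (C2 * A * h powr \<alpha> / (h + \<bar>x - u\<bar>)) = a * kern \<alpha> j (x - u)"
          by (simp add: a_def kern_def h_def)
        then show "ennreal (c * (1 + \<bar>\<beta>\<bar>) ^ (n + 2) * (C2 * A * h powr \<alpha> / (h + \<bar>x - u\<bar>))) * level_sum (grand_max n f) h u
          = ennreal a * (ennreal (kern \<alpha> j (x - u)) * level_sum (grand_max n f) (2 powr real_of_int j) u)"
          using a by (simp add: ennreal_mult h_def mult.assoc)
      qed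
      also have "\<dots> = ennreal a * F j"
        unfolding F_def level_sum_def by (rule nn_integral_cmult) measurable
      finally show ?thesis .
    qed
    show "ennreal (norm (H_op \<beta> b f x)) \<le> ennreal (c * C2 / \<rho> 0 0 * A * (1 + \<bar>\<beta>\<bar>) ^ (n + 2)) * isum F"
    \<comment> \<open>An infinite right-hand side leaves nothing to prove; otherwise
      \<open>t\<close> is a real bound for all partial sums.\<close>
    proof (cases "ennreal a * isum F = top")
      case True
      have "ennreal (c * C2 / \<rho> 0 0 * A * (1 + \<bar>\<beta>\<bar>) ^ (n + 2)) * isum F = ennreal (1 / \<rho> 0 0) * (ennreal a * isum F)"
        using \<rho>0 a by (simp add: mult.assoc[symmetric] ennreal_mult[symmetric] a_def)
      also have "\<dots> = top" using True \<rho>0 by (simp add: ennreal_mult_top)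
      finally show ?thesis by simp
    next
      case False
      then obtain t where t: "ennreal a * isum F = ennreal t" "0 \<le> t" by (cases "ennreal a * isum F") auto
      have main: "norm (trunc \<beta> (\<rho> 0) (2 ^ L) b f x) \<le> norm (trunc \<beta> (\<rho> 0) (2 ^ L) (smoothed m \<Phi> b (2 ^ L) 0) f x) + t" for L :: nat
      proof -
        define R :: real where "R = 2 ^ L"
        have R: "0 < R" by (simp add: R_def)
        \<comment> \<open>The remainder at the finest scale. It is no smoother than
          \<open>b\<close>, so it is removed by dominated convergence and not by pairing with the
          maximal function.\<close>
        define g where "g J y = b y - s (- int J) 0 y" for J :: nat and y
        have gd: "((g J) has_vector_derivative (b' y - s (- int J) 1 y)) (at y)" for J y
          unfolding g_def using dseqD[OF ds, of "- int J" 0 y UNIV] bd[of y] by (auto intro!: has_vector_derivative_diff)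
        have gc': "continuous_on UNIV (\<lambda>y. b' y - s (- int J) 1 y)" for J
          by (intro continuous_on_diff b(2) dseq_continuous[OF ds])
        have gc: "continuous_on UNIV (g J)" for J
          unfolding g_def[abs_def] by (intro continuous_on_diff bc dseq_continuous[OF ds])
        note tint = trunc_integrable_C1[OF bump f R]
        have sint: "integrable lborel (\<lambda>y. dq \<beta> (D 0) x y * of_real (\<rho> 0 ((y - x) / R)) * f y)" if "dseq D" for D
          by (rule tint[where g'="D 1"]) (use dseqD[OF that, of 0 _ UNIV] dseq_continuous[OF that] in auto)
        have step: "norm (trunc \<beta> (\<rho> 0) R b f x) \<le> norm (trunc \<beta> (\<rho> 0) R (s (int L) 0) f x) + t + norm (trunc \<beta> (\<rho> 0) R (g J) f x)" for J
        proof -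
          \<comment> \<open>The index is shifted so that a sum over natural numbers covers the
            scales from \<open>- J\<close> up to just below \<open>L\<close>.\<close>
          define w where "w i = v (int i - int J)" for i :: nat
          have tele: "b y = (s (int L) 0 y + (\<Sum>i<J + L. w i 0 y)) + g J y" for y
          proof -
            have "(\<Sum>i<J + L. w i 0 y) = (\<Sum>i<J + L. s (int i - int J) 0 y - s (int (Suc i) - int J) 0 y)"
              by (rule sum.cong) (auto simp: w_def v_def algebra_simps)
            also have "\<dots> = s (- int J) 0 y - s (int L) 0 y"
              by (subst sum_lessThan_telescope') simp
            finally show ?thesis by (simp add: g_def)
          qed
          define q where "q g s = dq \<beta> g x s * of_real (\<rho> 0 ((s - x) / R)) * f s" for g s
          have wi: "integrable lborel (q (w i 0))" for i unfolding q_def w_def by (rule sint[OF dv])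
          have "q b y = (q (s (int L) 0) y + (\<Sum>i<J + L. q (w i 0) y)) + q (g J) y" for y
          proof -
            have "dq \<beta> b x y = dq \<beta> (\<lambda>y. (s (int L) 0 y + (\<Sum>i<J + L. w i 0 y)) + g J y) x y"
              using tele by (simp add: dq_def)
            also have "\<dots> = (dq \<beta> (s (int L) 0) x y + (\<Sum>i<J + L. dq \<beta> (w i 0) x y)) + dq \<beta> (g J) x y"
              by (simp only: dq_add dq_sum)
            finally show ?thesis by (simp add: q_def distrib_right sum_distrib_right)
          qed
          then have "trunc \<beta> (\<rho> 0) R b f x = (LINT y|lborel. (q (s (int L) 0) y + (\<Sum>i<J + L. q (w i 0) y)) + q (g J) y)"
            unfolding trunc_def q_def[symmetric] by simp
          also have "\<dots> = (LINT y|lborel. q (s (int L) 0) y) + (\<Sum>i<J + L. LINT y|lborel. q (w i 0) y) + (LINT y|lborel. q (g J) y)"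
          proof -
            have i1: "integrable lborel (q (s (int L) 0))" unfolding q_def by (rule sint[OF ds])
            have i2: "integrable lborel (\<lambda>y. \<Sum>i<J + L. q (w i 0) y)" by (intro Bochner_Integration.integrable_sum wi)
            have i3: "integrable lborel (q (g J))" unfolding q_def by (rule tint[OF gd gc'])
            show ?thesis
              by (subst Bochner_Integration.integral_add[OF Bochner_Integration.integrable_add[OF i1 i2] i3],
                  subst Bochner_Integration.integral_add[OF i1 i2], subst Bochner_Integration.integral_sum) (auto intro: wi)
          qed
          also have "\<dots> = trunc \<beta> (\<rho> 0) R (s (int L) 0) f x + (\<Sum>i<J + L. trunc \<beta> (\<rho> 0) R (w i 0) f x) + trunc \<beta> (\<rho> 0) R (g J) f x"
            by (simp add: trunc_def q_def)
          finally have "norm (trunc \<beta> (\<rho> 0) R b f x) \<le> norm (trunc \<beta> (\<rho> 0) R (s (int L) 0) f x) + (\<Sum>i<J + L. norm (trunc \<beta> (\<rho> 0) R (w i 0) f x)) + norm (trunc \<beta> (\<rho> 0) R (g J) f x)"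
            using norm_sum[of "\<lambda>i. trunc \<beta> (\<rho> 0) R (w i 0) f x" "{..<J + L}"] by (auto intro!: norm_triangle_mono)
          moreover have "(\<Sum>i<J + L. norm (trunc \<beta> (\<rho> 0) R (w i 0) f x)) \<le> t"
          proof -
            have "ennreal (\<Sum>i<J + L. norm (trunc \<beta> (\<rho> 0) R (w i 0) f x)) = (\<Sum>i<J + L. ennreal (norm (trunc \<beta> (\<rho> 0) R (w i 0) f x)))"
              by (rule sum_ennreal[symmetric]) simp
            also have "\<dots> \<le> (\<Sum>i<J + L. ennreal a * F (int i - int J))"
            proof (rule sum_mono)
              fix i assume "i \<in> {..<J + L}"
              then have "2 powr real_of_int (int i - int J) \<le> 2 powr real L" by (intro powr_mono) auto
              also have "\<dots> = R" by (simp add: R_def powr_realpow)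
              finally show "ennreal (norm (trunc \<beta> (\<rho> 0) R (w i 0) f x)) \<le> ennreal a * F (int i - int J)"
                unfolding w_def by (rule tv)
            qed
            also have "\<dots> = ennreal a * sum F ((\<lambda>i. int i - int J) ` {..<J + L})"
              by (subst sum.reindex) (auto simp: inj_on_def sum_distrib_left)
            also have "\<dots> \<le> ennreal a * isum F" by (intro mult_left_mono sum_le_isum) auto
            finally show ?thesis using t by (simp add: ennreal_le_iff)
          qed
          ultimately show ?thesis by linarith
        qed
        have "(\<lambda>J. trunc \<beta> (\<rho> 0) R (g J) f x) \<longlonglongrightarrow> 0"
        proof -
          define T where "T = \<bar>x\<bar> + \<bar>\<beta>\<bar> * R"
          obtain L0 where L0: "0 \<le> L0" "\<And>y z. \<bar>y\<bar> \<le> T + real m * r \<Longrightarrow> \<bar>z\<bar> \<le> T + real m * r \<Longrightarrow> norm (b y - b z) \<le> L0 * \<bar>y - z\<bar>"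
            by (rule C1_lipschitz[OF bd b(2), where T="T + real m * r"]) blast
          \<comment> \<open>The Lipschitz constants of \<open>b\<close> and of its mollification
            added up; \<open>L0\<close> is taken on an interval enlarged by the reach
            \<open>m * r\<close> of the mollifier.\<close>
          define L1 where "L1 = L0 + 2 ^ m * (LINT u|lborel. \<bar>\<Phi> 0 u\<bar>) * L0"
          show ?thesis
          proof (rule trunc_tendsto_0[OF bump f R gc, where L=L1 and T=T])
            fix J y z assume yz: "\<bar>y\<bar> \<le> T" "\<bar>z\<bar> \<le> T"
            have "2 powr real_of_int (- int J) \<le> 2 powr 0" by (intro powr_mono) auto
            then have J1: "2 powr real_of_int (- int J) \<le> 1" by simp
            have 1: "norm (s (- int J) 0 y - s (- int J) 0 z) \<le> 2 ^ m * (LINT u|lborel. \<bar>\<Phi> 0 u\<bar>) * L0 * \<bar>y - z\<bar>"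
              unfolding s_def by (rule smoothed_lipschitz[OF bc _ J1 L0(2) yz]) auto
            have 2: "norm (b y - b z) \<le> L0 * \<bar>y - z\<bar>"
              using yz r by (intro L0) (auto simp: add_increasing2)
            have "norm (g J y - g J z) = norm ((b y - b z) - (s (- int J) 0 y - s (- int J) 0 z))" by (simp add: g_def algebra_simps)
            also have "\<dots> \<le> norm (b y - b z) + norm (s (- int J) 0 y - s (- int J) 0 z)" by (rule norm_triangle_ineq4)
            also have "\<dots> \<le> L0 * \<bar>y - z\<bar> + 2 ^ m * (LINT u|lborel. \<bar>\<Phi> 0 u\<bar>) * L0 * \<bar>y - z\<bar>" by (rule add_mono[OF 2 1])
            finally show "norm (g J y - g J z) \<le> L1 * \<bar>y - z\<bar>" by (simp only: L1_def distrib_right)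
          next
            fix y
            define K where "K = (LINT u|lborel. \<bar>\<Phi> 0 u\<bar>) * (A * r powr \<alpha>)"
            have gl: "norm (g J y) \<le> K * (2 powr (- \<alpha>)) ^ J" for J
            proof -
              have "norm (g J y) \<le> (LINT u|lborel. \<bar>\<Phi> 0 u\<bar>) * (A * (r * 2 powr real_of_int (- int J)) powr \<alpha>)"
                unfolding g_def s_def by (rule smoothed_approx[OF bc _ _ A(2)]) (use A in auto)
              also have "(r * 2 powr real_of_int (- int J)) powr \<alpha> = r powr \<alpha> * (2 powr (- \<alpha>)) ^ J"
                using r by (simp add: powr_mult powr_powr powr_power mult.commute)
              finally show ?thesis by (simp add: K_def mult.assoc)
            qed
            have lim: "(\<lambda>J. K * (2 powr (- \<alpha>)) ^ J) \<longlonglongrightarrow> 0"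
            proof -
              have "norm (2 powr (- \<alpha>)) < 1" using \<alpha> by (simp add: powr_less_one)
              from tendsto_mult_left[OF LIMSEQ_power_zero[OF this], of K] show ?thesis by simp
            qed
            show "(\<lambda>J. g J y) \<longlonglongrightarrow> 0"
              by (rule Lim_null_comparison[OF always_eventually lim]) (rule allI, rule gl)
          next
            show "0 \<le> L1" unfolding L1_def using L0 by (intro add_nonneg_nonneg mult_nonneg_nonneg) auto
          qed (simp add: T_def)
        qed
        then have "(\<lambda>J. norm (trunc \<beta> (\<rho> 0) R (s (int L) 0) f x) + t + norm (trunc \<beta> (\<rho> 0) R (g J) f x)) \<longlonglongrightarrow> norm (trunc \<beta> (\<rho> 0) R (s (int L) 0) f x) + t + 0"
          by (intro tendsto_add tendsto_const tendsto_norm_zero)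
        then have "norm (trunc \<beta> (\<rho> 0) R b f x) \<le> norm (trunc \<beta> (\<rho> 0) R (s (int L) 0) f x) + t + 0"
          by (rule LIMSEQ_le_const) (use step in blast)
        moreover have "s (int L) = smoothed m \<Phi> b (2 ^ L)" by (simp add: s_def powr_realpow)
        ultimately show ?thesis by (simp add: R_def)
      qed
      have "(\<lambda>L. norm (trunc \<beta> (\<rho> 0) (2 ^ L) (smoothed m \<Phi> b (2 ^ L) 0) f x) + t) \<longlonglongrightarrow> 0 + t"
        by (intro tendsto_add tendsto_const tendsto_norm_zero trunc_smoothed_tendsto_0[OF bd b(2) _ A(2) m\<alpha> q bump fin]) (use A in blast)
      moreover have "(\<lambda>L. norm (trunc \<beta> (\<rho> 0) (2 ^ L) b f x)) \<longlonglongrightarrow> norm (of_real (\<rho> 0 0) * H_op \<beta> b f x)"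
        by (intro tendsto_norm trunc_tendsto_H_op[OF bump int])
      ultimately have "norm (of_real (\<rho> 0 0) * H_op \<beta> b f x) \<le> 0 + t"
        using main by (intro LIMSEQ_le) auto
      then have "norm (H_op \<beta> b f x) \<le> 1 / \<rho> 0 0 * t" using \<rho>0 by (simp add: norm_mult field_simps)
      then have "ennreal (norm (H_op \<beta> b f x)) \<le> ennreal (1 / \<rho> 0 0) * (ennreal a * isum F)"
        unfolding t(1) using \<rho>0 t(2) by (subst ennreal_mult[symmetric]) (auto intro: ennreal_leI)
      also have "\<dots> = ennreal (c * C2 / \<rho> 0 0 * A * (1 + \<bar>\<beta>\<bar>) ^ (n + 2)) * isum F"
        using \<rho>0 a by (simp add: mult.assoc[symmetric] ennreal_mult[symmetric] a_def)
      finally show ?thesis .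
    qed
  qed
qed

subsection \<open>Fractional integrals\<close>

text \<open>On the k-th dyadic shell the kernel is at most its value at the inner radius
  \<open>2 powr k\<close>. The shell is closed at the outer radius, so the open ball is taken twice
  as large.\<close>

lemma riesz_dyadic_bound:
  fixes g :: "real \<Rightarrow> ennreal"
  assumes g[measurable]: "g \<in> borel_measurable borel" and \<alpha>: "\<alpha> < 1"
  shows "(\<integral>\<^sup>+s. ennreal (\<bar>x - s\<bar> powr (\<alpha> - 1)) * g s \<partial>lborel)
    \<le> isum (\<lambda>k. ennreal ((2 powr real_of_int k) powr (\<alpha> - 1)) * (\<integral>\<^sup>+y. g y * indicator (ball x (4 * 2 powr real_of_int k)) y \<partial>lborel))"
proof -
  have [measurable]: "ball x d \<in> sets borel" for d by (rule borel_open[OF open_ball])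
  have "(\<integral>\<^sup>+s. ennreal (\<bar>x - s\<bar> powr (\<alpha> - 1)) * g s \<partial>lborel) \<le>
    (\<integral>\<^sup>+s. isum (\<lambda>k. ennreal ((2 powr real_of_int k) powr (\<alpha> - 1)) * (g s * indicator (ball x (4 * 2 powr real_of_int k)) s)) \<partial>lborel)"
  proof (rule nn_integral_mono_AE, use AE_lborel_singleton[of x] in eventually_elim)
    fix s assume "s \<noteq> x"
    then have "0 < \<bar>x - s\<bar>" by simp
    then obtain k :: int where k: "2 powr real_of_int k < \<bar>x - s\<bar>" "\<bar>x - s\<bar> \<le> 2 powr (real_of_int k + 1)"
      by (rule dyadic_level)
    have "\<bar>x - s\<bar> \<le> 2 * 2 powr real_of_int k" using k(2) by (simp add: powr_add)
    moreover have "(0::real) < 2 powr real_of_int k" by simp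
    ultimately have "s \<in> ball x (4 * 2 powr real_of_int k)" unfolding mem_ball dist_real_def by linarith
    moreover have "\<bar>x - s\<bar> powr (\<alpha> - 1) \<le> (2 powr real_of_int k) powr (\<alpha> - 1)"
      using k \<alpha> by (intro powr_mono2') auto
    ultimately have "ennreal (\<bar>x - s\<bar> powr (\<alpha> - 1)) * g s \<le> ennreal ((2 powr real_of_int k) powr (\<alpha> - 1)) * (g s * indicator (ball x (4 * 2 powr real_of_int k)) s)"
      by (simp add: mult_right_mono ennreal_leI)
    also have "\<dots> \<le> isum (\<lambda>k. ennreal ((2 powr real_of_int k) powr (\<alpha> - 1)) * (g s * indicator (ball x (4 * 2 powr real_of_int k)) s))"
      by (rule nn_integral_ge_point) simp
    finally show "ennreal (\<bar>x - s\<bar> powr (\<alpha> - 1)) * g s \<le> \<dots>" .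
  qed
  also have "\<dots> = isum (\<lambda>k. ennreal ((2 powr real_of_int k) powr (\<alpha> - 1)) * (\<integral>\<^sup>+y. g y * indicator (ball x (4 * 2 powr real_of_int k)) y \<partial>lborel))"
    by (subst isum_nn_integral, measurable) (simp add: nn_integral_cmult)
  finally show ?thesis .
qed

text \<open>Hoelder's inequality, as \<open>power_mean\<close> with the indicator of the ball for
  weight.\<close>

lemma holder_ball:
  fixes g :: "real \<Rightarrow> ennreal"
  assumes g[measurable]: "g \<in> borel_measurable borel" and q: "1 < q" and r: "0 < r"
    and N: "(\<integral>\<^sup>+x. epowr (g x) q \<partial>lborel) = ennreal N" "0 \<le> N"
  shows "(\<integral>\<^sup>+y. g y * indicator (ball x r) y \<partial>lborel) \<le> ennreal ((2 * r) powr (1 - 1 / q) * N powr (1 / q))"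
proof -
  have [measurable]: "ball x d \<in> sets borel" for d by (rule borel_open[OF open_ball])
  define I where "I = (\<integral>\<^sup>+y. indicator (ball x r) y * g y \<partial>lborel)"
  have "epowr I q \<le> ennreal ((2 * r) powr (q - 1)) * (\<integral>\<^sup>+y. indicator (ball x r) y * epowr (g y) q \<partial>lborel)"
    unfolding I_def
  proof (rule power_mean)
    have "(\<integral>\<^sup>+y. indicator (ball x r) y \<partial>lborel) = emeasure lborel (ball x r)" by simp
    also have "\<dots> = ennreal (2 * r)" using r by (simp add: ball_eq_greaterThanLessThan)
    finally show "(\<integral>\<^sup>+y. indicator (ball x r) y \<partial>lborel) \<le> ennreal (2 * r)" by simp
  qed (use r q in auto)
  also have "\<dots> \<le> ennreal ((2 * r) powr (q - 1)) * (\<integral>\<^sup>+y. epowr (g y) q \<partial>lborel)"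
    by (intro mult_left_mono nn_integral_mono) (auto simp: indicator_def)
  also have "\<dots> = ennreal ((2 * r) powr (q - 1) * N)" using N by (simp add: ennreal_mult)
  finally have "epowr (epowr I q) (1 / q) \<le> epowr (ennreal ((2 * r) powr (q - 1) * N)) (1 / q)"
    using q by (intro epowr_mono) auto
  moreover have "((2 * r) powr (q - 1) * N) powr (1 / q) = (2 * r) powr (1 - 1 / q) * N powr (1 / q)"
    using q N by (simp add: powr_mult powr_powr field_simps)
  ultimately show ?thesis using q N by (simp add: epowr_epowr epowr_ennreal I_def mult.commute)
qed

lemma hl_max_cmult:
  assumes [measurable]: "g \<in> borel_measurable borel"
  shows "hl_max (\<lambda>y. c * g y) x = c * hl_max g x"
proof -
  have [measurable]: "ball x d \<in> sets borel" for d by (rule borel_open[OF open_ball])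
  have "ennreal (1 / (2 * r)) * (\<integral>\<^sup>+y. c * g y * indicator (ball x r) y \<partial>lborel) = c * (ennreal (1 / (2 * r)) * (\<integral>\<^sup>+y. g y * indicator (ball x r) y \<partial>lborel))" for r
  proof -
    have "(\<integral>\<^sup>+y. c * g y * indicator (ball x r) y \<partial>lborel) = c * (\<integral>\<^sup>+y. g y * indicator (ball x r) y \<partial>lborel)"
      unfolding mult.assoc by (rule nn_integral_cmult) measurable
    then show ?thesis by (simp only: mult.left_commute)
  qed
  then show ?thesis unfolding hl_max_def by (simp add: SUP_mult_left_ennreal)
qed

text \<open>Hedberg's argument: small scales are controlled by the maximal function, large ones by the
  \<open>L\<^sup>q\<close> norm.\<close>

lemma riesz_Lp:
  assumes q: "1 < q" "q < p" and \<alpha>: "\<alpha> = 1 / q - 1 / p"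
  obtains C where "0 < C" "\<And>g. g \<in> borel_measurable borel \<Longrightarrow> (\<integral>\<^sup>+x. epowr (g x) q \<partial>lborel) < top \<Longrightarrow>
    (\<integral>\<^sup>+x. epowr (\<integral>\<^sup>+s. ennreal (\<bar>x - s\<bar> powr (\<alpha> - 1)) * g s \<partial>lborel) p \<partial>lborel)
      \<le> ennreal C * epowr (\<integral>\<^sup>+x. epowr (g x) q \<partial>lborel) (p / q)"
proof -
  have p: "1 < p" using q by simp
  have \<alpha>0: "0 < \<alpha>" "\<alpha> < 1" "\<alpha> + 1 / p = 1 / q"
  proof -
    show "0 < \<alpha>" using q by (simp add: \<alpha> frac_less2)
    have "1 / q < 1" "0 < 1 / p" using q by simp_all
    then show "\<alpha> < 1" unfolding \<alpha> by linarith
  qed (simp add: \<alpha>)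
  obtain CH where CH: "0 < CH" "\<And>g. g \<in> borel_measurable borel \<Longrightarrow>
    (\<integral>\<^sup>+x. epowr (hl_max g x) q \<partial>lborel) \<le> ennreal CH * (\<integral>\<^sup>+x. epowr (g x) q \<partial>lborel)"
    using hl_strong_type[OF q(1)] by metis
  have qa: "2 powr (- \<alpha>) < 1" "2 powr (- (1 / p)) < 1" using \<alpha>0 p by (auto intro!: powr_less_one)
  define K where "K = 8 * (1 / (1 - 2 powr (- \<alpha>)) + 1 / (1 - 2 powr (- (1 / p))))"
  have K: "0 < K" using qa by (simp add: K_def add_pos_pos)
  show thesis
  proof (rule that[of "K powr p * CH"])
    show "0 < K powr p * CH" using K CH by simp
    fix g :: "real \<Rightarrow> ennreal"
    assume g[measurable]: "g \<in> borel_measurable borel" and fin: "(\<integral>\<^sup>+x. epowr (g x) q \<partial>lborel) < top"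
    define N where "N = enn2real (\<integral>\<^sup>+x. epowr (g x) q \<partial>lborel)"
    have N: "(\<integral>\<^sup>+x. epowr (g x) q \<partial>lborel) = ennreal N" "0 \<le> N" using fin by (auto simp: N_def less_top)
    define I where "I x = (\<integral>\<^sup>+s. ennreal (\<bar>x - s\<bar> powr (\<alpha> - 1)) * g s \<partial>lborel)" for x
    show "(\<integral>\<^sup>+x. epowr (\<integral>\<^sup>+s. ennreal (\<bar>x - s\<bar> powr (\<alpha> - 1)) * g s \<partial>lborel) p \<partial>lborel)
      \<le> ennreal (K powr p * CH) * epowr (\<integral>\<^sup>+x. epowr (g x) q \<partial>lborel) (p / q)"
    proof (cases "N = 0")
      case True
      then have "AE x in lborel. epowr (g x) q = 0" using N by (subst nn_integral_0_iff_AE[symmetric]) auto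
      then have z: "AE s in lborel. g s = 0" by simp
      have "I x = (\<integral>\<^sup>+s. 0 \<partial>(lborel :: real measure))" for x
        unfolding I_def by (rule nn_integral_cong_AE) (use z in \<open>eventually_elim, simp\<close>)
      then show ?thesis unfolding I_def[symmetric] by simp
    next
      case False
      then have N0: "0 < N" using N by simp
      have pt: "epowr (I x) p \<le> ennreal (K powr p * N powr (\<alpha> * p)) * epowr (hl_max g x) q" for x
      proof (cases "hl_max g x")
        case top
        then show ?thesis using K N0 by (simp add: ennreal_mult_top)
      next
        case (real M)
        define B where "B k = (\<integral>\<^sup>+y. g y * indicator (ball x (4 * 2 powr real_of_int k)) y \<partial>lborel)" for k :: int
        have I_le: "I x \<le> isum (\<lambda>k. ennreal ((2 powr real_of_int k) powr (\<alpha> - 1)) * B k)"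
          unfolding I_def B_def by (rule riesz_dyadic_bound[OF g \<alpha>0(2)])
        have small: "ennreal ((2 powr real_of_int k) powr (\<alpha> - 1)) * B k \<le> ennreal (8 * M) * ennreal (2 powr (real_of_int k * \<alpha>))" for k
        proof -
          have "B k \<le> ennreal (2 * (4 * 2 powr real_of_int k)) * ennreal M"
            unfolding B_def real(2)[symmetric] by (rule hl_max_ge) simp
          then have "ennreal ((2 powr real_of_int k) powr (\<alpha> - 1)) * B k \<le> ennreal ((2 powr real_of_int k) powr (\<alpha> - 1)) * (ennreal (2 * (4 * 2 powr real_of_int k)) * ennreal M)"
            by (rule mult_left_mono) simp
          also have "\<dots> = ennreal ((2 powr real_of_int k) powr (\<alpha> - 1) * (2 * (4 * 2 powr real_of_int k) * M))"
            using real(1) by (simp add: ennreal_mult)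
          also have "(2 powr real_of_int k) powr (\<alpha> - 1) * (2 * (4 * 2 powr real_of_int k) * M) = 8 * M * 2 powr (real_of_int k * \<alpha>)"
          proof -
            have "(2 powr real_of_int k) powr (\<alpha> - 1) * 2 powr real_of_int k = 2 powr (real_of_int k * \<alpha>)"
              by (simp add: powr_powr powr_add[symmetric] algebra_simps)
            then show ?thesis by (simp add: mult_ac)
          qed
          finally show ?thesis using real(1) by (simp add: ennreal_mult)
        qed
        have large: "ennreal ((2 powr real_of_int k) powr (\<alpha> - 1)) * B k \<le> ennreal (8 * N powr (1 / q)) * ennreal (2 powr (- (real_of_int k * (1 / p))))" for k
        proof -
          have "B k \<le> ennreal ((2 * (4 * 2 powr real_of_int k)) powr (1 - 1 / q) * N powr (1 / q))"
            unfolding B_def by (rule holder_ball[OF g q(1) _ N]) simp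
          also have "(2 * (4 * 2 powr real_of_int k)) powr (1 - 1 / q) \<le> 8 * (2 powr real_of_int k) powr (1 - 1 / q)"
          proof -
            have "(8::real) powr (1 - 1 / q) \<le> 8 powr 1" using q by (intro powr_mono) auto
            moreover have "(2 * (4 * 2 powr real_of_int k)) powr (1 - 1 / q) = 8 powr (1 - 1 / q) * (2 powr real_of_int k) powr (1 - 1 / q)"
              by (simp add: powr_mult[symmetric])
            ultimately show ?thesis by (simp add: mult_right_mono)
          qed
          finally have "B k \<le> ennreal (8 * (2 powr real_of_int k) powr (1 - 1 / q) * N powr (1 / q))"
            by (simp add: mult_right_mono ennreal_leI)
          then have "ennreal ((2 powr real_of_int k) powr (\<alpha> - 1)) * B k \<le> ennreal ((2 powr real_of_int k) powr (\<alpha> - 1)) * ennreal (8 * (2 powr real_of_int k) powr (1 - 1 / q) * N powr (1 / q))"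
            by (rule mult_left_mono) simp
          also have "\<dots> = ennreal ((2 powr real_of_int k) powr (\<alpha> - 1) * (8 * (2 powr real_of_int k) powr (1 - 1 / q) * N powr (1 / q)))"
            by (simp add: ennreal_mult)
          also have "(2 powr real_of_int k) powr (\<alpha> - 1) * (8 * (2 powr real_of_int k) powr (1 - 1 / q) * N powr (1 / q)) = 8 * N powr (1 / q) * 2 powr (- (real_of_int k * (1 / p)))"
          proof -
            have "(\<alpha> - 1) + (1 - 1 / q) = - (1 / p)" using \<alpha>0(3) by simp
            then have "(2 powr real_of_int k) powr (\<alpha> - 1) * (2 powr real_of_int k) powr (1 - 1 / q) = (2 powr real_of_int k) powr (- (1 / p))"
              by (simp only: powr_add[symmetric])
            then show ?thesis by (simp add: powr_powr mult_ac)
          qed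
          finally show ?thesis by (simp add: ennreal_mult)
        qed
        show ?thesis
        proof (cases "M = 0")
          case True
          then have "ennreal ((2 powr real_of_int k) powr (\<alpha> - 1)) * B k = 0" for k using small[of k] by simp
          then have "I x \<le> 0" using I_le by simp
          then show ?thesis by simp
        next
          case False
          then have M: "0 < M" using real(1) by simp
          \<comment> \<open>The scale at which both bounds coincide, as \<open>e1\<close> records:
            below it the maximal function is better, above it the norm.\<close>
          define e where "e = (N powr (1 / q) / M) powr q"
          have e: "0 < e" using N0 M by (simp add: e_def)
          have eq: "e = N / M powr q" using N0 M q by (simp add: e_def powr_divide powr_powr)
          have e1: "e powr (- (1 / p)) * N powr (1 / q) = e powr \<alpha> * M"
          proof -
            have "e powr (1 / q) = N powr (1 / q) / M" using N0 M q by (simp add: e_def powr_powr)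
            then have "N powr (1 / q) = e powr (\<alpha> + 1 / p) * M" using M \<alpha>0(3) by simp
            then have "e powr (- (1 / p)) * N powr (1 / q) = e powr (- (1 / p)) * e powr (\<alpha> + 1 / p) * M" by simp
            also have "e powr (- (1 / p)) * e powr (\<alpha> + 1 / p) = e powr \<alpha>" unfolding powr_add[symmetric] by simp
            finally show ?thesis .
          qed
          have "isum (\<lambda>k. ennreal ((2 powr real_of_int k) powr (\<alpha> - 1)) * B k) \<le>
            isum (\<lambda>k. ennreal (8 * M) * (ennreal (2 powr (real_of_int k * \<alpha>)) * indicator {k. 2 powr real_of_int k \<le> e} k) +
              ennreal (8 * N powr (1 / q)) * (ennreal (2 powr (- (real_of_int k * (1 / p)))) * indicator {k. e \<le> 2 powr real_of_int k} k))"
          proof (rule nn_integral_mono)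
            fix k :: int
            show "ennreal ((2 powr real_of_int k) powr (\<alpha> - 1)) * B k \<le> ennreal (8 * M) * (ennreal (2 powr (real_of_int k * \<alpha>)) * indicator {k. 2 powr real_of_int k \<le> e} k) +
              ennreal (8 * N powr (1 / q)) * (ennreal (2 powr (- (real_of_int k * (1 / p)))) * indicator {k. e \<le> 2 powr real_of_int k} k)"
            proof (cases "2 powr real_of_int k \<le> e")
              case True
              then show ?thesis using small[of k] by (simp add: add_increasing2)
            next
              case False
              then show ?thesis using large[of k] by simp
            qed
          qed
          also have "\<dots> = ennreal (8 * M) * isum (\<lambda>k. ennreal (2 powr (real_of_int k * \<alpha>)) * indicator {k. 2 powr real_of_int k \<le> e} k) +
              ennreal (8 * N powr (1 / q)) * isum (\<lambda>k. ennreal (2 powr (- (real_of_int k * (1 / p)))) * indicator {k. e \<le> 2 powr real_of_int k} k)"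
            by (subst nn_integral_add) (simp_all add: isum_mult)
          also have "\<dots> \<le> ennreal (8 * M) * ennreal (e powr \<alpha> / (1 - 2 powr (- \<alpha>))) + ennreal (8 * N powr (1 / q)) * ennreal (e powr (- (1 / p)) / (1 - 2 powr (- (1 / p))))"
            using e \<alpha>0 p by (intro add_mono mult_left_mono isum_geometric isum_geometric_upper) auto
          also have "\<dots> = ennreal (8 * M * (e powr \<alpha> / (1 - 2 powr (- \<alpha>))) + 8 * N powr (1 / q) * (e powr (- (1 / p)) / (1 - 2 powr (- (1 / p)))))"
            using M N0 qa by (simp add: ennreal_mult[symmetric] ennreal_plus[symmetric] del: ennreal_plus)
          also have "8 * M * (e powr \<alpha> / (1 - 2 powr (- \<alpha>))) + 8 * N powr (1 / q) * (e powr (- (1 / p)) / (1 - 2 powr (- (1 / p)))) = K * (e powr \<alpha> * M)"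
          proof -
            have "8 * N powr (1 / q) * (e powr (- (1 / p)) / (1 - 2 powr (- (1 / p)))) = 8 * (e powr (- (1 / p)) * N powr (1 / q)) * (1 / (1 - 2 powr (- (1 / p))))"
              by simp
            also have "\<dots> = 8 * (e powr \<alpha> * M) * (1 / (1 - 2 powr (- (1 / p))))" unfolding e1 ..
            finally have x2: "8 * N powr (1 / q) * (e powr (- (1 / p)) / (1 - 2 powr (- (1 / p)))) = 8 * (e powr \<alpha> * M) * (1 / (1 - 2 powr (- (1 / p))))" .
            show ?thesis unfolding x2 by (simp add: K_def distrib_left distrib_right mult_ac)
          qed
          finally have "I x \<le> ennreal (K * (e powr \<alpha> * M))" using I_le order_trans by blast
          then have "epowr (I x) p \<le> epowr (ennreal (K * (e powr \<alpha> * M))) p" using p by (intro epowr_mono) auto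
          also have "\<dots> = ennreal ((K * (e powr \<alpha> * M)) powr p)" using K M by (intro epowr_ennreal) simp
          also have "(K * (e powr \<alpha> * M)) powr p = K powr p * N powr (\<alpha> * p) * M powr q"
          proof -
            have "p - q * (\<alpha> * p) = q"
              using q p unfolding \<alpha> by (simp add: field_simps)
            then have m1: "M powr p / (M powr q) powr (\<alpha> * p) = M powr q"
              by (simp only: powr_powr powr_diff[symmetric])
            have m2: "e powr (\<alpha> * p) = N powr (\<alpha> * p) / (M powr q) powr (\<alpha> * p)"
              unfolding eq using N0 by (simp add: powr_divide)
            have "e powr (\<alpha> * p) * M powr p = N powr (\<alpha> * p) * (M powr p / (M powr q) powr (\<alpha> * p))"
              unfolding m2 by simp
            also have "\<dots> = N powr (\<alpha> * p) * M powr q" unfolding m1 ..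
            finally have "e powr (\<alpha> * p) * M powr p = N powr (\<alpha> * p) * M powr q" .
            then show ?thesis using K M by (simp add: powr_mult powr_powr)
          qed
          finally show ?thesis using real M by (simp add: ennreal_mult epowr_ennreal)
        qed
      qed
      \<comment> \<open>The constant is moved into the argument of \<open>hl_max\<close>. The
        maximal theorem then applies directly, and no constant has to be pulled out of an integral
        of \<open>hl_max\<close>.\<close>
      define c where "c = (K powr p * N powr (\<alpha> * p)) powr (1 / q)"
      have c: "0 \<le> c" "c powr q = K powr p * N powr (\<alpha> * p)" using q K N0 by (auto simp: c_def powr_powr)
      have "(\<integral>\<^sup>+x. epowr (I x) p \<partial>lborel) \<le> (\<integral>\<^sup>+x. epowr (hl_max (\<lambda>y. ennreal c * g y) x) q \<partial>lborel)"
        using pt q c by (intro nn_integral_mono) (simp add: hl_max_cmult epowr_mult epowr_ennreal)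
      also have "\<dots> \<le> ennreal CH * (\<integral>\<^sup>+x. epowr (ennreal c * g x) q \<partial>lborel)"
        by (intro CH(2)) measurable
      also have "\<dots> = ennreal CH * (ennreal (K powr p * N powr (\<alpha> * p)) * (\<integral>\<^sup>+x. epowr (g x) q \<partial>lborel))"
        using q c by (simp add: epowr_mult epowr_ennreal nn_integral_cmult)
      also have "\<dots> = ennreal (K powr p * N powr (\<alpha> * p) * (CH * N))"
        using N CH by (simp add: ennreal_mult mult_ac)
      also have "K powr p * N powr (\<alpha> * p) * (CH * N) = K powr p * CH * N powr (p / q)"
      proof -
        have "\<alpha> * p + 1 = p / q" using q p unfolding \<alpha> by (simp add: field_simps)
        then have "N powr (\<alpha> * p) * N powr 1 = N powr (p / q)" by (simp only: powr_add[symmetric])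
        then show ?thesis using N0 by simp
      qed
      also have "ennreal (K powr p * CH * N powr (p / q)) = ennreal (K powr p * CH) * epowr (\<integral>\<^sup>+x. epowr (g x) q \<partial>lborel) (p / q)"
        using N CH by (simp add: ennreal_mult epowr_ennreal)
      finally show ?thesis unfolding I_def .
    qed
  qed
qed

subsection \<open>Hardy spaces for exponents greater than one\<close>

text \<open>For \<open>1 < p\<close> the test class has order 1, so
  \<open>grand_max_le_hl_max\<close> and the maximal theorem give the bound.\<close>

lemma hardy_norm_le_Lp:
  assumes p: "1 < p"
  obtains C where "0 < C" "\<And>g. g \<in> borel_measurable borel \<Longrightarrow>
    hardy_norm p g \<le> ennreal C * epowr (\<integral>\<^sup>+x. epowr (ennreal (norm (g x))) p \<partial>lborel) (1 / p)"
proof -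
  obtain CH where CH: "0 < CH" "\<And>g. g \<in> borel_measurable borel \<Longrightarrow>
    (\<integral>\<^sup>+x. epowr (hl_max g x) p \<partial>lborel) \<le> ennreal CH * (\<integral>\<^sup>+x. epowr (g x) p \<partial>lborel)"
    using hl_strong_type[OF p] by metis
  have "\<lfloor>1 / p\<rfloor> = 0" using p by (simp add: floor_eq_iff)
  then have n: "nat \<lfloor>1 / p\<rfloor> + 1 = 1" by simp
  show thesis
  proof (rule that[of "(2 powr p * CH) powr (1 / p)"])
    show "0 < (2 powr p * CH) powr (1 / p)" using CH by simp
    fix g :: "real \<Rightarrow> complex" assume g[measurable]: "g \<in> borel_measurable borel"
    have "(\<integral>\<^sup>+x. epowr (grand_max 1 g x) p \<partial>lborel) \<le> (\<integral>\<^sup>+x. epowr (hl_max (\<lambda>y. 2 * ennreal (norm (g y))) x) p \<partial>lborel)"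
    proof (intro nn_integral_mono epowr_mono)
      fix x
      show "grand_max 1 g x \<le> hl_max (\<lambda>y. 2 * ennreal (norm (g y))) x"
        using grand_max_le_hl_max[OF g, of x] by (subst hl_max_cmult) auto
    qed (use p in auto)
    also have "\<dots> \<le> ennreal CH * (\<integral>\<^sup>+x. epowr (2 * ennreal (norm (g x))) p \<partial>lborel)"
      by (rule CH(2)) measurable
    also have "(\<integral>\<^sup>+x. epowr (2 * ennreal (norm (g x))) p \<partial>lborel) = ennreal (2 powr p) * (\<integral>\<^sup>+x. epowr (ennreal (norm (g x))) p \<partial>lborel)"
    proof -
      have "epowr 2 p = ennreal (2 powr p)" using epowr_ennreal[of 2 p] by simp
      then have "(\<integral>\<^sup>+x. epowr (2 * ennreal (norm (g x))) p \<partial>lborel) = (\<integral>\<^sup>+x. ennreal (2 powr p) * epowr (ennreal (norm (g x))) p \<partial>lborel)"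
        using p by (simp add: epowr_mult)
      then show ?thesis by (simp add: nn_integral_cmult)
    qed
    finally have "(\<integral>\<^sup>+x. epowr (grand_max 1 g x) p \<partial>lborel) \<le> ennreal (2 powr p * CH) * (\<integral>\<^sup>+x. epowr (ennreal (norm (g x))) p \<partial>lborel)"
      using CH by (simp add: ennreal_mult mult_ac)
    then have "hardy_norm p g \<le> epowr (ennreal (2 powr p * CH) * (\<integral>\<^sup>+x. epowr (ennreal (norm (g x))) p \<partial>lborel)) (1 / p)"
      unfolding hardy_norm_def n using p by (intro epowr_mono) auto
    also have "\<dots> = ennreal ((2 powr p * CH) powr (1 / p)) * epowr (\<integral>\<^sup>+x. epowr (ennreal (norm (g x))) p \<partial>lborel) (1 / p)"
      using p CH by (subst epowr_mult) (auto simp: epowr_ennreal)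
    finally show "hardy_norm p g \<le> \<dots>" .
  qed
qed

text \<open>\<open>norm (g x) \<le> 1 + norm (g x) powr p\<close>, and the constant 1 becomes
  integrable after division by \<open>(1 + \<bar>x\<bar>) ^ 2\<close>.\<close>

lemma Lp_tempered:
  assumes p: "1 < p" and g[measurable]: "g \<in> borel_measurable borel"
    and fin: "(\<integral>\<^sup>+x. epowr (ennreal (norm (g x))) p \<partial>lborel) < top"
  shows "tempered_fun g"
  unfolding tempered_fun_def
proof (intro conjI exI[of _ 2])
  show "integrable lborel (\<lambda>x. g x /\<^sub>R (1 + \<bar>x\<bar>) ^ 2)"
  proof (rule integrableI_bounded)
    have "(\<integral>\<^sup>+x. ennreal (norm (g x /\<^sub>R (1 + \<bar>x\<bar>) ^ 2)) \<partial>lborel) \<le> (\<integral>\<^sup>+x. ennreal (1 / (1 + \<bar>x\<bar>) ^ 2) + epowr (ennreal (norm (g x))) p \<partial>lborel)"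
    proof (rule nn_integral_mono)
      fix x :: real
      have "norm (g x) \<le> 1 + norm (g x) powr p"
      proof (cases "norm (g x) \<le> 1")
        case True
        then show ?thesis by (rule order_trans) simp
      next
        case False
        then have "norm (g x) powr 1 \<le> norm (g x) powr p" using p by (intro powr_mono) auto
        then show ?thesis using False by simp
      qed
      then have "norm (g x) / (1 + \<bar>x\<bar>) ^ 2 \<le> (1 + norm (g x) powr p) / (1 + \<bar>x\<bar>) ^ 2" by (rule divide_right_mono) simp
      also have "\<dots> = 1 / (1 + \<bar>x\<bar>) ^ 2 + norm (g x) powr p / (1 + \<bar>x\<bar>) ^ 2" by (rule add_divide_distrib)
      also have "\<dots> \<le> 1 / (1 + \<bar>x\<bar>) ^ 2 + norm (g x) powr p"
        by (intro add_left_mono) (simp add: divide_le_eq mult_le_cancel_left1 one_le_power)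
      finally have "norm (g x /\<^sub>R (1 + \<bar>x\<bar>) ^ 2) \<le> 1 / (1 + \<bar>x\<bar>) ^ 2 + norm (g x) powr p"
        by (simp add: divide_inverse mult.commute abs_inverse)
      then have "ennreal (norm (g x /\<^sub>R (1 + \<bar>x\<bar>) ^ 2)) \<le> ennreal (1 / (1 + \<bar>x\<bar>) ^ 2 + norm (g x) powr p)" by (rule ennreal_leI)
      then show "ennreal (norm (g x /\<^sub>R (1 + \<bar>x\<bar>) ^ 2)) \<le> ennreal (1 / (1 + \<bar>x\<bar>) ^ 2) + epowr (ennreal (norm (g x))) p"
        by (simp add: epowr_ennreal)
    qed
    also have "\<dots> = (\<integral>\<^sup>+x. ennreal (1 / (1 + \<bar>x\<bar>) ^ 2) \<partial>(lborel::real measure)) + (\<integral>\<^sup>+x. epowr (ennreal (norm (g x))) p \<partial>lborel)"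
      by (rule nn_integral_add) measurable
    also have "(\<integral>\<^sup>+x. ennreal (1 / (1 + \<bar>x\<bar>) ^ 2) \<partial>(lborel::real measure)) = ennreal (LINT x|lborel. 1 / (1 + \<bar>x\<bar>) ^ 2)"
      by (rule nn_integral_eq_integral[OF integrable_decay]) simp
    finally show "(\<integral>\<^sup>+x. ennreal (norm (g x /\<^sub>R (1 + \<bar>x\<bar>) ^ 2)) \<partial>lborel) < \<infinity>"
      using fin by (auto simp: less_top[symmetric] top_unique)
  qed measurable
qed (use g in simp)

section \<open>Assembly for both ranges of the exponent\<close>

lemma lip_space_bound:
  assumes \<alpha>: "0 < \<alpha>" and b: "b \<in> lip_space \<alpha>"
  shows "norm ((fwd_diff t ^^ (nat \<lfloor>\<alpha>\<rfloor> + 1)) b y) \<le> enn2real (lip_norm \<alpha> b) * \<bar>t\<bar> powr \<alpha>"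
proof (cases "t = 0")
  case True
  have "(fwd_diff 0 ^^ (nat \<lfloor>\<alpha>\<rfloor> + 1)) b y = 0" by (simp add: fwd_diff_def)
  then show ?thesis using True by simp
next
  case False
  have fin: "lip_norm \<alpha> b < top" using b by (simp add: lip_space_def)
  have "ennreal (norm ((fwd_diff t ^^ (nat \<lfloor>\<alpha>\<rfloor> + 1)) b y) / \<bar>t\<bar> powr \<alpha>) \<le> lip_norm \<alpha> b"
    unfolding lip_norm_def
    by (rule order_trans[OF _ SUP_upper[of y]], simp, rule order_trans[OF _ SUP_upper[of t]]) (use False in auto)
  also have "\<dots> = ennreal (enn2real (lip_norm \<alpha> b))" using fin by simp
  finally have "norm ((fwd_diff t ^^ (nat \<lfloor>\<alpha>\<rfloor> + 1)) b y) / \<bar>t\<bar> powr \<alpha> \<le> enn2real (lip_norm \<alpha> b)"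
    by (subst (asm) ennreal_le_iff) auto
  then show ?thesis using False by (simp add: pos_divide_le_eq)
qed

lemma H_op_measurable:
  assumes "continuous_on UNIV b" "f \<in> borel_measurable borel"
  shows "H_op \<beta> b f \<in> borel_measurable borel"
proof -
  have [measurable]: "b \<in> borel_measurable borel" "f \<in> borel_measurable borel"
    using assms by (auto intro: borel_measurable_continuous_onI)
  have "(\<lambda>(x, s). H_integrand \<beta> b f x s) \<in> borel_measurable (borel \<Otimes>\<^sub>M lborel)"
    unfolding H_integrand_def by measurable
  from lborel.borel_measurable_lebesgue_integral[OF this] show ?thesis
    by (simp add: H_op_def[abs_def])
qed

lemma C_k_1D:
  assumes "C_k 1 b"
  obtains b' where "\<And>x. (b has_vector_derivative b' x) (at x)" "continuous_on UNIV b'"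
proof
  show "(b has_vector_derivative nth_deriv 1 b x) (at x)" for x
    using assms by (simp add: C_k_def nth_deriv_def vector_derivative_works)
  show "continuous_on UNIV (nth_deriv 1 b)" using assms by (simp add: C_k_def)
qed

lemma hardy_space_integral:
  assumes "0 < q" "f \<in> hardy_space q"
  shows "(\<integral>\<^sup>+x. epowr (grand_max (nat \<lfloor>1 / q\<rfloor> + 1) f x) q \<partial>lborel) < top"
    "epowr (hardy_norm q f) q = (\<integral>\<^sup>+x. epowr (grand_max (nat \<lfloor>1 / q\<rfloor> + 1) f x) q \<partial>lborel)"
proof -
  show 1: "(\<integral>\<^sup>+x. epowr (grand_max (nat \<lfloor>1 / q\<rfloor> + 1) f x) q \<partial>lborel) < top"
    using assms by (simp add: hardy_space_def hardy_norm_def)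
  show "epowr (hardy_norm q f) q = (\<integral>\<^sup>+x. epowr (grand_max (nat \<lfloor>1 / q\<rfloor> + 1) f x) q \<partial>lborel)"
    using assms(1) by (simp add: hardy_norm_def epowr_epowr)
qed

lemma H_op_Lp_le_1:
  assumes p: "1 < p" and q: "0 < q" "q \<le> 1" and \<alpha>: "\<alpha> = 1 / q - 1 / p"
  obtains C N where "0 < C" "\<And>\<beta> b f. b \<in> lip_space \<alpha> \<Longrightarrow> C_k 1 b \<Longrightarrow> f \<in> hardy_space q \<Longrightarrow> C_k 1 f \<Longrightarrow>
    (AE x in lborel. integrable lborel (H_integrand \<beta> b f x)) \<Longrightarrow>
    (\<integral>\<^sup>+x. epowr (ennreal (norm (H_op \<beta> b f x))) p \<partial>lborel)
      \<le> epowr (ennreal (C * (1 + \<bar>\<beta>\<bar>) ^ N) * lip_norm \<alpha> b * hardy_norm q f) p"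
proof -
  have "1 / p < 1" "1 \<le> 1 / q" using p q by simp_all
  then have \<alpha>0: "0 < \<alpha>" unfolding \<alpha> by linarith
  have rel: "1 / q = \<alpha> + 1 / p" unfolding \<alpha> by simp
  have "0 < 1 / p" using p by simp
  then have lt: "\<alpha> < 1 / q" unfolding rel by linarith
  \<comment> \<open>The order of the differences in \<open>lip_norm\<close>. It is at most
    \<open>\<alpha> + 1\<close>, as the growth estimate requires.\<close>
  define m where "m = nat \<lfloor>\<alpha>\<rfloor> + 1"
  have m12: "1 \<le> m" "real m \<le> \<alpha> + 1" using \<alpha>0 by (simp_all add: m_def)
  define n where "n = nat \<lfloor>1 / q\<rfloor> + 1"
  obtain \<Phi> r where K: "diff_kernel m r \<Phi>" "(LINT u|lborel. \<Phi> 0 u) = 1" "0 \<le> r" by (rule diff_kernel_exists)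
  interpret smoothing m r \<Phi> \<alpha> by standard (use K m12 \<alpha>0 in auto)
  obtain C1 where C1: "0 \<le> C1" "\<And>b b' A \<beta> f x q. (\<forall>x. (b has_vector_derivative b' x) (at x)) \<Longrightarrow> continuous_on UNIV b' \<Longrightarrow>
     (\<forall>t y. norm ((fwd_diff t ^^ m) b y) \<le> A * \<bar>t\<bar> powr \<alpha>) \<Longrightarrow> 0 \<le> A \<Longrightarrow> continuous_on UNIV f \<Longrightarrow>
     0 < q \<Longrightarrow> \<alpha> < 1 / q \<Longrightarrow> (\<integral>\<^sup>+x. epowr (grand_max n f x) q \<partial>lborel) < top \<Longrightarrow>
     integrable lborel (H_integrand \<beta> b f x) \<Longrightarrow>
     ennreal (norm (H_op \<beta> b f x)) \<le> ennreal (C1 * A * (1 + \<bar>\<beta>\<bar>) ^ (n + 2)) *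
       isum (\<lambda>j. \<integral>\<^sup>+u. ennreal (kern \<alpha> j (x - u)) * level_sum (grand_max n f) (2 powr real_of_int j) u \<partial>lborel)"
    using H_op_pointwise[OF m12(2), of n] by blast
  obtain C2 where C2: "0 < C2" "\<And>F. (\<And>t. open {z. t < F z}) \<Longrightarrow> (\<integral>\<^sup>+x. epowr (F x) q \<partial>lborel) < top \<Longrightarrow>
    (\<integral>\<^sup>+x. epowr (isum (\<lambda>j. \<integral>\<^sup>+u. ennreal (kern \<alpha> j (x - u)) * level_sum F (2 powr real_of_int j) u \<partial>lborel)) p \<partial>lborel)
      \<le> ennreal C2 * epowr (\<integral>\<^sup>+x. epowr (F x) q \<partial>lborel) (p / q)"
    by (rule level_sum_Lp[OF \<alpha>0 p q rel]) blast
  show thesis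
  \<comment> \<open>\<open>C1 + 1\<close> because \<open>C1\<close> is only known to be nonnegative
    and the constant has to be positive.\<close>
  proof (rule that[of "(C1 + 1) * C2 powr (1 / p)" "n + 2"])
    show "0 < (C1 + 1) * C2 powr (1 / p)" using C1 C2 by simp
    fix \<beta> b f
    assume b: "b \<in> lip_space \<alpha>" "C_k 1 b" and f: "f \<in> hardy_space q" "C_k 1 f"
      and ae: "AE x in lborel. integrable lborel (H_integrand \<beta> b f x)"
    obtain b' where b': "\<And>x. (b has_vector_derivative b' x) (at x)" "continuous_on UNIV b'" by (rule C_k_1D[OF b(2)]) blast
    obtain f' where "\<And>x. (f has_vector_derivative f' x) (at x)" "continuous_on UNIV f'" by (rule C_k_1D[OF f(2)]) blast
    then have fc: "continuous_on UNIV f" by (meson continuous_on_vector_derivative has_vector_derivative_at_within)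
    define A where "A = enn2real (lip_norm \<alpha> b)"
    have A: "lip_norm \<alpha> b = ennreal A" "0 \<le> A" using b(1) by (auto simp: A_def lip_space_def)
    note F = hardy_space_integral[OF q(1) f(1), folded n_def]
    define T where "T x = isum (\<lambda>j. \<integral>\<^sup>+u. ennreal (kern \<alpha> j (x - u)) * level_sum (grand_max n f) (2 powr real_of_int j) u \<partial>lborel)" for x
    have [measurable]: "T \<in> borel_measurable borel"
      unfolding T_def[abs_def] level_sum_def by measurable
    define a where "a = (C1 + 1) * A * (1 + \<bar>\<beta>\<bar>) ^ (n + 2)"
    have a: "0 \<le> a" using C1 A by (simp add: a_def)
    have "(\<integral>\<^sup>+x. epowr (ennreal (norm (H_op \<beta> b f x))) p \<partial>lborel) \<le> (\<integral>\<^sup>+x. epowr (ennreal a * T x) p \<partial>lborel)"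
    proof (rule nn_integral_mono_AE, use ae in eventually_elim)
      fix x assume int: "integrable lborel (H_integrand \<beta> b f x)"
      have "ennreal (norm (H_op \<beta> b f x)) \<le> ennreal (C1 * A * (1 + \<bar>\<beta>\<bar>) ^ (n + 2)) * T x"
        unfolding T_def
        by (rule C1(2)[OF _ b'(2) _ A(2) fc q(1) _ F(1) int])
          (use b'(1) lip_space_bound[OF \<alpha>0 b(1)] lt in \<open>auto simp: A_def m_def\<close>)
      also have "\<dots> \<le> ennreal a * T x"
        unfolding a_def using A by (intro mult_right_mono ennreal_leI mult_right_mono) auto
      finally show "epowr (ennreal (norm (H_op \<beta> b f x))) p \<le> epowr (ennreal a * T x) p"
        using p by (intro epowr_mono) auto
    qed
    also have "\<dots> = ennreal (a powr p) * (\<integral>\<^sup>+x. epowr (T x) p \<partial>lborel)"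
      using p a by (simp add: epowr_mult epowr_ennreal nn_integral_cmult)
    also have "\<dots> \<le> ennreal (a powr p) * (ennreal C2 * epowr (epowr (hardy_norm q f) q) (p / q))"
      unfolding T_def F(2) by (intro mult_left_mono C2(2) grand_max_open F(1)) simp
    also have "epowr (epowr (hardy_norm q f) q) (p / q) = epowr (hardy_norm q f) p"
      using q p by (simp add: epowr_epowr)
    also have "ennreal (a powr p) * (ennreal C2 * epowr (hardy_norm q f) p) = epowr (ennreal (a * C2 powr (1 / p)) * hardy_norm q f) p"
    proof -
      have "(C2 powr (1 / p)) powr p = C2" using C2 p by (simp add: powr_powr)
      then show ?thesis using p a C2 by (simp add: epowr_mult epowr_ennreal ennreal_mult mult.assoc)
    qed
    also have "ennreal (a * C2 powr (1 / p)) = ennreal ((C1 + 1) * C2 powr (1 / p) * (1 + \<bar>\<beta>\<bar>) ^ (n + 2)) * lip_norm \<alpha> b"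
      unfolding A(1) using A(2) C1 by (subst ennreal_mult[symmetric]) (auto simp: a_def mult_ac)
    finally show "(\<integral>\<^sup>+x. epowr (ennreal (norm (H_op \<beta> b f x))) p \<partial>lborel)
      \<le> epowr (ennreal ((C1 + 1) * C2 powr (1 / p) * (1 + \<bar>\<beta>\<bar>) ^ (n + 2)) * lip_norm \<alpha> b * hardy_norm q f) p" .
  qed
qed

text \<open>Here \<alpha> < 1, so \<open>lip_norm\<close> is a Hoelder seminorm and the kernel is at
  most a multiple of \<open>\<bar>x - s\<bar> powr (\<alpha> - 1)\<close>. The bound follows from
  \<open>riesz_Lp\<close> applied to \<open>norm (f s)\<close>, without cancellation.\<close>

lemma H_op_Lp_gt_1:
  assumes q: "1 < q" "q < p" and \<alpha>: "\<alpha> = 1 / q - 1 / p"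
  obtains C where "0 < C" "\<And>\<beta> b f. b \<in> lip_space \<alpha> \<Longrightarrow> f \<in> hardy_space q \<Longrightarrow> C_k 1 f \<Longrightarrow>
    (\<integral>\<^sup>+x. epowr (ennreal (norm (H_op \<beta> b f x))) p \<partial>lborel)
      \<le> epowr (ennreal (C * (1 + \<bar>\<beta>\<bar>) ^ 1) * lip_norm \<alpha> b * hardy_norm q f) p"
proof -
  have p: "1 < p" using q by simp
  have \<alpha>0: "0 < \<alpha>" "\<alpha> < 1"
  proof -
    show "0 < \<alpha>" using q by (simp add: \<alpha> frac_less2)
    have "1 / q < 1" "0 < 1 / p" using q by simp_all
    then show "\<alpha> < 1" unfolding \<alpha> by linarith
  qed
  define n where "n = nat \<lfloor>1 / q\<rfloor> + 1"
  obtain C1 where C1: "0 < C1" "\<And>g. g \<in> borel_measurable borel \<Longrightarrow> (\<integral>\<^sup>+x. epowr (g x) q \<partial>lborel) < top \<Longrightarrow>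
    (\<integral>\<^sup>+x. epowr (\<integral>\<^sup>+s. ennreal (\<bar>x - s\<bar> powr (\<alpha> - 1)) * g s \<partial>lborel) p \<partial>lborel)
      \<le> ennreal C1 * epowr (\<integral>\<^sup>+x. epowr (g x) q \<partial>lborel) (p / q)"
    by (rule riesz_Lp[OF q \<alpha>]) blast
  obtain c where c: "0 < c" "\<And>f x. continuous_on UNIV f \<Longrightarrow> ennreal (norm (f x :: complex)) \<le> ennreal c * grand_max n f x"
    by (rule norm_le_grand_max[of n]) blast
  show thesis
  proof (rule that[of "C1 powr (1 / p) * c"])
    show "0 < C1 powr (1 / p) * c" using C1 c by simp
    fix \<beta> b f
    assume b: "b \<in> lip_space \<alpha>" and f: "f \<in> hardy_space q" "C_k 1 f"
    obtain f' where "\<And>x. (f has_vector_derivative f' x) (at x)" "continuous_on UNIV f'" by (rule C_k_1D[OF f(2)]) blast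
    then have fc: "continuous_on UNIV f" by (meson continuous_on_vector_derivative has_vector_derivative_at_within)
    then have [measurable]: "f \<in> borel_measurable borel" by (rule borel_measurable_continuous_onI)
    define A where "A = enn2real (lip_norm \<alpha> b)"
    have A: "lip_norm \<alpha> b = ennreal A" "0 \<le> A" using b(1) by (auto simp: A_def lip_space_def)
    note F = hardy_space_integral[OF q(1)[THEN less_trans[OF zero_less_one]] f(1), folded n_def]
    define G where "G = (\<integral>\<^sup>+x. epowr (ennreal (norm (f x))) q \<partial>lborel)"
    have G: "G \<le> epowr (ennreal c * hardy_norm q f) q"
    proof -
      have "G \<le> (\<integral>\<^sup>+x. epowr (ennreal c * grand_max n f x) q \<partial>lborel)"
        unfolding G_def using q by (intro nn_integral_mono epowr_mono c(2) fc) auto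
      also have "\<dots> = epowr (ennreal c) q * epowr (hardy_norm q f) q"
        unfolding F(2) using q by (subst epowr_mult) (simp_all add: nn_integral_cmult)
      also have "\<dots> = epowr (ennreal c * hardy_norm q f) q" using q by (simp add: epowr_mult)
      finally show ?thesis .
    qed
    also have "\<dots> < top" using f(1) by (simp add: hardy_space_def ennreal_mult_less_top)
    finally have Gfin: "G < top" .
    define a where "a = A * (1 + \<bar>\<beta>\<bar>)"
    have a: "0 \<le> a" using A by (simp add: a_def)
    define I where "I x = (\<integral>\<^sup>+s. ennreal (\<bar>x - s\<bar> powr (\<alpha> - 1)) * ennreal (norm (f s)) \<partial>lborel)" for x
    have [measurable]: "I \<in> borel_measurable borel" unfolding I_def[abs_def] by measurable
    have floor: "nat \<lfloor>\<alpha>\<rfloor> + 1 = 1" using \<alpha>0 by (simp add: floor_eq_iff)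
    have "(\<integral>\<^sup>+x. epowr (ennreal (norm (H_op \<beta> b f x))) p \<partial>lborel) \<le> (\<integral>\<^sup>+x. epowr (ennreal a * I x) p \<partial>lborel)"
    proof (intro nn_integral_mono epowr_mono)
      fix x
      have "ennreal (norm (H_op \<beta> b f x)) \<le> (\<integral>\<^sup>+s. ennreal (norm (H_integrand \<beta> b f x s)) \<partial>lborel)"
        unfolding H_op_def by (rule norm_integral_le_nn_integral)
      also have "\<dots> \<le> (\<integral>\<^sup>+s. ennreal a * (ennreal (\<bar>x - s\<bar> powr (\<alpha> - 1)) * ennreal (norm (f s))) \<partial>lborel)"
      proof (rule nn_integral_mono_AE, use AE_lborel_singleton[of x] in eventually_elim)
        fix s assume s: "s \<noteq> x"
        have "norm (b (x + \<beta> * (s - x)) - b x) \<le> A * \<bar>\<beta> * (s - x)\<bar> powr \<alpha>"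
          using lip_space_bound[OF \<alpha>0(1) b, of "\<beta> * (s - x)" x] unfolding floor by (simp add: A_def fwd_diff_def)
        also have "\<bar>\<beta> * (s - x)\<bar> powr \<alpha> = \<bar>\<beta>\<bar> powr \<alpha> * \<bar>x - s\<bar> powr \<alpha>"
          by (simp add: abs_mult powr_mult abs_minus_commute)
        also have "A * (\<bar>\<beta>\<bar> powr \<alpha> * \<bar>x - s\<bar> powr \<alpha>) \<le> a * \<bar>x - s\<bar> powr \<alpha>"
        proof -
          \<comment> \<open>As \<alpha> < 1 and \<open>1 \<le> 1 + \<bar>\<beta>\<bar>\<close>, the
            fractional power is replaced by the first power, to match the polynomial form of the
            other range.\<close>
          have "\<bar>\<beta>\<bar> powr \<alpha> \<le> (1 + \<bar>\<beta>\<bar>) powr \<alpha>" using \<alpha>0 by (intro powr_mono2) auto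
          also have "\<dots> \<le> (1 + \<bar>\<beta>\<bar>) powr 1" using \<alpha>0 by (intro powr_mono) auto
          finally have "A * \<bar>\<beta>\<bar> powr \<alpha> \<le> a" unfolding a_def using A by (intro mult_left_mono) auto
          then have "A * \<bar>\<beta>\<bar> powr \<alpha> * \<bar>x - s\<bar> powr \<alpha> \<le> a * \<bar>x - s\<bar> powr \<alpha>" by (rule mult_right_mono) simp
          then show ?thesis by (simp only: mult.assoc)
        qed
        finally have "norm (b (x + \<beta> * (s - x)) - b x) * norm (f s) / \<bar>x - s\<bar> \<le> a * \<bar>x - s\<bar> powr \<alpha> * norm (f s) / \<bar>x - s\<bar>"
          by (intro divide_right_mono mult_right_mono) auto
        also have "\<dots> = a * (\<bar>x - s\<bar> powr (\<alpha> - 1) * norm (f s))" using s by (simp add: powr_diff)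
        finally have "norm (H_integrand \<beta> b f x s) \<le> a * (\<bar>x - s\<bar> powr (\<alpha> - 1) * norm (f s))"
          by (simp add: H_integrand_def norm_divide norm_mult flip: of_real_diff)
        then show "ennreal (norm (H_integrand \<beta> b f x s)) \<le> ennreal a * (ennreal (\<bar>x - s\<bar> powr (\<alpha> - 1)) * ennreal (norm (f s)))"
          using a by (simp add: ennreal_mult[symmetric] ennreal_leI)
      qed
      also have "\<dots> = ennreal a * I x" unfolding I_def by (rule nn_integral_cmult) measurable
      finally show "ennreal (norm (H_op \<beta> b f x)) \<le> ennreal a * I x" .
    qed (use p in auto)
    also have "\<dots> = ennreal (a powr p) * (\<integral>\<^sup>+x. epowr (I x) p \<partial>lborel)"
      using p a by (simp add: epowr_mult epowr_ennreal nn_integral_cmult)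
    also have "\<dots> \<le> ennreal (a powr p) * (ennreal C1 * epowr G (p / q))"
      unfolding I_def G_def using Gfin by (intro mult_left_mono C1(2)) (auto simp: G_def)
    also have "\<dots> \<le> ennreal (a powr p) * (ennreal C1 * epowr (epowr (ennreal c * hardy_norm q f) q) (p / q))"
      using p q by (intro mult_left_mono epowr_mono G) auto
    also have "epowr (epowr (ennreal c * hardy_norm q f) q) (p / q) = epowr (ennreal c * hardy_norm q f) p"
      using q p by (simp add: epowr_epowr)
    also have "ennreal (a powr p) * (ennreal C1 * epowr (ennreal c * hardy_norm q f) p) = epowr (ennreal (a * C1 powr (1 / p) * c) * hardy_norm q f) p"
    proof -
      have "(C1 powr (1 / p)) powr p = C1" using C1 p by (simp add: powr_powr)
      then show ?thesis using p a C1 c by (simp add: epowr_mult epowr_ennreal ennreal_mult mult.assoc)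
    qed
    also have "ennreal (a * C1 powr (1 / p) * c) = ennreal (C1 powr (1 / p) * c * (1 + \<bar>\<beta>\<bar>) ^ 1) * lip_norm \<alpha> b"
      unfolding A(1) using A(2) C1 c by (subst ennreal_mult[symmetric]) (auto simp: a_def mult_ac)
    finally show "(\<integral>\<^sup>+x. epowr (ennreal (norm (H_op \<beta> b f x))) p \<partial>lborel)
      \<le> epowr (ennreal (C1 powr (1 / p) * c * (1 + \<bar>\<beta>\<bar>) ^ 1) * lip_norm \<alpha> b * hardy_norm q f) p" .
  qed
qed

theorem proposition13:
  fixes p q \<alpha> :: real
  assumes "1 < p" and "0 < q" and "q < p" and "\<alpha> = 1 / q - 1 / p"
  shows "\<exists>(C :: real \<Rightarrow> real) (N :: nat).
    (\<forall>\<beta>. 0 < C \<beta>) \<and>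
    (\<forall>K. compact K \<longrightarrow> bdd_above (C ` K)) \<and>
    (\<forall>\<beta> b f.
       b \<in> lip_space \<alpha> \<longrightarrow> C_k N b \<longrightarrow>
       f \<in> hardy_space q \<longrightarrow> C_k N f \<longrightarrow>
       (AE x in lborel. integrable lborel (H_integrand \<beta> b f x)) \<longrightarrow>
         H_op \<beta> b f \<in> hardy_space p \<and>
         hardy_norm p (H_op \<beta> b f) \<le> ennreal (C \<beta>) * hardy_norm q f * lip_norm \<alpha> b)"
proof -
  obtain C0 M where C0: "0 < C0" "\<And>\<beta> b f. b \<in> lip_space \<alpha> \<Longrightarrow> C_k 1 b \<Longrightarrow> f \<in> hardy_space q \<Longrightarrow> C_k 1 f \<Longrightarrow>
    (AE x in lborel. integrable lborel (H_integrand \<beta> b f x)) \<Longrightarrow>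
    (\<integral>\<^sup>+x. epowr (ennreal (norm (H_op \<beta> b f x))) p \<partial>lborel)
      \<le> epowr (ennreal (C0 * (1 + \<bar>\<beta>\<bar>) ^ M) * lip_norm \<alpha> b * hardy_norm q f) p"
  proof (cases "q \<le> 1")
    case True
    show thesis by (rule H_op_Lp_le_1[OF assms(1,2) True assms(4)]) (rule that, blast+)
  next
    case False
    then have q1: "1 < q" by simp
    show thesis by (rule H_op_Lp_gt_1[OF q1 assms(3,4)]) (rule that[of _ 1], blast+)
  qed
  obtain C1 where C1: "0 < C1" "\<And>g. g \<in> borel_measurable borel \<Longrightarrow>
    hardy_norm p g \<le> ennreal C1 * epowr (\<integral>\<^sup>+x. epowr (ennreal (norm (g x))) p \<partial>lborel) (1 / p)"
    by (rule hardy_norm_le_Lp[OF assms(1)]) blast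
  \<comment> \<open>Polynomial in \<open>\<bar>\<beta>\<bar>\<close>, hence continuous and bounded
    on compact sets.\<close>
  define C where "C \<beta> = C1 * (C0 * (1 + \<bar>\<beta>\<bar>) ^ M)" for \<beta> :: real
  show ?thesis
  \<comment> \<open>The second witness is the smoothness order: one continuous derivative of
    \<open>b\<close> and of \<open>f\<close>.\<close>
  proof (intro exI[of _ C] exI[of _ 1] conjI allI impI)
    show "0 < C \<beta>" for \<beta> using C0 C1 by (simp add: C_def add_pos_nonneg)
    show "bdd_above (C ` K)" if "compact K" for K
    proof -
      have "continuous_on K C" unfolding C_def[abs_def] by (intro continuous_intros)
      then have "compact (C ` K)" using that by (rule compact_continuous_image)
      then show ?thesis by (intro bounded_imp_bdd_above compact_imp_bounded)
    qed
    fix \<beta> b f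
    assume b: "b \<in> lip_space \<alpha>" "C_k 1 b" and f: "f \<in> hardy_space q" "C_k 1 f"
      and ae: "AE x in lborel. integrable lborel (H_integrand \<beta> b f x)"
    have bc: "continuous_on UNIV b" using b(1) by (simp add: lip_space_def)
    have fm: "f \<in> borel_measurable borel" using f(1) by (simp add: hardy_space_def tempered_fun_def)
    have Hm: "H_op \<beta> b f \<in> borel_measurable borel" by (rule H_op_measurable[OF bc fm])
    define X where "X = ennreal (C0 * (1 + \<bar>\<beta>\<bar>) ^ M) * lip_norm \<alpha> b * hardy_norm q f"
    have X: "(\<integral>\<^sup>+x. epowr (ennreal (norm (H_op \<beta> b f x))) p \<partial>lborel) \<le> epowr X p"
      unfolding X_def by (rule C0(2)[OF b f ae])
    have Xfin: "X < top" using b(1) f(1) by (simp add: X_def lip_space_def hardy_space_def ennreal_mult_less_top)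
    have "hardy_norm p (H_op \<beta> b f) \<le> ennreal C1 * epowr (epowr X p) (1 / p)"
      by (rule order_trans[OF C1(2)[OF Hm]]) (use assms X in \<open>auto intro!: mult_left_mono epowr_mono\<close>)
    also have "epowr (epowr X p) (1 / p) = X" using assms by (simp add: epowr_epowr)
    finally have le: "hardy_norm p (H_op \<beta> b f) \<le> ennreal C1 * X" .
    also have "ennreal C1 * X = ennreal (C \<beta>) * hardy_norm q f * lip_norm \<alpha> b"
      using C0 C1 by (simp add: X_def C_def ennreal_mult mult_ac)
    finally show "hardy_norm p (H_op \<beta> b f) \<le> ennreal (C \<beta>) * hardy_norm q f * lip_norm \<alpha> b" .
    have "ennreal C1 * X < top" using Xfin by (simp add: ennreal_mult_less_top)
    then have "hardy_norm p (H_op \<beta> b f) < \<infinity>" using le by (simp add: order_le_less_trans)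
    moreover have "tempered_fun (H_op \<beta> b f)"
      by (rule Lp_tempered[OF assms(1) Hm order_le_less_trans[OF X]]) (simp add: Xfin)
    ultimately show "H_op \<beta> b f \<in> hardy_space p" by (simp add: hardy_space_def)
  qed
qed

end
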